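(* Let $0<\lambda<1$, $p\in(1,\infty)$ and let $g$ be analytic on $\mathbb{D}$. If $T_g:\mathcal{L}^{2,\lambda}_0\to B_0$ is bounded, then $$\|T_g\|_{e,\mathcal{L}^{2,\lambda}_0\to B_0}\approx\limsup_{|a|\to1}\Big(\int_{\mathbb{D}}\Big(\frac{1-|a|^2}{|1-\overline{a}z|^2}\Big)^{p+1-\lambda}|g'(z)|^2(1-|z|^2)^p\,dm(z)\Big)^{1/2}.$$
   Context: $\mathbb{D}$ is the open unit disc in $\mathbb{C}$, $\partial\mathbb{D}$ the unit circle, $H(\mathbb{D})$ the space of analytic functions on $\mathbb{D}$, $dm(z)=\frac1\pi dx\,dy$; $a$ ranges over $\mathbb{D}$. For an arc $I\subset\partial\mathbb{D}$, $|I|=\frac1{2\pi}\int_I|d\zeta|$ is its normalized length, $f_I=\frac1{|I|}\int_I f(\zeta)\frac{|d\zeta|}{2\pi}$, and $S(I)=\{z\in\mathbb{D}:1-|I|\le|z|<1,\ z/|z|\in I\}$ is its Carleson box (with $S(\partial\mathbb{D})=\mathbb{D}$). Analytic Morrey space: $\mathcal{L}^{2,\lambda}$ is the set of $f$ in the Hardy space $H^2$ (boundary values are used on $\partial\mathbb{D}$) with $\sup_{I\subset\partial\mathbb{D}}\frac1{|I|^\lambda}\int_I|f(\zeta)-f_I|^2\frac{|d\zeta|}{2\pi}<\infty$. For $0<\lambda<1$ it is known that $f\in H(\mathbb{D})$ lies in $\mathcal{L}^{2,\lambda}$ iff $\|f\|_{\mathcal{L}^{2,\lambda}}=|f(0)|+\sup_{I\subset\partial\mathbb{D}}\big(\frac1{|I|^\lambda}\int_{S(I)}|f'(z)|^2(1-|z|^2)\,dm(z)\big)^{1/2}<\infty$,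 and this is the norm used. The little Morrey space $\mathcal{L}^{2,\lambda}_0$ is the subspace of $f\in\mathcal{L}^{2,\lambda}$ with $\lim_{|I|\to0}\frac1{|I|^\lambda}\int_I|f(\zeta)-f_I|^2\frac{|d\zeta|}{2\pi}=0$, with the same norm. Bloch space: $B=\{f\in H(\mathbb{D}):\|f\|_B=\sup_{z\in\mathbb{D}}(1-|z|^2)|f'(z)|<\infty\}$, a Banach space with norm $|f(0)|+\|f\|_B$; the little Bloch space $B_0$ is the closed subspace of $f\in B$ with $\lim_{|z|\to1^-}(1-|z|^2)|f'(z)|=0$. For $g\in H(\mathbb{D})$, $T_gf(z)=\int_0^z f(w)g'(w)\,dw$ for $f\in H(\mathbb{D})$, $z\in\mathbb{D}$. That $T_g:X\to Y$ is bounded means it maps $X$ into $Y$ and is a bounded linear operator. The essential norm of a bounded operator $T:X\to Y$ between Banach spaces is $\|T\|_{e,X\to Y}=\inf\{\|T-K\|_{X\to Y}: K:X\to Y \text{ compact}\}$. $F\approx G$ means $C^{-1}G\le F\le CG$ with a constant $C>0$ depending only on $p,\lambda$. *)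

theory Defs
  imports "HOL-Complex_Analysis.Complex_Analysis"
begin

text \<open>
  Analytic functions on the unit disc are represented by functions on the complex plane that
  vanish outside the disc, so that equality in the function spaces below is equality on the disc.
\<close>

abbreviation unit_disc :: "complex set" where
  "unit_disc \<equiv> ball 0 1"

definition analytic_disc :: "(complex \<Rightarrow> complex) set" where
  "analytic_disc = {f. f holomorphic_on unit_disc \<and> (\<forall>z. z \<notin> unit_disc \<longrightarrow> f z = 0)}"

text \<open>
  Norms, suprema and integrals of nonnegative functions take values in \<^typ>\<open>ennreal\<close>, so that
  divergence is never confused with the value 0.
\<close>

definition ennreal_sqrt :: "ennreal \<Rightarrow> ennreal" where
  "ennreal_sqrt x = (if x = \<infinity> then \<infinity> else ennreal (sqrt (enn2real x)))"

text \<open>The integral over a subset of the plane with respect to \<open>dm = dx dy / pi\<close>.\<close>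

definition area_integral :: "complex set \<Rightarrow> (complex \<Rightarrow> real) \<Rightarrow> ennreal" where
  "area_integral A u = ennreal (1 / pi) * (\<integral>\<^sup>+z\<in>A. ennreal (u z) \<partial>lebesgue)"

text \<open>The filter expressing \<open>|z| \<rightarrow> 1\<close> from inside the disc.\<close>

definition at_unit_circle :: "complex filter" where
  "at_unit_circle = filtercomap cmod (at_left 1)"


subsection \<open>Hardy space and Morrey spaces\<close>

definition hardy2 :: "(complex \<Rightarrow> complex) set" where
  "hardy2 = {f \<in> analytic_disc.
     (SUP r\<in>{0..<1}. ennreal (1 / (2 * pi)) *
        (\<integral>\<^sup>+t\<in>{0..2 * pi}. ennreal ((cmod (f (of_real r * cis t)))\<^sup>2) \<partial>lebesgue)) < \<infinity>}"

text \<open>Radial limits; for functions in the Hardy space they exist almost everywhere.\<close>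

definition boundary_value :: "(complex \<Rightarrow> complex) \<Rightarrow> complex \<Rightarrow> complex" where
  "boundary_value f \<zeta> = Lim (at_left 1) (\<lambda>r::real. f (of_real r * \<zeta>))"

text \<open>
  The pair \<open>(\<alpha>, h)\<close> with \<open>0 < h \<le> 1\<close> stands for the arc \<open>I = {cis t | \<alpha> \<le> t \<le> \<alpha> + 2 pi h}\<close>, whose
  normalized length \<open>|I|\<close> is \<open>h\<close>. The value \<open>h = 1\<close> gives the full circle.
\<close>

definition arc_angles :: "real \<Rightarrow> real \<Rightarrow> real set" where
  "arc_angles \<alpha> h = {\<alpha>..\<alpha> + 2 * pi * h}"

definition arc_mean :: "(complex \<Rightarrow> complex) \<Rightarrow> real \<Rightarrow> real \<Rightarrow> complex" where
  "arc_mean f \<alpha> h =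
     of_real (1 / (2 * pi * h)) * (LINT t:arc_angles \<alpha> h|lebesgue. boundary_value f (cis t))"

definition arc_oscillation :: "real \<Rightarrow> (complex \<Rightarrow> complex) \<Rightarrow> real \<Rightarrow> real \<Rightarrow> ennreal" where
  "arc_oscillation lam f \<alpha> h = ennreal (1 / h powr lam) * (ennreal (1 / (2 * pi)) *
     (\<integral>\<^sup>+t\<in>arc_angles \<alpha> h. ennreal ((cmod (boundary_value f (cis t) - arc_mean f \<alpha> h))\<^sup>2) \<partial>lebesgue))"

definition morrey :: "real \<Rightarrow> (complex \<Rightarrow> complex) set" where
  "morrey lam = {f \<in> hardy2. (SUP \<alpha>. SUP h\<in>{0<..1}. arc_oscillation lam f \<alpha> h) < \<infinity>}"

definition little_morrey :: "real \<Rightarrow> (complex \<Rightarrow> complex) set" where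
  "little_morrey lam = {f \<in> morrey lam.
     ((\<lambda>(\<alpha>, h). arc_oscillation lam f \<alpha> h) \<longlongrightarrow> 0) (filtercomap snd (at_right 0))}"

text \<open>
  The condition \<open>z / |z| \<in> I\<close> is written as \<open>z = |z| cis t\<close>, so that the box of the full circle is
  the whole disc, including the origin.
\<close>

definition carleson_box :: "real \<Rightarrow> real \<Rightarrow> complex set" where
  "carleson_box \<alpha> h = {z. 1 - h \<le> cmod z \<and> cmod z < 1 \<and>
     (\<exists>t\<in>arc_angles \<alpha> h. z = of_real (cmod z) * cis t)}"

definition morrey_norm :: "real \<Rightarrow> (complex \<Rightarrow> complex) \<Rightarrow> ennreal" where
  "morrey_norm lam f = ennreal (cmod (f 0)) +
     (SUP \<alpha>. SUP h\<in>{0<..1}. ennreal_sqrt (ennreal (1 / h powr lam) *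
        area_integral (carleson_box \<alpha> h) (\<lambda>z. (cmod (deriv f z))\<^sup>2 * (1 - (cmod z)\<^sup>2))))"


subsection \<open>Bloch spaces\<close>

definition bloch_norm :: "(complex \<Rightarrow> complex) \<Rightarrow> ennreal" where
  "bloch_norm f = ennreal (cmod (f 0)) +
     (SUP z\<in>unit_disc. ennreal ((1 - (cmod z)\<^sup>2) * cmod (deriv f z)))"

definition bloch :: "(complex \<Rightarrow> complex) set" where
  "bloch = {f \<in> analytic_disc. bloch_norm f < \<infinity>}"

definition little_bloch :: "(complex \<Rightarrow> complex) set" where
  "little_bloch = {f \<in> bloch.
     ((\<lambda>z. (1 - (cmod z)\<^sup>2) * cmod (deriv f z)) \<longlongrightarrow> 0) at_unit_circle}"


subsection \<open>Operators between normed function spaces\<close>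

text \<open>
  A normed space is given by a carrier \<open>X\<close> and a norm \<open>nX\<close>. An operator is a map on all functions,
  of which only the restriction to the carrier matters.
\<close>

definition bounded_operator ::
  "(complex \<Rightarrow> complex) set \<Rightarrow> ((complex \<Rightarrow> complex) \<Rightarrow> ennreal) \<Rightarrow>
   (complex \<Rightarrow> complex) set \<Rightarrow> ((complex \<Rightarrow> complex) \<Rightarrow> ennreal) \<Rightarrow>
   ((complex \<Rightarrow> complex) \<Rightarrow> complex \<Rightarrow> complex) \<Rightarrow> bool" where
  "bounded_operator X nX Y nY T \<longleftrightarrow>
     (\<forall>f\<in>X. T f \<in> Y) \<and>
     (\<forall>f\<in>X. \<forall>k\<in>X. T (\<lambda>z. f z + k z) = (\<lambda>z. T f z + T k z)) \<and>
     (\<forall>c. \<forall>f\<in>X. T (\<lambda>z. c * f z) = (\<lambda>z. c * T f z)) \<and>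
     (\<exists>M::real. \<forall>f\<in>X. nY (T f) \<le> ennreal M * nX f)"

definition compact_operator ::
  "(complex \<Rightarrow> complex) set \<Rightarrow> ((complex \<Rightarrow> complex) \<Rightarrow> ennreal) \<Rightarrow>
   (complex \<Rightarrow> complex) set \<Rightarrow> ((complex \<Rightarrow> complex) \<Rightarrow> ennreal) \<Rightarrow>
   ((complex \<Rightarrow> complex) \<Rightarrow> complex \<Rightarrow> complex) \<Rightarrow> bool" where
  "compact_operator X nX Y nY K \<longleftrightarrow>
     bounded_operator X nX Y nY K \<and>
     (\<forall>F::nat \<Rightarrow> complex \<Rightarrow> complex.
        (\<forall>n. F n \<in> X) \<and> (\<exists>M::real. \<forall>n. nX (F n) \<le> ennreal M) \<longrightarrow>
        (\<exists>k\<in>Y. \<exists>s::nat \<Rightarrow> nat. strict_mono s \<and>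
           (\<lambda>n. nY (\<lambda>z. K (F (s n)) z - k z)) \<longlonglongrightarrow> 0))"

definition operator_norm ::
  "(complex \<Rightarrow> complex) set \<Rightarrow> ((complex \<Rightarrow> complex) \<Rightarrow> ennreal) \<Rightarrow>
   ((complex \<Rightarrow> complex) \<Rightarrow> ennreal) \<Rightarrow>
   ((complex \<Rightarrow> complex) \<Rightarrow> complex \<Rightarrow> complex) \<Rightarrow> ennreal" where
  "operator_norm X nX nY T = (SUP f\<in>{f \<in> X. nX f \<le> 1}. nY (T f))"

definition essential_norm ::
  "(complex \<Rightarrow> complex) set \<Rightarrow> ((complex \<Rightarrow> complex) \<Rightarrow> ennreal) \<Rightarrow>
   (complex \<Rightarrow> complex) set \<Rightarrow> ((complex \<Rightarrow> complex) \<Rightarrow> ennreal) \<Rightarrow>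
   ((complex \<Rightarrow> complex) \<Rightarrow> complex \<Rightarrow> complex) \<Rightarrow> ennreal" where
  "essential_norm X nX Y nY T =
     (INF K\<in>{K. compact_operator X nX Y nY K}. operator_norm X nX nY (\<lambda>f z. T f z - K f z))"

definition volterra :: "(complex \<Rightarrow> complex) \<Rightarrow> (complex \<Rightarrow> complex) \<Rightarrow> complex \<Rightarrow> complex" where
  "volterra g f z =
     (if z \<in> unit_disc then contour_integral (linepath 0 z) (\<lambda>w. f w * deriv g w) else 0)"

end

theory Submission
  imports Defs
begin

text \<open>
  Both sides are comparable to \<open>L = limsup (1 - |z|\<^sup>2)\<^bsup>(1 + lam)/2\<^esup> |g'(z)|\<close> as \<open>|z| \<rightarrow> 1\<close>.
  For the right-hand side this follows from the sub-mean value property of \<open>|g'|\<^sup>2\<close> on a disc of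
  radius comparable to \<open>1 - |a|\<close> in one direction and from the Forelli--Rudin estimate in the other.

  For the upper bound of the essential norm, Morrey functions grow at most like
  \<open>(1 - |z|)\<^bsup>(lam - 1)/2\<^esup>\<close>, so by Montel's theorem \<open>f \<mapsto> T\<^sub>g (f (r \<cdot>))\<close> is compact, and it
  approximates \<open>T\<^sub>g\<close> up to a multiple of \<open>L\<close> when \<open>r\<close> is close to 1.

  For the lower bound, \<open>T\<^sub>g\<close> is tested on
  \<open>f\<^sub>a(z) = (1 - |a|\<^sup>2)\<^bsup>(1 + lam)/2\<^esup> / (1 - cnj a z)\<close>. The integral of \<open>|f\<^sub>a'|\<^sup>2 (1 - |z|\<^sup>2)\<close>
  over a box of size \<open>h\<close> is negligible unless \<open>h\<close> is comparable to \<open>1 - |a|\<close>. Hence all finite sums of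
  test functions along a lacunary sequence are bounded in norm, and a compact operator sends a
  subsequence of them to 0.
\<close>


subsection \<open>Area integrals on the disc\<close>

text \<open>The boundary description of the little Morrey space has to be verified only for
  functions that are analytic across the circle, whose radial limits are ordinary values; for all
  other members, the estimates start from holomorphy and the bound on box integrals. The dilates f(r
  z) occur only as arguments of T_g, so no estimate of their Morrey norm is made. That T_g sends
  them to the little Bloch space comes from T_g 1, which shows that g itself, up to a constant, lies
  in that space. Area integrals are computed without a Jacobian: rotation invariance allows
  averaging over circles, and the variable 1 - |z|^2 is uniformly distributed on [0, 1]. Since p > 1
  > lam, the weight (1 - |z|^2)^(p - 1 - lam), which remains when |g'|^2 is replaced by its bound
  near the circle, is integrable; this makes the Forelli-Rudin estimate applicable to the right-hand
  side. All comparisons pass through reals M above a limsup, because M then bounds the function on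
  an entire annulus next to the circle.\<close>

lemma lborel_complex_vec2:
  "distr lborel borel (\<lambda>v::real^2. Complex (v $ 1) (v $ 2)) = (lborel :: complex measure)"
proof (rule lborel_eqI [symmetric])
  let ?f = "\<lambda>v::real^2. Complex (v $ 1) (v $ 2)"
  fix l u :: complex
  assume le: "\<And>b. b \<in> Basis \<Longrightarrow> l \<bullet> b \<le> u \<bullet> b"
  have m: "?f \<in> borel_measurable lborel"
    by (auto intro!: borel_measurable_continuous_onI continuous_intros simp: Complex_eq)
  define l' u' :: "real^2" where "l' = (\<chi> i. if i = 1 then Re l else Im l)" and "u' = (\<chi> i. if i = 1 then Re u else Im u)"
  have "?f -` box l u = box l' u'"
    by (auto simp: in_box_complex_iff mem_box_cart forall_2 l'_def u'_def)
  moreover have "Re l \<le> Re u" "Im l \<le> Im u"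
    using le[of 1] le[of \<i>] by (auto simp: Basis_complex_def)
  moreover have "(\<Prod>b\<in>Basis. (u' - l') \<bullet> b) = (\<Prod>b\<in>Basis. (u - l) \<bullet> b)"
    by (subst prod.reindex_bij_betw[of "\<lambda>i. axis i 1" UNIV Basis, symmetric])
       (auto simp: Basis_complex_def prod_2 inner_axis l'_def u'_def bij_betw_def inj_on_def axis_eq_axis Basis_vec_def UNIV_2)
  ultimately show "emeasure (distr lborel borel ?f) (box l u) = (\<Prod>b\<in>Basis. (u - l) \<bullet> b)"
    using m by (subst emeasure_distr) (auto simp: emeasure_lborel_box_eq Basis_vec_def inner_axis forall_2 l'_def u'_def)
qed simp

text \<open>Multiplication by c is an orthogonal map of the plane. The invariance of measure under
  such maps is taken from \<open>real^2\<close> and carried over by the preceding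
  identification.\<close>

lemma lborel_rotation:
  fixes c :: complex
  assumes c: "cmod c = 1"
  shows "distr lborel borel (\<lambda>z. c * z) = lborel"
proof (rule lborel_eqI [symmetric])
  let ?f = "\<lambda>v::real^2. Complex (v $ 1) (v $ 2)"
  let ?g = "\<lambda>z. (\<chi> i. if i = 1 then Re z else Im z) :: real^2"
  have m': "?f \<in> borel_measurable borel"
    by (auto intro!: borel_measurable_continuous_onI continuous_intros simp: Complex_eq)
  have mc: "(\<lambda>z. c * z) \<in> borel_measurable borel"
    by (auto intro!: borel_measurable_continuous_onI continuous_intros)
  define f g where "f = ?f" and "g = ?g"
  have m: "f \<in> borel_measurable borel" using m' by (simp add: f_def)
  have gf: "g (f v) = v" for v by (simp add: vec_eq_iff forall_2 f_def g_def)
  have fg: "f (g z) = z" for z by (simp add: complex_eq_iff f_def g_def)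
  \<comment> \<open>The inverse rotation in real coordinates: preimages under multiplication by c
    become images under \<open>R\<close>, the form in which the invariance is stated.\<close>
  define R where "R = (\<lambda>v. g (inverse c * f v))"
  have "c \<noteq> 0" using c by auto
  have eqA: "f -` ((\<lambda>z. c * z) -` A) = R ` (f -` A)" for A
  proof (intro equalityI subsetI)
    fix v assume "v \<in> f -` ((\<lambda>z. c * z) -` A)"
    then show "v \<in> R ` (f -` A)"
      by (intro image_eqI[of _ _ "g (c * f v)"]) (auto simp: R_def fg gf \<open>c \<noteq> 0\<close> mult.assoc[symmetric])
  next
    fix w assume "w \<in> R ` (f -` A)"
    then obtain v where v: "w = R v" "f v \<in> A" by auto
    have "c * f (R v) = f v" by (simp add: R_def fg \<open>c \<noteq> 0\<close> mult.assoc[symmetric])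
    then show "w \<in> f -` ((\<lambda>z. c * z) -` A)" using v by simp
  qed
  have "orthogonal_transformation R"
  proof -
    have nf: "norm (f v) = norm v" for v
      by (simp add: norm_vec_def L2_set_def sum_2 cmod_def f_def)
    have "linear R"
      by (rule linearI) (auto simp: R_def f_def g_def vec_eq_iff forall_2 algebra_simps add_divide_distrib diff_divide_distrib)
    moreover have "norm (R v) = norm v" for v
      by (subst nf[symmetric], simp only: R_def fg) (simp add: norm_mult nf norm_inverse c)
    ultimately show ?thesis by (simp add: orthogonal_transformation)
  qed
  fix l u :: complex
  assume le: "\<And>b. b \<in> Basis \<Longrightarrow> l \<bullet> b \<le> u \<bullet> b"
  let ?B = "f -` box l u"
  have e: "emeasure lborel (f -` A) = emeasure lborel A" if "A \<in> sets borel" for A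
    using that m by (unfold f_def, subst lborel_complex_vec2[symmetric], subst emeasure_distr) auto
  have B: "?B \<in> sets borel" by (intro measurable_sets_borel[OF m]) auto
  have RB: "R ` ?B \<in> sets borel"
    unfolding eqA[symmetric] by (intro measurable_sets_borel[OF m] measurable_sets_borel[OF mc]) auto
  have Bf: "emeasure lborel ?B = (\<Prod>b\<in>Basis. (u - l) \<bullet> b)"
    by (subst e) (auto simp: emeasure_lborel_box_eq le)
  have lm: "?B \<in> lmeasurable"
    using B Bf by (intro fmeasurableI) (auto simp: lborelD)
  have "emeasure lborel (R ` ?B) = emeasure lborel ?B"
  proof -
    have "measure lebesgue (R ` ?B) = measure lebesgue ?B"
      by (rule measure_orthogonal_image) fact+
    moreover have "R ` ?B \<in> lmeasurable"
      by (rule measurable_orthogonal_image) fact+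
    ultimately have "emeasure lebesgue (R ` ?B) = emeasure lebesgue ?B"
      using lm by (simp add: emeasure_eq_measure2)
    then show ?thesis using B RB by simp
  qed
  moreover have "emeasure (distr lborel borel (\<lambda>z. c * z)) (box l u) = emeasure lborel (R ` ?B)"
    using mc by (subst emeasure_distr) (auto simp: eqA[symmetric] e measurable_sets_borel[OF mc])
  ultimately show "emeasure (distr lborel borel (\<lambda>z. c * z)) (box l u) = (\<Prod>b\<in>Basis. (u - l) \<bullet> b)"
    using Bf by simp
qed simp

text \<open>Every rotated integral equals the original one, so their average over x in [0, 1] does
  too, and Tonelli exchanges the integrals. This is the angular half of polar coordinates.\<close>

lemma nn_integral_circle_average:
  fixes u :: "complex \<Rightarrow> ennreal"
  assumes u [measurable]: "u \<in> borel_measurable borel"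
  shows "(\<integral>\<^sup>+z. u z \<partial>lborel) = (\<integral>\<^sup>+z. (\<integral>\<^sup>+x. u (cis (2 * pi * x) * z) * indicator {0..1} x \<partial>lborel) \<partial>lborel)"
proof -
  have [measurable]: "(\<lambda>(x, z). cis (2 * pi * x) * z) \<in> borel_measurable (borel \<Otimes>\<^sub>M borel)"
    unfolding borel_prod by (auto intro!: borel_measurable_continuous_onI continuous_intros simp: split_beta)
  have rot: "(\<integral>\<^sup>+z. u (cis (2 * pi * x) * z) \<partial>lborel) = (\<integral>\<^sup>+z. u z \<partial>lborel)" for x
  proof -
    have "(\<lambda>z. cis (2 * pi * x) * z) \<in> borel_measurable borel"
      by (auto intro!: borel_measurable_continuous_onI continuous_intros)
    then show ?thesis
      by (subst (2) lborel_rotation[of "cis (2 * pi * x)", symmetric]) (auto simp: nn_integral_distr)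
  qed
  have "(\<integral>\<^sup>+z. (\<integral>\<^sup>+x. u (cis (2 * pi * x) * z) * indicator {0..1} x \<partial>lborel) \<partial>lborel)
      = (\<integral>\<^sup>+x. (\<integral>\<^sup>+z. u (cis (2 * pi * x) * z) * indicator {0..1} x \<partial>lborel) \<partial>lborel)"
    by (rule lborel_pair.Fubini') measurable
  also have "\<dots> = (\<integral>\<^sup>+x. (\<integral>\<^sup>+z. u z \<partial>lborel) * indicator {0..1::real} x \<partial>lborel)"
    by (subst nn_integral_multc) (auto simp: rot intro!: borel_measurable_continuous_onI continuous_intros measurable_compose[OF _ u])
  also have "\<dots> = (\<integral>\<^sup>+z. u z \<partial>lborel)"
    by (subst nn_integral_cmult_indicator) auto
  finally show ?thesis ..
qed

lemma borel_measurable_indicator_ball [measurable]: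
  "indicator (ball a r) \<in> borel_measurable borel"
  by (rule borel_measurable_indicator) simp

text \<open>The set where 1 - |z|^2 exceeds x is a disc of area pi (1 - x), so this variable is
  uniformly distributed. This is the radial half of polar coordinates, with no Jacobian
  left.\<close>

lemma distr_radial:
  "distr (density lborel (indicator unit_disc)) borel (\<lambda>z. 1 - (cmod z)\<^sup>2)
   = density lborel (\<lambda>x::real. pi * indicator {0..1} x)"
proof (rule measure_eqI_lessThan)
  have m: "(\<lambda>z. 1 - (cmod z)\<^sup>2) \<in> borel_measurable borel" by simp
  have L: "emeasure (distr (density lborel (indicator unit_disc)) borel (\<lambda>z. 1 - (cmod z)\<^sup>2)) {x<..}
     = (if x < 0 then pi else if x < 1 then pi * (1 - x) else 0)" for x
  proof -
    have "emeasure (distr (density lborel (indicator unit_disc)) borel (\<lambda>z. 1 - (cmod z)\<^sup>2)) {x<..}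
       = emeasure lborel (unit_disc \<inter> {z. x < 1 - (cmod z)\<^sup>2})"
    proof -
      have ms: "{z. x < 1 - (cmod z)\<^sup>2} \<in> sets borel"
        by (auto intro!: borel_open open_Collect_less continuous_intros)
      have "emeasure (distr (density lborel (indicator unit_disc)) borel (\<lambda>z. 1 - (cmod z)\<^sup>2)) {x<..}
        = (\<integral>\<^sup>+z. indicator unit_disc z * indicator {z. x < 1 - (cmod z)\<^sup>2} z \<partial>lborel)"
        using ms by (subst emeasure_distr, simp, simp, subst emeasure_density) (auto simp: vimage_def)
      also have "\<dots> = (\<integral>\<^sup>+z. indicator (unit_disc \<inter> {z. x < 1 - (cmod z)\<^sup>2}) z \<partial>lborel)"
        by (simp add: indicator_inter_arith)
      finally show ?thesis using ms by simp
    qed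
    also have "unit_disc \<inter> {z. x < 1 - (cmod z)\<^sup>2} = (if x < 0 then ball 0 1 else if x < 1 then ball 0 (sqrt (1 - x)) else {})"
    proof -
      have sq: "(cmod z < sqrt (1 - x)) = (x < 1 - (cmod z)\<^sup>2)" for z
      proof -
        have "(cmod z < sqrt (1 - x)) = (sqrt ((cmod z)\<^sup>2) < sqrt (1 - x))" by simp
        then show ?thesis by (auto simp del: real_sqrt_abs)
      qed
      consider "x < 0" | "0 \<le> x" "x < 1" | "1 \<le> x" by linarith
      then show ?thesis
      proof cases
        case 1
        have "x < 1 - (cmod z)\<^sup>2" if "cmod z < 1" for z
        proof -
          have "(cmod z)\<^sup>2 < 1" using that by (simp add: abs_square_less_1)
          then show ?thesis using 1 by linarith
        qed
        then show ?thesis using 1 by auto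
      next
        case 2
        have "cmod z < 1" if "cmod z < sqrt (1 - x)" for z
        proof -
          have "sqrt (1 - x) \<le> 1" using 2 by simp
          then show ?thesis using that by linarith
        qed
        then show ?thesis using 2 by (auto simp: sq[symmetric])
      next
        case 3
        have "\<not> x < 1 - (cmod z)\<^sup>2" for z
          using zero_le_power2[of "cmod z"] 3 by linarith
        then show ?thesis using 3 by auto
      qed
    qed
    also have "emeasure lborel \<dots> = (if x < 0 then pi else if x < 1 then pi * (1 - x) else 0)"
      by (simp add: emeasure_ball unit_ball_vol_2)
    finally show ?thesis .
  qed
  have R: "emeasure (density lborel (\<lambda>x::real. pi * indicator {0..1} x)) {x<..} 
     = (if x < 0 then pi else if x < 1 then pi * (1 - x) else 0)" for x
  proof -
    have "emeasure (density lborel (\<lambda>x::real. pi * indicator {0..1} x)) {x<..} = (\<integral>\<^sup>+t. ennreal pi * indicator ({0..1} \<inter> {x<..}) t \<partial>lborel)"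
      by (subst emeasure_density) (auto intro!: nn_integral_cong split: split_indicator)
    also have "\<dots> = ennreal pi * emeasure lborel ({0..1} \<inter> {x<..})"
      by (subst nn_integral_cmult_indicator) auto
    also have "{0..1} \<inter> {x<..} = (if x < 0 then {0..1} else if x < 1 then {x<..1} else {})"
      by auto
    finally show ?thesis by (auto simp: ennreal_mult'[symmetric])
  qed
  show "emeasure (distr (density lborel (indicator unit_disc)) borel (\<lambda>z. 1 - (cmod z)\<^sup>2)) {x<..} < \<infinity>" for x
    unfolding L by simp
  show "emeasure (distr (density lborel (indicator unit_disc)) borel (\<lambda>z. 1 - (cmod z)\<^sup>2)) {x<..} = emeasure (density lborel (\<lambda>x::real. pi * indicator {0..1} x)) {x<..}" for x
    unfolding L R ..
qed auto

lemma nn_integral_radial: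
  fixes \<phi> :: "real \<Rightarrow> ennreal"
  assumes [measurable]: "\<phi> \<in> borel_measurable borel"
  shows "(\<integral>\<^sup>+z\<in>unit_disc. \<phi> (1 - (cmod z)\<^sup>2) \<partial>lborel) = pi * (\<integral>\<^sup>+x\<in>{0..1}. \<phi> x \<partial>lborel)"
proof -
  have "(\<integral>\<^sup>+z\<in>unit_disc. \<phi> (1 - (cmod z)\<^sup>2) \<partial>lborel)
      = (\<integral>\<^sup>+x. \<phi> x \<partial>(distr (density lborel (indicator unit_disc)) borel (\<lambda>z. 1 - (cmod z)\<^sup>2)))"
    by (subst nn_integral_distr, simp, simp, subst nn_integral_density) (auto simp: mult.commute)
  also have "\<dots> = (\<integral>\<^sup>+x. pi * (\<phi> x * indicator {0..1} x) \<partial>lborel)"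
    unfolding distr_radial
    by (subst nn_integral_density) (auto intro!: nn_integral_cong split: split_indicator)
  also have "\<dots> = pi * (\<integral>\<^sup>+x\<in>{0..1}. \<phi> x \<partial>lborel)"
    by (rule nn_integral_cmult) auto
  finally show ?thesis .
qed

lemma borel_measurable_cis [measurable]: "cis \<in> borel_measurable borel"
  by (auto intro!: borel_measurable_continuous_onI continuous_intros)

section \<open>Circle averages and the sub-mean value property\<close>

lemma mean_value_unit_circle:
  assumes H: "H holomorphic_on ball 0 R" and R: "1 < R"
  shows "((\<lambda>x. H (cis (2 * pi * x))) has_integral H 0) {0..1}"
proof -
  have "H holomorphic_on cball 0 1"
    by (rule holomorphic_on_subset[OF H]) (use R in auto)
  then have "((\<lambda>u. H u / (u - 0)) has_contour_integral 2 * of_real pi * \<i> * H 0) (circlepath 0 1)"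
    by (intro Cauchy_integral_circlepath_simple) auto
  moreover have "circlepath 0 1 x = cis (2 * pi * x)"
    and "vector_derivative (circlepath 0 1) (at x) = 2 * of_real pi * \<i> * cis (2 * pi * x)" for x
    by (simp_all add: vector_derivative_circlepath) (simp_all add: circlepath cis_conv_exp mult_ac)
  ultimately have "((\<lambda>x. H (cis (2 * pi * x)) / cis (2 * pi * x) * (2 * pi * \<i> * cis (2 * pi * x))) has_integral (2 * of_real pi * \<i> * H 0)) {0..1}"
    by (simp add: has_contour_integral)
  moreover define k where "k = 2 * of_real pi * \<i>"
  ultimately have "((\<lambda>x. k * H (cis (2 * pi * x))) has_integral k * H 0) {0..1}"
    by (simp add: mult_ac)
  from has_integral_mult_right[OF this, of "inverse k"]
  moreover have "k \<noteq> 0" by (simp add: k_def)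
  ultimately show ?thesis by (simp add: mult.assoc[symmetric])
qed

lemma norm_le_circle_average:
  assumes H: "H holomorphic_on ball 0 R" and R: "1 < R"
  shows "ennreal (cmod (H 0)) \<le> (\<integral>\<^sup>+x\<in>{0..1}. ennreal (cmod (H (cis (2 * pi * x)))) \<partial>lborel)"
proof -
  have sub: "cis t \<in> ball 0 R" for t using R by simp
  have cont: "continuous_on {0..1} (\<lambda>x. H (cis (2 * pi * x)))"
    by (rule continuous_on_compose2[OF holomorphic_on_imp_continuous_on[OF H]])
       (use sub in \<open>auto intro!: continuous_intros\<close>)
  then have int: "(\<lambda>x. cmod (H (cis (2 * pi * x)))) integrable_on {0..1}"
    by (intro integrable_continuous_interval continuous_intros)
  have "cmod (H 0) \<le> integral {0..1} (\<lambda>x. cmod (H (cis (2 * pi * x))))"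
    using integral_norm_bound_integral[OF has_integral_integrable[OF mean_value_unit_circle[OF H R]] int]
      integral_unique[OF mean_value_unit_circle[OF H R]] by simp
  then show ?thesis
    using nn_integral_has_integral_lebesgue'[OF _ integrable_integral[OF int]] by (simp add: ennreal_leI)
qed

text \<open>The real part of (1 + w z) / (1 - w z) on the circle is the Poisson kernel (1 - |w|^2) /
  |1 - w z|^2, and its mean is its value 1 at z = 0.\<close>

lemma poisson_average:
  fixes w :: complex
  assumes w: "cmod w < 1"
  shows "(\<integral>\<^sup>+x\<in>{0..1}. ennreal (1 / (cmod (1 - w * cis (2 * pi * x)))\<^sup>2) \<partial>lborel) = ennreal (1 / (1 - (cmod w)\<^sup>2))"
proof -
  let ?P = "\<lambda>z. (1 + w * z) / (1 - w * z)"
  \<comment> \<open>The quotient \<open>?P\<close> is holomorphic for |z| < 1 / |w|, a radius beyond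
    1; for w = 0 any radius above 1 serves.\<close>
  define R where "R = (if w = 0 then 2 else 1 / cmod w)"
  have R: "1 < R" using w by (auto simp: R_def field_simps)
  have wR: "cmod (w * z) < 1" if "z \<in> ball 0 R" for z
    using that by (auto simp: R_def norm_mult field_simps split: if_splits)
  then have "1 - w * z \<noteq> 0" if "z \<in> ball 0 R" for z
    using that by (metis eq_iff_diff_eq_0 less_irrefl norm_one)
  then have "?P holomorphic_on ball 0 R" by (auto intro!: holomorphic_intros)
  from mean_value_unit_circle[OF this R]
  have "((\<lambda>x. ?P (cis (2 * pi * x))) has_integral 1) {0..1}" by simp
  from has_integral_Re[OF this]
  have 1: "((\<lambda>x. Re (?P (cis (2 * pi * x)))) has_integral 1) {0..1}" by simp
  have w1: "(cmod w)\<^sup>2 < 1" using w by (simp add: abs_square_less_1)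
  have 2: "Re ((1 + u) / (1 - u)) = (1 - (cmod u)\<^sup>2) / (cmod (1 - u))\<^sup>2" for u
    by (simp add: Re_divide cmod_power2) (simp add: power2_eq_square algebra_simps)
  have 3: "((\<lambda>x. 1 / (1 - (cmod w)\<^sup>2) * Re (?P (cis (2 * pi * x)))) has_integral 1 / (1 - (cmod w)\<^sup>2) * 1) {0..1}"
    by (rule has_integral_mult_right[OF 1])
  have "((\<lambda>x. 1 / (cmod (1 - w * cis (2 * pi * x)))\<^sup>2) has_integral 1 / (1 - (cmod w)\<^sup>2)) {0..1}"
    using 3 w1 by (simp add: 2 norm_mult)
  from nn_integral_has_integral_lebesgue'[OF _ this] show ?thesis by simp
qed

lemma area_integral_lborel: "area_integral A u = ennreal (1 / pi) * (\<integral>\<^sup>+z\<in>A. ennreal (u z) \<partial>lborel)"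
  unfolding area_integral_def by (simp add: nn_integral_completion)

lemma area_integral_mono:
  assumes "A \<subseteq> B" "\<And>z. z \<in> A \<Longrightarrow> u z \<le> v z"
  shows "area_integral A u \<le> area_integral B v"
  unfolding area_integral_def
  by (intro mult_left_mono nn_integral_mono) (use assms in \<open>auto split: split_indicator intro: ennreal_leI\<close>)

text \<open>On each circle about a the average of |F|^2 is at least |F(a)|^2, because F^2 is
  holomorphic. Integration over the disc gives its normalized area as factor; pi cancels against dm
  = dx dy / pi.\<close>

lemma area_integral_mean_value:
  assumes F: "F holomorphic_on ball a \<rho>" and \<rho>: "0 < \<rho>"
  shows "ennreal (\<rho>\<^sup>2 * (cmod (F a))\<^sup>2) \<le> area_integral (ball a \<rho>) (\<lambda>z. (cmod (F z))\<^sup>2)"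
proof -
  define u where "u = (\<lambda>z. ennreal (indicator (ball 0 \<rho>) z *\<^sub>R (cmod (F (a + z)))\<^sup>2))"
  have cont: "continuous_on (ball 0 \<rho>) (\<lambda>z. (cmod (F (a + z)))\<^sup>2)"
    by (intro continuous_intros continuous_on_compose2[OF holomorphic_on_imp_continuous_on[OF F]]) (auto simp: dist_norm)
  have um [measurable]: "u \<in> borel_measurable borel"
    unfolding u_def using borel_measurable_continuous_on_indicator[OF _ cont] by measurable
  have um': "(\<lambda>z. u (z - a)) \<in> borel_measurable borel" by measurable
  have "(\<integral>\<^sup>+z\<in>ball a \<rho>. ennreal ((cmod (F z))\<^sup>2) \<partial>lborel) = (\<integral>\<^sup>+z. u (z - a) \<partial>lborel)"
    by (intro nn_integral_cong) (auto simp: u_def dist_norm norm_minus_commute split: split_indicator)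
  also have "\<dots> = (\<integral>\<^sup>+z. u z \<partial>lborel)"
    by (subst lborel_distr_plus[of a, symmetric], subst nn_integral_distr) (use um' in auto)
  also have "\<dots> = (\<integral>\<^sup>+z. (\<integral>\<^sup>+x. u (cis (2 * pi * x) * z) * indicator {0..1} x \<partial>lborel) \<partial>lborel)"
    by (rule nn_integral_circle_average) fact
  also have "\<dots> \<ge> (\<integral>\<^sup>+z. ennreal ((cmod (F a))\<^sup>2) * indicator (ball (0::complex) \<rho>) z \<partial>lborel)"
  proof (rule nn_integral_mono)
    fix z :: complex
    show "ennreal ((cmod (F a))\<^sup>2) * indicator (ball 0 \<rho>) z \<le> (\<integral>\<^sup>+x. u (cis (2 * pi * x) * z) * indicator {0..1} x \<partial>lborel)"
    proof (cases "z \<in> ball 0 \<rho>")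
      case True
      \<comment> \<open>With z fixed, the circle through a + z is parametrized by w on the unit
        circle. The function F(a + w z)^2 of w is holomorphic up to radius \<open>\<rho>\<close> /
        |z| > 1 and equals F(a)^2 at w = 0.\<close>
      define R where "R = (if z = 0 then 2 else \<rho> / cmod z)"
      have R: "1 < R" using True by (auto simp: R_def field_simps)
      have "a + w * z \<in> ball a \<rho>" if "w \<in> ball 0 R" for w
        using that \<rho> by (auto simp: R_def norm_mult field_simps dist_norm split: if_splits)
      then have "(\<lambda>w. (F (a + w * z))\<^sup>2) holomorphic_on ball 0 R"
        by (intro holomorphic_intros holomorphic_on_compose_gen[OF _ F, unfolded o_def]) auto
      from norm_le_circle_average[OF this R] True show ?thesis
        by (simp add: u_def norm_power norm_mult mult.commute)
    qed simp
  qed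
  finally have "ennreal (1 / pi) * (\<integral>\<^sup>+z. ennreal ((cmod (F a))\<^sup>2) * indicator (ball (0::complex) \<rho>) z \<partial>lborel)
      \<le> area_integral (ball a \<rho>) (\<lambda>z. (cmod (F z))\<^sup>2)"
    unfolding area_integral_lborel by (intro mult_left_mono) auto
  also have "ennreal (1 / pi) * (\<integral>\<^sup>+z. ennreal ((cmod (F a))\<^sup>2) * indicator (ball (0::complex) \<rho>) z \<partial>lborel) = ennreal (\<rho>\<^sup>2 * (cmod (F a))\<^sup>2)"
    using \<rho> by (subst nn_integral_cmult_indicator)
      (auto simp: emeasure_ball unit_ball_vol_2 ennreal_mult'[symmetric] field_simps)
  finally show ?thesis .
qed

section \<open>Forelli-Rudin estimates\<close>

lemma one_minus_square_bounds:
  fixes r :: real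
  assumes "0 \<le> r" "r < 1"
  shows "0 < 1 - r\<^sup>2" "1 - r\<^sup>2 \<le> 1" "1 - r \<le> 1 - r\<^sup>2" "1 - r\<^sup>2 \<le> 2 * (1 - r)"
proof -
  have "r\<^sup>2 \<le> r" using assms by (simp add: power2_eq_square mult_left_le_one_le)
  moreover have "0 \<le> (1 - r)\<^sup>2" by simp
  ultimately show "0 < 1 - r\<^sup>2" "1 - r\<^sup>2 \<le> 1" "1 - r \<le> 1 - r\<^sup>2" "1 - r\<^sup>2 \<le> 2 * (1 - r)"
    using assms by (auto simp: power2_eq_square algebra_simps)
qed

text \<open>The part of the kernel beyond the power 2 is bounded by its maximum (1 - |w|)^(2 - s);
  the power 2 itself has the exact Poisson average.\<close>

lemma kernel_circle_average_le:
  fixes w :: complex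
  assumes w: "cmod w < 1" and s: "2 \<le> s"
  shows "(\<integral>\<^sup>+x\<in>{0..1}. ennreal (cmod (1 - w * cis (2 * pi * x)) powr - s) \<partial>lborel) \<le> ennreal ((1 - cmod w) powr (1 - s))"
proof -
  have "(\<integral>\<^sup>+x\<in>{0..1}. ennreal (cmod (1 - w * cis (2 * pi * x)) powr - s) \<partial>lborel) \<le> 
    (\<integral>\<^sup>+x. ennreal ((1 - cmod w) powr (2 - s)) * (ennreal (1 / (cmod (1 - w * cis (2 * pi * x)))\<^sup>2) * indicator {0..1} x) \<partial>lborel)"
  proof (rule nn_integral_mono)
    fix x :: real
    define m where "m = cmod (1 - w * cis (2 * pi * x))"
    have m: "1 - cmod w \<le> m"
      unfolding m_def using norm_triangle_ineq2[of 1 "w * cis (2 * pi * x)"] by (simp add: norm_mult)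
    have m0: "0 < m" using m w by linarith
    have "m powr - s = m powr (2 - s) * (1 / m\<^sup>2)"
      using m0 by (simp add: powr_diff powr_minus field_simps)
    also have "\<dots> \<le> (1 - cmod w) powr (2 - s) * (1 / m\<^sup>2)"
      using m w s by (intro mult_right_mono powr_mono2') auto
    finally have "ennreal (m powr - s) \<le> ennreal ((1 - cmod w) powr (2 - s)) * ennreal (1 / m\<^sup>2)"
      by (subst ennreal_mult'[symmetric]) (auto intro: ennreal_leI)
    then show "ennreal (cmod (1 - w * cis (2 * pi * x)) powr - s) * indicator {0..1} x \<le> 
       ennreal ((1 - cmod w) powr (2 - s)) * (ennreal (1 / (cmod (1 - w * cis (2 * pi * x)))\<^sup>2) * indicator {0..1} x)"
      unfolding m_def by (simp split: split_indicator)
  qed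
  also have "\<dots> = ennreal ((1 - cmod w) powr (2 - s)) * ennreal (1 / (1 - (cmod w)\<^sup>2))"
    by (subst nn_integral_cmult) (simp_all add: poisson_average[OF w])
  also have "\<dots> \<le> ennreal ((1 - cmod w) powr (1 - s))"
  proof -
    have "1 / (1 - (cmod w)\<^sup>2) \<le> 1 / (1 - cmod w)"
      using one_minus_square_bounds[of "cmod w"] w by (intro divide_left_mono mult_pos_pos) auto
    then have "(1 - cmod w) powr (2 - s) * (1 / (1 - (cmod w)\<^sup>2)) \<le> (1 - cmod w) powr (2 - s) * (1 / (1 - cmod w))"
      by (intro mult_left_mono) auto
    also have "\<dots> = (1 - cmod w) powr (1 - s)"
      using w by (simp add: powr_diff field_simps power2_eq_square)
    finally show ?thesis by (subst ennreal_mult'[symmetric]) (auto intro: ennreal_leI)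
  qed
  finally show ?thesis .
qed

text \<open>The integral is split at \<open>\<delta>\<close>. Below it the maximum is constant and c
  > -1 gives integrability at 0; above it the range is extended to infinity, where c + 2 < s gives
  convergence.\<close>

lemma nn_integral_powr_max_le:
  fixes \<delta> c s :: real
  assumes \<delta>: "0 < \<delta>" and c: "-1 < c" and s: "c + 2 < s"
  shows "(\<integral>\<^sup>+x\<in>{0..1}. ennreal (x powr c * max x \<delta> powr (1 - s)) \<partial>lborel)
    \<le> ennreal ((1 / (c + 1) + 1 / (s - 2 - c)) * \<delta> powr (c + 2 - s))"
proof -
  have "(\<integral>\<^sup>+x\<in>{0..1}. ennreal (x powr c * max x \<delta> powr (1 - s)) \<partial>lborel)
    \<le> (\<integral>\<^sup>+x. ennreal (\<delta> powr (1 - s) * x powr c) * indicator {0..\<delta>} x + ennreal (x powr (c + 1 - s)) * indicator {\<delta>..} x \<partial>lborel)"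
  proof (rule nn_integral_mono)
    fix x :: real
    consider "x < 0" | "0 \<le> x" "x \<le> \<delta>" | "\<delta> < x" by linarith
    then show "ennreal (x powr c * max x \<delta> powr (1 - s)) * indicator {0..1} x \<le> 
      ennreal (\<delta> powr (1 - s) * x powr c) * indicator {0..\<delta>} x + ennreal (x powr (c + 1 - s)) * indicator {\<delta>..} x"
    proof cases
      case 3
      then have "x powr c * max x \<delta> powr (1 - s) = x powr (c + 1 - s)"
        using \<delta> by (simp add: powr_add[symmetric] algebra_simps)
      then show ?thesis using 3 by (auto split: split_indicator)
    qed (auto simp: mult.commute split: split_indicator)
  qed
  also have "\<dots> = (\<integral>\<^sup>+x. ennreal (\<delta> powr (1 - s) * x powr c) * indicator {0..\<delta>} x \<partial>lborel) + (\<integral>\<^sup>+x. ennreal (x powr (c + 1 - s)) * indicator {\<delta>..} x \<partial>lborel)"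
    by (rule nn_integral_add) auto
  also have "(\<integral>\<^sup>+x. ennreal (\<delta> powr (1 - s) * x powr c) * indicator {0..\<delta>} x \<partial>lborel) = ennreal (\<delta> powr (1 - s) * (\<delta> powr (c + 1) / (c + 1)))"
    by (intro nn_integral_has_integral_lebesgue' has_integral_mult_right has_integral_powr_from_0) (use \<delta> c in auto)
  also have "(\<integral>\<^sup>+x. ennreal (x powr (c + 1 - s)) * indicator {\<delta>..} x \<partial>lborel) = ennreal (- (\<delta> powr (c + 1 - s + 1)) / (c + 1 - s + 1))"
    by (intro nn_integral_has_integral_lebesgue' has_integral_powr_to_inf) (use \<delta> s in auto)
  also have "ennreal (\<delta> powr (1 - s) * (\<delta> powr (c + 1) / (c + 1))) + ennreal (- (\<delta> powr (c + 1 - s + 1)) / (c + 1 - s + 1))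
     = ennreal (\<delta> powr (1 - s) * (\<delta> powr (c + 1) / (c + 1)) + - (\<delta> powr (c + 1 - s + 1)) / (c + 1 - s + 1))"
    by (subst ennreal_plus) (use c s \<delta> in \<open>auto simp: divide_nonneg_neg\<close>)
  also have "\<delta> powr (1 - s) * (\<delta> powr (c + 1) / (c + 1)) + - (\<delta> powr (c + 1 - s + 1)) / (c + 1 - s + 1)
     = (1 / (c + 1) + 1 / (s - 2 - c)) * \<delta> powr (c + 2 - s)"
  proof -
    have "\<delta> powr (1 - s) * \<delta> powr (c + 1) = \<delta> powr (c + 2 - s)"
      by (simp add: powr_add[symmetric] algebra_simps)
    moreover have "- (\<delta> powr (c + 1 - s + 1)) / (c + 1 - s + 1) = \<delta> powr (c + 2 - s) / (s - 2 - c)"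
    proof -
      have e: "c + 1 - s + 1 = c + 2 - s" "s - 2 - c = - (c + 2 - s)" by simp_all
      show ?thesis unfolding e by (simp del: minus_diff_eq)
    qed
    ultimately show ?thesis by (simp add: ring_distribs)
  qed
  finally show ?thesis .
qed

text \<open>Averaging over rotations replaces the kernel by its circle average, and the substitution
  x = 1 - |z|^2 leaves the one-dimensional integral of
  \<open>nn_integral_powr_max_le\<close>.\<close>

lemma forelli_rudin:
  fixes a :: complex and c s :: real
  assumes a: "cmod a < 1" and c: "-1 < c" and s: "2 \<le> s" "c + 2 < s"
  shows "area_integral unit_disc (\<lambda>z. (1 - (cmod z)\<^sup>2) powr c * cmod (1 - cnj a * z) powr - s)
    \<le> ennreal (2 powr (s - 1) * (1 / (c + 1) + 1 / (s - 2 - c)) * (1 - (cmod a)\<^sup>2) powr (c + 2 - s))"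
proof -
  define \<delta> where "\<delta> = 1 - (cmod a)\<^sup>2"
  have \<delta>: "0 < \<delta>" "\<delta> \<le> 2 * (1 - cmod a)" using one_minus_square_bounds[of "cmod a"] a by (auto simp: \<delta>_def)
  define u where "u = (\<lambda>z. ennreal ((1 - (cmod z)\<^sup>2) powr c * cmod (1 - cnj a * z) powr - s) * indicator unit_disc z)"
  have [measurable]: "u \<in> borel_measurable borel" unfolding u_def by measurable
  define \<phi> where "\<phi> = (\<lambda>x. ennreal (2 powr (s - 1)) * ennreal (x powr c * max x \<delta> powr (1 - s)))"
  have [measurable]: "\<phi> \<in> borel_measurable borel" unfolding \<phi>_def by measurable
  have "(\<integral>\<^sup>+z. u z \<partial>lborel) = (\<integral>\<^sup>+z. (\<integral>\<^sup>+x. u (cis (2 * pi * x) * z) * indicator {0..1} x \<partial>lborel) \<partial>lborel)"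
    by (rule nn_integral_circle_average) measurable
  also have "\<dots> \<le> (\<integral>\<^sup>+z\<in>unit_disc. \<phi> (1 - (cmod z)\<^sup>2) \<partial>lborel)"
  proof (rule nn_integral_mono)
    fix z :: complex
    show "(\<integral>\<^sup>+x. u (cis (2 * pi * x) * z) * indicator {0..1} x \<partial>lborel) \<le> \<phi> (1 - (cmod z)\<^sup>2) * indicator unit_disc z"
    proof (cases "z \<in> unit_disc")
      case True
      then have z: "cmod z < 1" by simp
      define x where "x = 1 - (cmod z)\<^sup>2"
      have x: "0 < x" "x \<le> 2 * (1 - cmod z)" using one_minus_square_bounds[of "cmod z"] z by (auto simp: x_def)
      define w where "w = cnj a * z"
      have wle: "cmod w \<le> cmod z" "cmod w \<le> cmod a"
        using z a by (auto simp: w_def norm_mult intro: mult_left_le_one_le mult_right_le_one_le)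
      have w: "cmod w < 1" using wle a by simp
      have "(\<integral>\<^sup>+y. u (cis (2 * pi * y) * z) * indicator {0..1} y \<partial>lborel) =
        (\<integral>\<^sup>+y. ennreal (x powr c) * (ennreal (cmod (1 - w * cis (2 * pi * y)) powr - s) * indicator {0..1} y) \<partial>lborel)"
        using z by (intro nn_integral_cong)
          (simp add: u_def x_def w_def norm_mult ennreal_mult' mult_ac split: split_indicator)
      also have "\<dots> = ennreal (x powr c) * (\<integral>\<^sup>+y\<in>{0..1}. ennreal (cmod (1 - w * cis (2 * pi * y)) powr - s) \<partial>lborel)"
        by (rule nn_integral_cmult) simp
      also have "\<dots> \<le> ennreal (x powr c) * ennreal ((1 - cmod w) powr (1 - s))"
        by (intro mult_left_mono kernel_circle_average_le w s) auto
      also have "\<dots> \<le> \<phi> x"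
      proof -
        \<comment> \<open>As |w| is at most |z| and at most |a|, both \<open>x\<close> and
          \<open>\<delta>\<close> are at most 2 (1 - |w|). This 2 is the source of the factor 2 powr
          (s - 1).\<close>
        have "(1 - cmod w) powr (1 - s) \<le> (max x \<delta> / 2) powr (1 - s)"
          using x \<delta> wle s by (intro powr_mono2') auto
        also have "\<dots> = 2 powr (s - 1) * max x \<delta> powr (1 - s)"
          using x by (subst powr_divide) (auto simp: powr_diff field_simps)
        finally have "x powr c * (1 - cmod w) powr (1 - s) \<le> x powr c * (2 powr (s - 1) * max x \<delta> powr (1 - s))"
          by (intro mult_left_mono) auto
        then show ?thesis
          unfolding \<phi>_def by (subst (1 2) ennreal_mult'[symmetric]) (auto intro!: ennreal_leI simp: mult_ac)
      qed
      finally show ?thesis using True by (simp add: x_def)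
    next
      case False
      then show ?thesis by (simp add: u_def norm_mult)
    qed
  qed
  also have "\<dots> = pi * (\<integral>\<^sup>+x\<in>{0..1}. \<phi> x \<partial>lborel)"
    by (rule nn_integral_radial) measurable
  also have "(\<integral>\<^sup>+x\<in>{0..1}. \<phi> x \<partial>lborel) = ennreal (2 powr (s - 1)) * (\<integral>\<^sup>+x\<in>{0..1}. ennreal (x powr c * max x \<delta> powr (1 - s)) \<partial>lborel)"
    unfolding \<phi>_def mult.assoc by (rule nn_integral_cmult) measurable
  also have "\<dots> \<le> ennreal (2 powr (s - 1)) * ennreal ((1 / (c + 1) + 1 / (s - 2 - c)) * \<delta> powr (c + 2 - s))"
    by (intro mult_left_mono nn_integral_powr_max_le \<delta> c s) auto
  finally have "(\<integral>\<^sup>+z. u z \<partial>lborel) \<le> ennreal (pi * (2 powr (s - 1) * ((1 / (c + 1) + 1 / (s - 2 - c)) * \<delta> powr (c + 2 - s))))"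
    using c s by (simp add: ennreal_mult' mult_left_mono)
  then have "ennreal (1 / pi) * (\<integral>\<^sup>+z. u z \<partial>lborel) \<le> ennreal (1 / pi) * ennreal (pi * (2 powr (s - 1) * ((1 / (c + 1) + 1 / (s - 2 - c)) * \<delta> powr (c + 2 - s))))"
    by (intro mult_left_mono) auto
  also have "\<dots> = ennreal (2 powr (s - 1) * (1 / (c + 1) + 1 / (s - 2 - c)) * \<delta> powr (c + 2 - s))"
    using c s by (subst ennreal_mult'[symmetric]) (auto simp: mult_ac)
  finally show ?thesis unfolding area_integral_lborel u_def \<delta>_def .
qed

section \<open>Square roots of extended reals and the approach to the circle\<close>

lemma ennreal_sqrt_le_iff:
  assumes "0 \<le> m"
  shows "ennreal_sqrt x \<le> ennreal m \<longleftrightarrow> x \<le> ennreal (m\<^sup>2)"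
proof (cases x)
  case (real r)
  have "sqrt r \<le> m \<longleftrightarrow> sqrt r \<le> sqrt (m\<^sup>2)" using assms by simp
  also have "\<dots> \<longleftrightarrow> r \<le> m\<^sup>2" by (rule real_sqrt_le_iff)
  finally show ?thesis using real assms by (simp add: ennreal_sqrt_def)
qed (use assms in \<open>simp_all add: ennreal_sqrt_def top_unique\<close>)

lemma eventually_at_unit_circle:
  "eventually P at_unit_circle \<longleftrightarrow> (\<exists>s<1. \<forall>z. s < cmod z \<and> cmod z < 1 \<longrightarrow> P z)"
proof -
  have "eventually P at_unit_circle \<longleftrightarrow> (\<exists>Q. (\<exists>s<1. \<forall>r. s < r \<and> r < 1 \<longrightarrow> Q r) \<and> (\<forall>z. Q (cmod z) \<longrightarrow> P z))"
    unfolding at_unit_circle_def eventually_filtercomap eventually_at_left_field by auto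
  also have "\<dots> \<longleftrightarrow> (\<exists>s<1. \<forall>z. s < cmod z \<and> cmod z < 1 \<longrightarrow> P z)"
  proof safe
    fix s :: real assume s: "s < 1" and P: "\<forall>z. s < cmod z \<and> cmod z < 1 \<longrightarrow> P z"
    show "\<exists>Q. (\<exists>s<1. \<forall>r. s < r \<and> r < 1 \<longrightarrow> Q r) \<and> (\<forall>z. Q (cmod z) \<longrightarrow> P z)"
      by (rule exI[of _ "\<lambda>r. s < r \<and> r < 1"]) (use s P in blast)
  qed blast
  finally show ?thesis .
qed


subsection \<open>Bloch norm and Volterra operators\<close>

lemma bloch_norm_add_le:
  assumes f: "f holomorphic_on unit_disc" and k: "k holomorphic_on unit_disc"
  shows "bloch_norm (\<lambda>z. f z + k z) \<le> bloch_norm f + bloch_norm k"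
proof -
  let ?S = "\<lambda>f. SUP z\<in>unit_disc. ennreal ((1 - (cmod z)\<^sup>2) * cmod (deriv f z))"
  have "?S (\<lambda>z. f z + k z) \<le> ?S f + ?S k"
  proof (rule SUP_least)
    fix z :: complex assume z: "z \<in> unit_disc"
    then have w: "0 \<le> 1 - (cmod z)\<^sup>2" using one_minus_square_bounds[of "cmod z"] by simp
    have "deriv (\<lambda>z. f z + k z) z = deriv f z + deriv k z"
      using z f k by (intro deriv_add holomorphic_on_imp_differentiable_at) auto
    then have "(1 - (cmod z)\<^sup>2) * cmod (deriv (\<lambda>z. f z + k z) z)
       \<le> (1 - (cmod z)\<^sup>2) * cmod (deriv f z) + (1 - (cmod z)\<^sup>2) * cmod (deriv k z)"
      using w by (simp add: distrib_left[symmetric] mult_left_mono norm_triangle_ineq)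
    then have "ennreal ((1 - (cmod z)\<^sup>2) * cmod (deriv (\<lambda>z. f z + k z) z))
       \<le> ennreal ((1 - (cmod z)\<^sup>2) * cmod (deriv f z)) + ennreal ((1 - (cmod z)\<^sup>2) * cmod (deriv k z))"
      using w by (simp add: ennreal_leI flip: ennreal_plus)
    also have "\<dots> \<le> ?S f + ?S k" using z by (intro add_mono SUP_upper) auto
    finally show "ennreal ((1 - (cmod z)\<^sup>2) * cmod (deriv (\<lambda>z. f z + k z) z)) \<le> ?S f + ?S k" .
  qed
  moreover have "ennreal (cmod (f 0 + k 0)) \<le> ennreal (cmod (f 0)) + ennreal (cmod (k 0))"
    by (simp add: ennreal_leI norm_triangle_ineq flip: ennreal_plus)
  ultimately have "bloch_norm (\<lambda>z. f z + k z) \<le> (ennreal (cmod (f 0)) + ennreal (cmod (k 0))) + (?S f + ?S k)"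
    unfolding bloch_norm_def by (intro add_mono) auto
  then show ?thesis unfolding bloch_norm_def by (simp add: ac_simps)
qed

lemma bloch_norm_cmult:
  assumes f: "f holomorphic_on unit_disc"
  shows "bloch_norm (\<lambda>z. c * f z) = ennreal (cmod c) * bloch_norm f"
proof -
  have "ennreal ((1 - (cmod z)\<^sup>2) * cmod (deriv (\<lambda>z. c * f z) z))
     = ennreal (cmod c) * ennreal ((1 - (cmod z)\<^sup>2) * cmod (deriv f z))" if z: "z \<in> unit_disc" for z
  proof -
    have "deriv (\<lambda>z. c * f z) z = c * deriv f z"
      using z f by (intro deriv_cmult holomorphic_on_imp_differentiable_at) auto
    then show ?thesis by (simp add: norm_mult ennreal_mult'[symmetric] mult_ac)
  qed
  then have "(SUP z\<in>unit_disc. ennreal ((1 - (cmod z)\<^sup>2) * cmod (deriv (\<lambda>z. c * f z) z)))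
     = ennreal (cmod c) * (SUP z\<in>unit_disc. ennreal ((1 - (cmod z)\<^sup>2) * cmod (deriv f z)))"
    by (simp add: SUP_mult_left_ennreal)
  then show ?thesis
    by (simp add: bloch_norm_def distrib_left norm_mult ennreal_mult')
qed

lemma bloch_norm_sum_le:
  assumes "\<And>i. i \<in> I \<Longrightarrow> f i holomorphic_on unit_disc"
  shows "bloch_norm (\<lambda>z. \<Sum>i\<in>I. f i z) \<le> (\<Sum>i\<in>I. bloch_norm (f i))"
  using assms
proof (induction I rule: infinite_finite_induct)
  case (insert i I)
  then have "bloch_norm (\<lambda>z. \<Sum>i\<in>insert i I. f i z) \<le> bloch_norm (f i) + bloch_norm (\<lambda>z. \<Sum>i\<in>I. f i z)"
    by (simp add: bloch_norm_add_le holomorphic_on_sum)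
  also have "\<dots> \<le> bloch_norm (f i) + (\<Sum>i\<in>I. bloch_norm (f i))"
    using insert by (intro add_left_mono) auto
  finally show ?case using insert by simp
qed (simp_all add: bloch_norm_def)

text \<open>On the convex disc the integrand has a primitive, and the integral along a segment from
  0 is a difference of two of its values.\<close>

lemma volterra_has_field_derivative:
  assumes g: "g holomorphic_on unit_disc" and f: "f holomorphic_on unit_disc" and z: "z \<in> unit_disc"
  shows "(volterra g f has_field_derivative f z * deriv g z) (at z)"
proof -
  have "(\<lambda>w. f w * deriv g w) holomorphic_on unit_disc"
    by (intro holomorphic_intros f holomorphic_deriv g) auto
  then obtain P where P: "\<And>w. w \<in> unit_disc \<Longrightarrow> (P has_field_derivative f w * deriv g w) (at w within unit_disc)"
    using holomorphic_convex_primitive'[of unit_disc "\<lambda>w. f w * deriv g w"] by auto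
  have V: "volterra g f w = P w - P 0" if "w \<in> unit_disc" for w
  proof -
    have "closed_segment 0 w \<subseteq> unit_disc"
      using that by (intro closed_segment_subset) auto
    then have "((\<lambda>w. f w * deriv g w) has_contour_integral (P w - P 0)) (linepath 0 w)"
      using contour_integral_primitive[OF P, where g = "linepath 0 w"] by simp
    then show ?thesis using that by (simp add: volterra_def contour_integral_unique)
  qed
  have "(P has_field_derivative f z * deriv g z) (at z)"
    using P[OF z] unfolding at_within_open[OF z open_ball] .
  then have "((\<lambda>w. P w - P 0) has_field_derivative f z * deriv g z) (at z)"
    by (auto intro!: derivative_eq_intros)
  then show ?thesis
    by (rule has_field_derivative_transform_within_open[of _ _ _ unit_disc]) (use V z in auto)
qed

lemma volterra_holomorphic:
  assumes "g holomorphic_on unit_disc" "f holomorphic_on unit_disc"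
  shows "volterra g f holomorphic_on unit_disc"
proof -
  have "\<exists>D. (volterra g f has_field_derivative D) (at z)" if "z \<in> unit_disc" for z
    using volterra_has_field_derivative[OF assms that] by (rule exI)
  then show ?thesis by (simp only: holomorphic_on_open[OF open_ball] ball_simps) blast
qed

lemma volterra_in_analytic_disc:
  assumes "g holomorphic_on unit_disc" "f holomorphic_on unit_disc"
  shows "volterra g f \<in> analytic_disc"
  using volterra_holomorphic[OF assms] by (simp add: analytic_disc_def volterra_def)

text \<open>As T_g f vanishes at 0, only its derivative f g' counts. From here on, Bloch estimates
  of T_g are pointwise estimates of a product.\<close>

lemma bloch_norm_volterra:
  assumes g: "g holomorphic_on unit_disc" and f: "f holomorphic_on unit_disc"
  shows "bloch_norm (volterra g f) = (SUP z\<in>unit_disc. ennreal ((1 - (cmod z)\<^sup>2) * cmod (f z * deriv g z)))"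
proof -
  have "deriv (volterra g f) z = f z * deriv g z" if "z \<in> unit_disc" for z
    by (rule DERIV_imp_deriv[OF volterra_has_field_derivative[OF g f that]])
  moreover have "volterra g f 0 = 0" by (simp add: volterra_def)
  ultimately show ?thesis by (simp add: bloch_norm_def)
qed

lemma volterra_integrable:
  assumes g: "g holomorphic_on unit_disc" and f: "f holomorphic_on unit_disc" and z: "z \<in> unit_disc"
  shows "(\<lambda>w. f w * deriv g w) contour_integrable_on linepath 0 z"
proof (rule contour_integrable_continuous_linepath)
  have "(\<lambda>w. f w * deriv g w) holomorphic_on unit_disc"
    by (intro holomorphic_intros f holomorphic_deriv g) auto
  moreover have "closed_segment 0 z \<subseteq> unit_disc"
    using z by (intro closed_segment_subset) auto
  ultimately show "continuous_on (closed_segment 0 z) (\<lambda>w. f w * deriv g w)"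
    by (meson continuous_on_subset holomorphic_on_imp_continuous_on)
qed

lemma volterra_add:
  assumes g: "g holomorphic_on unit_disc" and "f holomorphic_on unit_disc" "k holomorphic_on unit_disc"
  shows "volterra g (\<lambda>z. f z + k z) = (\<lambda>z. volterra g f z + volterra g k z)"
  using assms by (auto simp: volterra_def distrib_right contour_integral_add volterra_integrable)

lemma volterra_diff:
  assumes g: "g holomorphic_on unit_disc" and "f holomorphic_on unit_disc" "k holomorphic_on unit_disc"
  shows "volterra g (\<lambda>z. f z - k z) = (\<lambda>z. volterra g f z - volterra g k z)"
  using assms by (auto simp: volterra_def left_diff_distrib contour_integral_diff volterra_integrable)

lemma volterra_cmult:
  assumes g: "g holomorphic_on unit_disc" and "f holomorphic_on unit_disc"
  shows "volterra g (\<lambda>z. c * f z) = (\<lambda>z. c * volterra g f z)"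
  using assms by (auto simp: volterra_def mult.assoc contour_integral_lmul volterra_integrable)

lemma bloch_norm_volterra_le:
  assumes g: "g holomorphic_on unit_disc" and f: "f holomorphic_on unit_disc"
    and A: "\<And>z. z \<in> unit_disc \<Longrightarrow> cmod (f z) \<le> A"
    and N: "\<And>z. z \<in> unit_disc \<Longrightarrow> (1 - (cmod z)\<^sup>2) * cmod (deriv g z) \<le> N"
  shows "bloch_norm (volterra g f) \<le> ennreal (N * A)"
  unfolding bloch_norm_volterra[OF g f]
proof (intro SUP_least ennreal_leI)
  fix z :: complex assume z: "z \<in> unit_disc"
  have "(1 - (cmod z)\<^sup>2) * cmod (f z * deriv g z) = cmod (f z) * ((1 - (cmod z)\<^sup>2) * cmod (deriv g z))"
    by (simp add: norm_mult)
  also have "\<dots> \<le> A * N"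
    using A[OF z] N[OF z] z one_minus_square_bounds[of "cmod z"]
    by (intro mult_mono order_trans[OF norm_ge_zero A[OF z]]) auto
  finally show "(1 - (cmod z)\<^sup>2) * cmod (f z * deriv g z) \<le> N * A" by (simp add: mult.commute)
qed

lemma volterra_in_little_bloch:
  assumes g: "g holomorphic_on unit_disc" and f: "f holomorphic_on unit_disc"
    and A: "\<And>z. z \<in> unit_disc \<Longrightarrow> cmod (f z) \<le> A"
    and N: "\<And>z. z \<in> unit_disc \<Longrightarrow> (1 - (cmod z)\<^sup>2) * cmod (deriv g z) \<le> N"
    and lim: "((\<lambda>z. (1 - (cmod z)\<^sup>2) * cmod (deriv g z)) \<longlongrightarrow> 0) at_unit_circle"
  shows "volterra g f \<in> little_bloch"
proof -
  have "volterra g f \<in> bloch"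
    using volterra_in_analytic_disc[OF g f] bloch_norm_volterra_le[OF g f A N]
    by (auto simp: bloch_def intro: le_less_trans)
  moreover have "((\<lambda>z. (1 - (cmod z)\<^sup>2) * cmod (deriv (volterra g f) z)) \<longlongrightarrow> 0) at_unit_circle"
  proof (rule tendsto_sandwich[OF _ _ tendsto_const])
    show "((\<lambda>z. A * ((1 - (cmod z)\<^sup>2) * cmod (deriv g z))) \<longlongrightarrow> 0) at_unit_circle"
      using tendsto_mult_left[OF lim, of A] by simp
    have *: "(1 - (cmod z)\<^sup>2) * cmod (deriv (volterra g f) z) = cmod (f z) * ((1 - (cmod z)\<^sup>2) * cmod (deriv g z))"
      and "0 \<le> 1 - (cmod z)\<^sup>2" if "z \<in> unit_disc" for z
      using DERIV_imp_deriv[OF volterra_has_field_derivative[OF g f that]] that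
        one_minus_square_bounds[of "cmod z"] by (auto simp: norm_mult)
    then show "\<forall>\<^sub>F z in at_unit_circle. 0 \<le> (1 - (cmod z)\<^sup>2) * cmod (deriv (volterra g f) z)"
      unfolding eventually_at_unit_circle by (intro exI[of _ 0]) auto
    have "(1 - (cmod z)\<^sup>2) * cmod (deriv (volterra g f) z) \<le> A * ((1 - (cmod z)\<^sup>2) * cmod (deriv g z))"
      if z: "z \<in> unit_disc" for z
      unfolding *[OF z] using A[OF z] z one_minus_square_bounds[of "cmod z"] by (intro mult_right_mono) auto
    then show "\<forall>\<^sub>F z in at_unit_circle. (1 - (cmod z)\<^sup>2) * cmod (deriv (volterra g f) z) \<le> A * ((1 - (cmod z)\<^sup>2) * cmod (deriv g z))"
      unfolding eventually_at_unit_circle by (intro exI[of _ 0]) auto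
  qed
  ultimately show ?thesis by (simp add: little_bloch_def)
qed


subsection \<open>Growth of Morrey functions\<close>

lemma exists_angle_in_period: "\<exists>t\<in>{\<alpha>..\<alpha> + 2 * pi}. w = of_real (cmod w) * cis t"
proof -
  define n where "n = \<lceil>(\<alpha> - Arg w) / (2 * pi)\<rceil>"
  define t where "t = Arg w + 2 * pi * of_int n"
  have "(\<alpha> - Arg w) / (2 * pi) \<le> of_int n" "of_int n < (\<alpha> - Arg w) / (2 * pi) + 1"
    unfolding n_def by linarith+
  then have "t \<in> {\<alpha>..\<alpha> + 2 * pi}"
    by (auto simp: t_def field_simps)
  moreover have "cis t = cis (Arg w)" by (simp add: t_def cis_mult[symmetric])
  moreover have "w = of_real (cmod w) * cis (Arg w)"
    using rcis_cmod_Arg[of w] by (simp add: rcis_def)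
  ultimately show ?thesis by metis
qed

text \<open>With d = 1 - |z| at most 1/2, the disc of radius d/2 has depth at most 3 d / 2 and its
  points differ from z in argument by at most 2 d. A box of length 2 d about the argument of z, with
  angular half-width 2 pi d, is large enough.\<close>

lemma ball_subset_carleson_box:
  assumes z: "cmod z < 1"
  obtains \<alpha> where "ball z ((1 - cmod z) / 2) \<subseteq> carleson_box \<alpha> (min 1 (2 * (1 - cmod z)))"
proof -
  define d where "d = 1 - cmod z"
  have d: "0 < d" "d \<le> 1" using z by (auto simp: d_def)
  have zd: "cmod z = 1 - d" by (simp add: d_def)
  have B: "1 - min 1 (2 * d) \<le> cmod w" "cmod w < 1" if "w \<in> ball z (d / 2)" for w
  proof -
    have *: "cmod w < cmod z + d / 2" "cmod z < cmod w + d / 2"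
      using that norm_triangle_ineq2[of w z] norm_triangle_ineq2[of z w]
      by (auto simp: dist_norm norm_minus_commute)
    show "1 - min 1 (2 * d) \<le> cmod w" using * d zd norm_ge_zero[of w] by (simp add: min_def)
    show "cmod w < 1" using * d zd by linarith
  qed
  show ?thesis
  proof (cases "d \<le> 1 / 2")
    \<comment> \<open>Here the length is 1 and the box is the whole disc, so any starting angle
      works.\<close>
    case False
    have "ball z (d / 2) \<subseteq> carleson_box 0 (min 1 (2 * d))"
      using B False exists_angle_in_period[of 0] by (auto simp: carleson_box_def arc_angles_def min_def)
    then show ?thesis by (intro that) (simp add: d_def)
  next
    case True
    have z0: "z \<noteq> 0" "1 / 2 \<le> cmod z" using True by (auto simp: d_def)
    have "\<exists>t\<in>arc_angles (Arg z - 2 * pi * d) (2 * d). w = of_real (cmod w) * cis t" if w: "w \<in> ball z (d / 2)" for w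
    proof -
      \<comment> \<open>The relative displacement: w = z (1 + u), so the argument changes by the
        imaginary part of Ln (1 + u). The bound |Ln (1 + u)| <= 2 |u| requires |u| < 1/2, which
        follows from |z| >= 1/2 and |w - z| < d/2.\<close>
      define u where "u = (w - z) / z"
      have "cmod (w - z) < d / 2" using w by (simp add: dist_norm norm_minus_commute)
      moreover have "d * (1 / 2) \<le> d * cmod z" using z0 d by (intro mult_left_mono) auto
      ultimately have "cmod u < d"
        using z0 by (simp add: u_def norm_divide field_simps)
      then have u: "cmod u < 1 / 2" "cmod u < d" using True by auto
      have "cmod (Ln (1 + u)) \<le> 2 * cmod u" by (rule norm_Ln_le) fact
      then have "\<bar>Im (Ln (1 + u))\<bar> \<le> 2 * d" using abs_Im_le_cmod[of "Ln (1 + u)"] u by linarith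
      also have "\<dots> \<le> 2 * pi * d" using pi_ge_two d by simp
      finally have im: "\<bar>Im (Ln (1 + u))\<bar> \<le> 2 * pi * d" .
      have "1 + u \<noteq> 0"
      proof
        assume "1 + u = 0"
        moreover have "u = (1 + u) - 1" by simp
        ultimately have "u = - 1" by simp
        then show False using u by simp
      qed
      then have e: "1 + u = of_real (cmod (1 + u)) * cis (Im (Ln (1 + u)))"
        by (metis exp_Ln exp_eq_polar norm_exp_eq_Re)
      have zz: "z = of_real (cmod z) * cis (Arg z)"
        using rcis_cmod_Arg[of z] by (simp add: rcis_def)
      have "w = z * (1 + u)" using z0 by (simp add: u_def field_simps)
      also have "\<dots> = (of_real (cmod z) * cis (Arg z)) * (of_real (cmod (1 + u)) * cis (Im (Ln (1 + u))))"
        using zz e by metis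
      also have "\<dots> = of_real (cmod (z * (1 + u))) * cis (Arg z + Im (Ln (1 + u)))"
        by (simp add: norm_mult cis_mult[symmetric])
      also have "z * (1 + u) = w" using z0 by (simp add: u_def field_simps)
      finally have "w = of_real (cmod w) * cis (Arg z + Im (Ln (1 + u)))" .
      moreover have "Arg z + Im (Ln (1 + u)) \<in> arc_angles (Arg z - 2 * pi * d) (2 * d)"
        using im by (auto simp: arc_angles_def)
      ultimately show ?thesis by blast
    qed
    moreover have "min 1 (2 * d) = 2 * d" using True by simp
    ultimately have "ball z (d / 2) \<subseteq> carleson_box (Arg z - 2 * pi * d) (min 1 (2 * d))"
      using B by (auto simp: carleson_box_def)
    then show ?thesis by (intro that) (simp add: d_def)
  qed
qed

lemma morrey_norm_leD:
  assumes n: "morrey_norm lam f \<le> ennreal M" and M: "0 \<le> M" and h: "0 < h" "h \<le> 1"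
  shows "area_integral (carleson_box \<alpha> h) (\<lambda>z. (cmod (deriv f z))\<^sup>2 * (1 - (cmod z)\<^sup>2)) \<le> ennreal (h powr lam * M\<^sup>2)"
    (is "?A \<le> _")
proof -
  have "ennreal_sqrt (ennreal (1 / h powr lam) * ?A) \<le> (SUP \<alpha>. SUP h\<in>{0<..1}. ennreal_sqrt (ennreal (1 / h powr lam) *
        area_integral (carleson_box \<alpha> h) (\<lambda>z. (cmod (deriv f z))\<^sup>2 * (1 - (cmod z)\<^sup>2))))"
    using h by (intro SUP_upper2[of \<alpha>] SUP_upper2[of h]) auto
  also have "\<dots> \<le> morrey_norm lam f" unfolding morrey_norm_def by simp
  also note n
  finally have "ennreal (1 / h powr lam) * ?A \<le> ennreal (M\<^sup>2)" using M by (simp add: ennreal_sqrt_le_iff)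
  then have "ennreal (h powr lam) * (ennreal (1 / h powr lam) * ?A) \<le> ennreal (h powr lam) * ennreal (M\<^sup>2)"
    by (intro mult_left_mono) auto
  then show ?thesis
    using h by (simp add: mult.assoc[symmetric] ennreal_mult'[symmetric])
qed

lemma morrey_norm_leI:
  assumes f0: "cmod (f 0) \<le> A" and M: "0 \<le> M"
    and le: "\<And>\<alpha> h. 0 < h \<Longrightarrow> h \<le> 1 \<Longrightarrow>
      area_integral (carleson_box \<alpha> h) (\<lambda>z. (cmod (deriv f z))\<^sup>2 * (1 - (cmod z)\<^sup>2)) \<le> ennreal (h powr lam * M\<^sup>2)"
  shows "morrey_norm lam f \<le> ennreal (A + M)"
proof -
  have "ennreal_sqrt (ennreal (1 / h powr lam) *
        area_integral (carleson_box \<alpha> h) (\<lambda>z. (cmod (deriv f z))\<^sup>2 * (1 - (cmod z)\<^sup>2))) \<le> ennreal M" if h: "h \<in> {0<..1}" for \<alpha> h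
  proof -
    have "ennreal (1 / h powr lam) * area_integral (carleson_box \<alpha> h) (\<lambda>z. (cmod (deriv f z))\<^sup>2 * (1 - (cmod z)\<^sup>2))
       \<le> ennreal (1 / h powr lam) * ennreal (h powr lam * M\<^sup>2)"
      using h le by (intro mult_left_mono) auto
    also have "\<dots> = ennreal (M\<^sup>2)" using h by (simp add: ennreal_mult'[symmetric])
    finally show ?thesis using M by (simp add: ennreal_sqrt_le_iff)
  qed
  then have "morrey_norm lam f \<le> ennreal A + ennreal M"
    unfolding morrey_norm_def using f0 by (intro add_mono SUP_least) (auto intro: ennreal_leI)
  also have "\<dots> = ennreal (A + M)" using M order_trans[OF norm_ge_zero f0] by (simp add: ennreal_plus)
  finally show ?thesis .
qed

text \<open>With d = 1 - |z|, the disc of radius d/2 about z carries weight at least d/2 and lies in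
  a box of length at most 2 d. Hence d^3 |f'(z)|^2 is at most a multiple of d^lam M^2, and the
  exponent is half of lam - 3.\<close>

lemma morrey_deriv_growth:
  assumes lam: "0 \<le> lam" "lam \<le> 1" and f: "f holomorphic_on unit_disc"
    and n: "morrey_norm lam f \<le> ennreal M" and M: "0 \<le> M" and z: "cmod z < 1"
  shows "cmod (deriv f z) \<le> 4 * M * (1 - cmod z) powr ((lam - 3) / 2)"
proof -
  define d where "d = 1 - cmod z"
  have d: "0 < d" using z by (auto simp: d_def)
  have zd: "cmod z = 1 - d" by (simp add: d_def)
  obtain \<alpha> where box: "ball z (d / 2) \<subseteq> carleson_box \<alpha> (min 1 (2 * d))"
    using ball_subset_carleson_box[OF z] unfolding d_def .
  have B: "d / 2 \<le> 1 - (cmod w)\<^sup>2" "cmod w < 1" if "w \<in> ball z (d / 2)" for w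
  proof -
    have *: "cmod w < cmod z + d / 2"
      using that norm_triangle_ineq2[of w z] by (simp add: dist_norm norm_minus_commute)
    have "cmod w < 1" using * d zd by linarith
    moreover have "d / 2 \<le> 1 - cmod w" using * d zd by linarith
    ultimately show "d / 2 \<le> 1 - (cmod w)\<^sup>2" "cmod w < 1" using one_minus_square_bounds[of "cmod w"] by auto
  qed
  \<comment> \<open>The lower bound d/2 of the weight is built into the holomorphic function, so
    that the mean value estimate yields the weighted integral at once.\<close>
  have "(\<lambda>w. of_real (sqrt (d / 2)) * deriv f w) holomorphic_on ball z (d / 2)"
    by (intro holomorphic_intros holomorphic_on_subset[OF holomorphic_deriv[OF f]]) (use B in auto)
  from area_integral_mean_value[OF this]
  have "ennreal ((d / 2)\<^sup>2 * (d / 2 * (cmod (deriv f z))\<^sup>2))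
     \<le> area_integral (ball z (d / 2)) (\<lambda>w. d / 2 * (cmod (deriv f w))\<^sup>2)"
    using d by (simp add: norm_mult power_mult_distrib)
  also have "\<dots> \<le> area_integral (carleson_box \<alpha> (min 1 (2 * d))) (\<lambda>w. (cmod (deriv f w))\<^sup>2 * (1 - (cmod w)\<^sup>2))"
  proof (intro area_integral_mono box)
    fix w assume "w \<in> ball z (d / 2)"
    from mult_right_mono[OF B(1)[OF this], of "(cmod (deriv f w))\<^sup>2"]
    show "d / 2 * (cmod (deriv f w))\<^sup>2 \<le> (cmod (deriv f w))\<^sup>2 * (1 - (cmod w)\<^sup>2)"
      by (simp only: mult.commute) simp
  qed
  also have "\<dots> \<le> ennreal (min 1 (2 * d) powr lam * M\<^sup>2)"
    by (rule morrey_norm_leD) (use n M d in auto)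
  finally have "(d / 2)\<^sup>2 * (d / 2 * (cmod (deriv f z))\<^sup>2) \<le> min 1 (2 * d) powr lam * M\<^sup>2"
    by simp
  also have "\<dots> \<le> (2 * d powr lam) * M\<^sup>2"
  proof (intro mult_right_mono)
    have "min 1 (2 * d) powr lam \<le> (2 * d) powr lam" using lam d by (intro powr_mono2) auto
    also have "\<dots> = 2 powr lam * d powr lam" using d by (simp add: powr_mult)
    also have "\<dots> \<le> 2 powr 1 * d powr lam" using lam by (intro mult_right_mono powr_mono) auto
    finally show "min 1 (2 * d) powr lam \<le> 2 * d powr lam" by simp
  qed simp
  also have "(d / 2)\<^sup>2 * (d / 2 * (cmod (deriv f z))\<^sup>2) = d ^ 3 / 8 * (cmod (deriv f z))\<^sup>2"
    by (simp add: power2_eq_square power3_eq_cube)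
  finally have "(cmod (deriv f z))\<^sup>2 \<le> 16 * M\<^sup>2 * (d powr lam / d ^ 3)"
  proof -
    assume *: "d ^ 3 / 8 * (cmod (deriv f z))\<^sup>2 \<le> 2 * d powr lam * M\<^sup>2"
    have "(cmod (deriv f z))\<^sup>2 = (d ^ 3 / 8 * (cmod (deriv f z))\<^sup>2) * (8 / d ^ 3)" using d by simp
    also have "\<dots> \<le> (2 * d powr lam * M\<^sup>2) * (8 / d ^ 3)" using * d by (intro mult_right_mono) auto
    finally show ?thesis by (simp add: mult_ac)
  qed
  also have "d powr lam / d ^ 3 = d powr (lam - 3)"
    using d by (simp add: powr_diff powr_numeral)
  also have "\<dots> = (d powr ((lam - 3) / 2))\<^sup>2"
    by (simp add: power2_eq_square powr_add[symmetric])
  also have "16 * M\<^sup>2 * \<dots> = (4 * M * d powr ((lam - 3) / 2))\<^sup>2"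
    by (simp add: power_mult_distrib)
  finally have "cmod (deriv f z) \<le> 4 * M * d powr ((lam - 3) / 2)"
    by (rule power2_le_imp_le) (use M in simp)
  then show ?thesis by (simp add: d_def)
qed

text \<open>Integrating the bound on f' along the radius raises the exponent by 1, to (lam - 1)/2,
  which is still negative; this produces 8 / (1 - lam). The additional 1 pays for |f(0)| <=
  M.\<close>

lemma morrey_growth:
  assumes lam: "0 \<le> lam" "lam < 1" and f: "f holomorphic_on unit_disc"
    and n: "morrey_norm lam f \<le> ennreal M" and M: "0 \<le> M" and z: "cmod z < 1"
  shows "cmod (f z) \<le> (1 + 8 / (1 - lam)) * M * (1 - cmod z) powr ((lam - 1) / 2)"
proof -
  define r where "r = cmod z"
  have r: "0 \<le> r" "r < 1" using z by (auto simp: r_def)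
  \<comment> \<open>An antiderivative in t of the bound for f' along the segment from 0 to z. Its
    value at t = 0 is nonnegative and is dropped at the end.\<close>
  define \<psi> where "\<psi> = (\<lambda>t. 8 * M / (1 - lam) * (1 - t * r) powr ((lam - 1) / 2))"
  have tr: "0 < 1 - t * r" "t * r < 1" "cmod (of_real t * z) < 1" if "t \<in> {0..1}" for t
  proof -
    have "t * r \<le> r" using that r by (auto intro: mult_left_le_one_le)
    then show "0 < 1 - t * r" "t * r < 1" "cmod (of_real t * z) < 1" using r that by (auto simp: norm_mult r_def)
  qed
  have F: "((\<lambda>t. deriv f (of_real t * z) * z) has_integral f (of_real 1 * z) - f (of_real 0 * z)) {0..1}"
  proof (rule fundamental_theorem_of_calculus)
    fix t :: real assume t: "t \<in> {0..1}"
    have "((\<lambda>w. f (w * z)) has_field_derivative deriv f (of_real t * z) * z) (at (of_real t))"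
      by (rule DERIV_chain2[where f = f])
        (use tr[OF t] in \<open>auto intro!: holomorphic_derivI[OF f] derivative_eq_intros\<close>)
    then show "((\<lambda>t. f (of_real t * z)) has_vector_derivative deriv f (of_real t * z) * z) (at t within {0..1})"
      by (rule has_vector_derivative_real_field)
  qed simp
  have P: "((\<lambda>t. 4 * M * r * (1 - t * r) powr ((lam - 3) / 2)) has_integral \<psi> 1 - \<psi> 0) {0..1}"
  proof (rule fundamental_theorem_of_calculus)
    fix t :: real assume t: "t \<in> {0..1}"
    have "((\<lambda>t. (1 - t * r) powr ((lam - 1) / 2)) has_real_derivative (lam - 1) / 2 * (1 - t * r) powr ((lam - 1) / 2 - 1) * (- r)) (at t)"
      using tr[OF t] by (auto intro!: derivative_eq_intros)
    then have "(\<psi> has_real_derivative 8 * M / (1 - lam) * ((lam - 1) / 2 * (1 - t * r) powr ((lam - 1) / 2 - 1) * (- r))) (at t)"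
      unfolding \<psi>_def by (rule DERIV_cmult)
    moreover have "8 * M / (1 - lam) * ((lam - 1) / 2 * (1 - t * r) powr ((lam - 1) / 2 - 1) * (- r)) = 4 * M * r * (1 - t * r) powr ((lam - 3) / 2)"
    proof -
      have "(lam - 1) / 2 - 1 = (lam - 3) / 2" by (simp add: diff_divide_distrib)
      moreover have "8 * M / (1 - lam) * ((lam - 1) / 2 * X * (- r)) = 4 * M * r * X" for X
        using lam by (simp add: field_simps)
      ultimately show ?thesis by (simp only:)
    qed
    ultimately have "(\<psi> has_real_derivative 4 * M * r * (1 - t * r) powr ((lam - 3) / 2)) (at t)" by simp
    then show "(\<psi> has_vector_derivative 4 * M * r * (1 - t * r) powr ((lam - 3) / 2)) (at t within {0..1})"
      by (simp add: has_real_derivative_iff_has_vector_derivative has_vector_derivative_at_within)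
  qed simp
  have "cmod (f z - f 0) \<le> \<psi> 1 - \<psi> 0"
  proof -
    have "cmod (integral {0..1} (\<lambda>t. deriv f (of_real t * z) * z)) \<le> integral {0..1} (\<lambda>t. 4 * M * r * (1 - t * r) powr ((lam - 3) / 2))"
    proof (rule integral_norm_bound_integral)
      fix t :: real assume t: "t \<in> {0..1}"
      have "cmod (deriv f (of_real t * z)) \<le> 4 * M * (1 - cmod (of_real t * z)) powr ((lam - 3) / 2)"
        using tr[OF t] lam by (intro morrey_deriv_growth f n M) auto
      also have "cmod (of_real t * z) = t * r" using t by (simp add: norm_mult r_def)
      finally have "cmod (deriv f (of_real t * z)) * r \<le> 4 * M * (1 - t * r) powr ((lam - 3) / 2) * r"
        using r by (intro mult_right_mono)
      then show "cmod (deriv f (of_real t * z) * z) \<le> 4 * M * r * (1 - t * r) powr ((lam - 3) / 2)"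
        by (simp add: norm_mult r_def mult_ac)
    qed (use F P in \<open>auto intro: has_integral_integrable\<close>)
    then show ?thesis using integral_unique[OF F] integral_unique[OF P] by simp
  qed
  also have "\<dots> \<le> \<psi> 1" using lam M by (simp add: \<psi>_def)
  finally have 1: "cmod (f z - f 0) \<le> 8 * M / (1 - lam) * (1 - r) powr ((lam - 1) / 2)"
    by (simp add: \<psi>_def)
  have "ennreal (cmod (f 0)) \<le> ennreal M"
    using n unfolding morrey_norm_def by (meson le_iff_add order_trans)
  then have "cmod (f 0) \<le> M * 1" using M by simp
  also have "\<dots> \<le> M * (1 - r) powr ((lam - 1) / 2)"
    using r lam M powr_mono2'[of "(1 - lam) / 2" "1 - r" 1] powr_mono2'[of "(lam - 1) / 2" "1 - r" 1]
    by (intro mult_left_mono) auto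
  finally have 2: "cmod (f 0) \<le> M * (1 - r) powr ((lam - 1) / 2)" .
  have "cmod (f z) \<le> cmod (f z - f 0) + cmod (f 0)" using norm_triangle_ineq[of "f z - f 0" "f 0"] by simp
  also have "\<dots> \<le> 8 * M / (1 - lam) * (1 - r) powr ((lam - 1) / 2) + M * (1 - r) powr ((lam - 1) / 2)"
    by (rule add_mono[OF 1 2])
  also have "\<dots> = (1 + 8 / (1 - lam)) * M * (1 - r) powr ((lam - 1) / 2)"
    by (simp add: algebra_simps)
  finally show ?thesis by (simp add: r_def)
qed


subsection \<open>Functions analytic across the unit circle\<close>

text \<open>Formulas such as those of the test functions make sense beyond the disc, whereas members
  of \<open>analytic_disc\<close> vanish outside it. The cut-off reconciles the two, and F still
  supplies the boundary values.\<close>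

definition restrict_disc :: "(complex \<Rightarrow> complex) \<Rightarrow> complex \<Rightarrow> complex" where
  "restrict_disc F z = (if z \<in> unit_disc then F z else 0)"

lemma deriv_restrict_disc: "z \<in> unit_disc \<Longrightarrow> deriv (restrict_disc F) z = deriv F z"
  by (rule deriv_cong_ev)
    (auto simp: restrict_disc_def intro!: eventually_mono[OF eventually_nhds_in_open[of unit_disc]])

lemma analytic_cball_Lipschitz:
  assumes F: "F analytic_on cball 0 1"
  obtains L where "0 \<le> L" "\<And>z w. cmod z \<le> 1 \<Longrightarrow> cmod w \<le> 1 \<Longrightarrow> cmod (F z - F w) \<le> L * cmod (z - w)"
proof -
  obtain T where T: "open T" "cball 0 1 \<subseteq> T" "F holomorphic_on T"
    using F unfolding analytic_on_holomorphic by blast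
  have "continuous_on (cball 0 1) (deriv F)"
    using T by (intro holomorphic_on_imp_continuous_on holomorphic_on_subset[OF holomorphic_deriv[OF T(3,1)]])
  then have "bounded (deriv F ` cball 0 1)"
    by (intro compact_imp_bounded compact_continuous_image) auto
  then obtain L where L: "\<And>z. z \<in> cball 0 1 \<Longrightarrow> cmod (deriv F z) \<le> L"
    unfolding bounded_iff by blast
  show ?thesis
  proof (rule that)
    show "0 \<le> L" using L[of 0] norm_ge_zero[of "deriv F 0"] by (simp del: norm_ge_zero)
    fix z w :: complex assume "cmod z \<le> 1" "cmod w \<le> 1"
    then show "cmod (F z - F w) \<le> L * cmod (z - w)"
      by (intro field_differentiable_bound[of "cball 0 1" F "deriv F" L])
        (use T L in \<open>auto intro: holomorphic_derivI[OF T(3,1)]\<close>)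
  qed
qed

lemma cis_Lipschitz: "cmod (cis s - cis t) \<le> \<bar>s - t\<bar>"
proof -
  have "norm (cis s - cis t) \<le> 1 * norm (s - t)"
  proof (rule differentiable_bound[of UNIV cis "\<lambda>x h. h *\<^sub>R (\<i> * cis x)"])
    show "(cis has_derivative (\<lambda>h. h *\<^sub>R (\<i> * cis x))) (at x within UNIV)" for x
    proof -
      have "((\<lambda>w. exp (\<i> * w)) has_field_derivative \<i> * exp (\<i> * of_real x)) (at (of_real x))"
        by (auto intro!: derivative_eq_intros)
      then have "(cis has_vector_derivative \<i> * cis x) (at x)"
        using has_vector_derivative_real_field by (fastforce simp: cis_conv_exp[abs_def])
      then show ?thesis by (simp add: has_vector_derivative_def)
    qed
    show "onorm (\<lambda>h. h *\<^sub>R (\<i> * cis x)) \<le> 1" for x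
      by (rule onorm_bound) (auto simp: norm_mult)
  qed auto
  then show ?thesis by simp
qed

lemma boundary_value_restrict_disc:
  assumes F: "F analytic_on cball 0 1" and \<zeta>: "cmod \<zeta> = 1"
  shows "boundary_value (restrict_disc F) \<zeta> = F \<zeta>"
proof -
  have "isCont F \<zeta>"
    using F \<zeta> analytic_at_imp_isCont analytic_on_analytic_at by (metis mem_cball_0 order_refl)
  moreover have "((\<lambda>r::real. of_real r * \<zeta>) \<longlongrightarrow> of_real 1 * \<zeta>) (at_left 1)"
    by (intro tendsto_intros)
  ultimately have "((\<lambda>r::real. F (of_real r * \<zeta>)) \<longlongrightarrow> F \<zeta>) (at_left 1)"
    by (intro isCont_tendsto_compose[of _ F]) auto
  moreover have "\<forall>\<^sub>F r in at_left (1::real). F (of_real r * \<zeta>) = restrict_disc F (of_real r * \<zeta>)"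
    unfolding eventually_at_left_field
    by (intro exI[of _ 0]) (auto simp: restrict_disc_def norm_mult \<zeta>)
  ultimately have "((\<lambda>r::real. restrict_disc F (of_real r * \<zeta>)) \<longlongrightarrow> F \<zeta>) (at_left 1)"
    by (rule Lim_transform_eventually)
  then show ?thesis unfolding boundary_value_def by (intro tendsto_Lim) auto
qed

lemma restrict_disc_in_hardy2:
  assumes F: "F analytic_on cball 0 1"
  shows "restrict_disc F \<in> hardy2"
proof -
  have "F holomorphic_on unit_disc"
    using F by (meson analytic_imp_holomorphic analytic_on_subset ball_subset_cball)
  then have ad: "restrict_disc F \<in> analytic_disc"
    unfolding analytic_disc_def by (auto simp: restrict_disc_def elim!: holomorphic_transform)
  obtain L where L: "0 \<le> L" "\<And>z w. cmod z \<le> 1 \<Longrightarrow> cmod w \<le> 1 \<Longrightarrow> cmod (F z - F w) \<le> L * cmod (z - w)"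
    using analytic_cball_Lipschitz[OF F] by blast
  define A where "A = L + cmod (F 0)"
  have A: "cmod (restrict_disc F z) \<le> A" for z
  proof (cases "z \<in> unit_disc")
    case True
    have "cmod (F z) \<le> cmod (F z - F 0) + cmod (F 0)" using norm_triangle_ineq[of "F z - F 0" "F 0"] by simp
    also have "cmod (F z - F 0) \<le> L * cmod (z - 0)" using True by (intro L) auto
    also have "\<dots> \<le> L" using True L by (simp add: mult_left_le)
    finally show ?thesis using True by (simp add: A_def restrict_disc_def)
  qed (use L in \<open>simp add: restrict_disc_def A_def\<close>)
  have bnd: "ennreal (1 / (2 * pi)) * (\<integral>\<^sup>+t\<in>{0..2 * pi}. ennreal ((cmod (restrict_disc F (of_real r * cis t)))\<^sup>2) \<partial>lebesgue)
    \<le> ennreal (1 / (2 * pi)) * (\<integral>\<^sup>+t. ennreal (A\<^sup>2) * indicator {0..2 * pi} t \<partial>lebesgue)" for r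
    using A by (intro mult_left_mono nn_integral_mono mult_right_mono ennreal_leI power_mono) auto
  have eq: "ennreal (1 / (2 * pi)) * (\<integral>\<^sup>+t. ennreal (A\<^sup>2) * indicator {0..2 * pi} t \<partial>lebesgue) = ennreal (A\<^sup>2)"
    by (subst nn_integral_cmult_indicator) (auto simp: ennreal_mult'[symmetric])
  have "(SUP r\<in>{0..<1}. ennreal (1 / (2 * pi)) *
        (\<integral>\<^sup>+t\<in>{0..2 * pi}. ennreal ((cmod (restrict_disc F (of_real r * cis t)))\<^sup>2) \<partial>lebesgue)) \<le> ennreal (A\<^sup>2)"
    using bnd unfolding eq by (intro SUP_least)
  also have "\<dots> < \<infinity>" by simp
  finally show ?thesis using ad by (simp add: hardy2_def)
qed

text \<open>By the Lipschitz property F differs from its mean by O(h) on an arc of length h, so the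
  squared integral is O(h^3). For lam < 3 the remaining power of h gives both the Morrey bound and
  its vanishing as h tends to 0.\<close>

lemma arc_oscillation_restrict_disc_le:
  assumes F: "F analytic_on cball 0 1"
  obtains K where "0 \<le> K" "\<And>\<alpha> h. 0 < h \<Longrightarrow> arc_oscillation lam (restrict_disc F) \<alpha> h \<le> ennreal (K * h powr (3 - lam))"
proof -
  obtain L where L: "0 \<le> L" "\<And>z w. cmod z \<le> 1 \<Longrightarrow> cmod w \<le> 1 \<Longrightarrow> cmod (F z - F w) \<le> L * cmod (z - w)"
    using analytic_cball_Lipschitz[OF F] by blast
  have Lc: "cmod (F (cis s) - F (cis t)) \<le> L * \<bar>s - t\<bar>" for s t
    using L(2)[of "cis s" "cis t"] mult_left_mono[OF cis_Lipschitz L(1), of s t] by simp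
  have cont: "continuous_on S (\<lambda>s. F (cis s))" for S
  proof -
    have "continuous_on (cball 0 1) F"
      by (intro holomorphic_on_imp_continuous_on analytic_imp_holomorphic F)
    then show ?thesis
      by (rule continuous_on_compose2) (auto intro!: continuous_intros)
  qed
  define K where "K = (2 * pi * L)\<^sup>2"
  show ?thesis
  proof (rule that)
    show "0 \<le> K" by (simp add: K_def)
    fix \<alpha> h :: real assume h: "0 < h"
    let ?I = "arc_angles \<alpha> h"
    have I: "?I = {\<alpha>..\<alpha> + 2 * pi * h}" by (simp add: arc_angles_def)
    have mean: "arc_mean (restrict_disc F) \<alpha> h = of_real (1 / (2 * pi * h)) * integral ?I (\<lambda>s. F (cis s))"
    proof -
      have "set_integrable lebesgue ?I (\<lambda>s. F (cis s))"
        unfolding I by (intro absolutely_integrable_continuous_real cont)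
      then show ?thesis
        by (simp add: arc_mean_def boundary_value_restrict_disc[OF F] set_lebesgue_integral_eq_integral(2))
    qed
    have osc: "cmod (F (cis t) - arc_mean (restrict_disc F) \<alpha> h) \<le> L * (2 * pi * h)" if t: "t \<in> ?I" for t
    proof -
      have int: "((\<lambda>s. F (cis s)) has_integral integral ?I (\<lambda>s. F (cis s))) ?I"
        unfolding I by (intro integrable_integral integrable_continuous_interval cont)
      have "((\<lambda>s. F (cis t)) has_integral (2 * pi * h) *\<^sub>R F (cis t)) ?I"
        using has_integral_const_real[of "F (cis t)" \<alpha> "\<alpha> + 2 * pi * h"] h by (simp add: I)
      from has_integral_diff[OF this int]
      have "((\<lambda>s. F (cis t) - F (cis s)) has_integral (2 * pi * h) *\<^sub>R F (cis t) - integral ?I (\<lambda>s. F (cis s))) (cbox \<alpha> (\<alpha> + 2 * pi * h))"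
        by (simp add: I)
      then have "norm ((2 * pi * h) *\<^sub>R F (cis t) - integral ?I (\<lambda>s. F (cis s))) \<le> (L * (2 * pi * h)) * measure lborel (cbox \<alpha> (\<alpha> + 2 * pi * h))"
      proof (rule has_integral_bound[rotated])
        show "0 \<le> L * (2 * pi * h)" using L h by simp
        fix s assume "s \<in> cbox \<alpha> (\<alpha> + 2 * pi * h)"
        then have "\<bar>t - s\<bar> \<le> 2 * pi * h" using t by (auto simp: I)
        then show "norm (F (cis t) - F (cis s)) \<le> L * (2 * pi * h)"
          using Lc[of t s] mult_left_mono[OF _ L(1)] by (meson order_trans)
      qed
      then have "norm ((2 * pi * h) *\<^sub>R F (cis t) - integral ?I (\<lambda>s. F (cis s))) \<le> (L * (2 * pi * h)) * (2 * pi * h)"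
        using h by simp
      moreover have "(2 * pi * h) *\<^sub>R F (cis t) - integral ?I (\<lambda>s. F (cis s)) = of_real (2 * pi * h) * (F (cis t) - arc_mean (restrict_disc F) \<alpha> h)"
        using h by (simp add: mean right_diff_distrib scaleR_conv_of_real)
      moreover have "norm (of_real (2 * pi * h) * w) = (2 * pi * h) * cmod w" for w
        using h by (simp add: norm_mult)
      ultimately have "(2 * pi * h) * cmod (F (cis t) - arc_mean (restrict_disc F) \<alpha> h) \<le> (2 * pi * h) * (L * (2 * pi * h))"
        by (simp only:) (simp only: mult_ac)
      then show ?thesis by (rule mult_left_le_imp_le) (use h in simp)
    qed
    have "(\<integral>\<^sup>+t\<in>?I. ennreal ((cmod (boundary_value (restrict_disc F) (cis t) - arc_mean (restrict_disc F) \<alpha> h))\<^sup>2) \<partial>lebesgue)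
       \<le> (\<integral>\<^sup>+t. ennreal ((L * (2 * pi * h))\<^sup>2) * indicator ?I t \<partial>lebesgue)"
      using osc by (intro nn_integral_mono)
        (auto simp: boundary_value_restrict_disc[OF F] split: split_indicator intro!: ennreal_leI power_mono)
    also have "\<dots> = ennreal ((L * (2 * pi * h))\<^sup>2 * (2 * pi * h))"
      using h by (subst nn_integral_cmult_indicator) (auto simp: I ennreal_mult'[symmetric])
    finally have "arc_oscillation lam (restrict_disc F) \<alpha> h \<le> ennreal (1 / h powr lam) * (ennreal (1 / (2 * pi)) * ennreal ((L * (2 * pi * h))\<^sup>2 * (2 * pi * h)))"
      unfolding arc_oscillation_def by (intro mult_left_mono) auto
    also have "\<dots> = ennreal (1 / h powr lam * (1 / (2 * pi) * ((L * (2 * pi * h))\<^sup>2 * (2 * pi * h))))"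
      using h by (simp add: ennreal_mult'[symmetric])
    also have "1 / h powr lam * (1 / (2 * pi) * ((L * (2 * pi * h))\<^sup>2 * (2 * pi * h))) = K * h powr (3 - lam)"
      using h by (simp add: K_def powr_diff powr_numeral power2_eq_square power3_eq_cube)
    finally show "arc_oscillation lam (restrict_disc F) \<alpha> h \<le> ennreal (K * h powr (3 - lam))" .
  qed
qed

lemma restrict_disc_in_little_morrey:
  assumes lam: "lam < 3" and F: "F analytic_on cball 0 1"
  shows "restrict_disc F \<in> little_morrey lam"
proof -
  obtain K where K: "0 \<le> K" "\<And>\<alpha> h. 0 < h \<Longrightarrow> arc_oscillation lam (restrict_disc F) \<alpha> h \<le> ennreal (K * h powr (3 - lam))"
    using arc_oscillation_restrict_disc_le[OF F] by blast
  have "arc_oscillation lam (restrict_disc F) \<alpha> h \<le> ennreal K" if h: "h \<in> {0<..1}" for \<alpha> h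
  proof -
    have "h powr (3 - lam) \<le> 1" using h lam by (intro powr_le1) auto
    then have "K * h powr (3 - lam) \<le> K" using K by (simp add: mult_left_le)
    then show ?thesis using K(2)[of h \<alpha>] h ennreal_leI order_trans by fastforce
  qed
  then have "(SUP \<alpha>. SUP h\<in>{0<..1}. arc_oscillation lam (restrict_disc F) \<alpha> h) \<le> ennreal K"
    by (intro SUP_least)
  also have "\<dots> < \<infinity>" by simp
  finally have m: "restrict_disc F \<in> morrey lam"
    using restrict_disc_in_hardy2[OF F] by (simp add: morrey_def)
  have "((\<lambda>(\<alpha>, h). arc_oscillation lam (restrict_disc F) \<alpha> h) \<longlongrightarrow> 0) (filtercomap snd (at_right 0))"
  proof (rule tendsto_sandwich[OF _ _ tendsto_const])
    have "((\<lambda>h. K * h powr (3 - lam)) \<longlongrightarrow> 0) (at_right 0)"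
      by (rule tendsto_eq_rhs[OF tendsto_mult[OF tendsto_const tendsto_powr']])
         (use lam in \<open>auto intro!: tendsto_eq_intros simp: eventually_at_filter\<close>)
    then have "((\<lambda>h. ennreal (K * h powr (3 - lam))) \<longlongrightarrow> 0) (at_right 0)"
      using tendsto_ennrealI by fastforce
    then show "((\<lambda>(\<alpha>::real, h). ennreal (K * h powr (3 - lam))) \<longlongrightarrow> 0) (filtercomap snd (at_right 0))"
      unfolding case_prod_unfold by (rule filterlim_compose[OF _ filterlim_filtercomap])
    have "\<forall>\<^sub>F x in filtercomap snd (at_right 0). 0 < (snd (x :: real \<times> real))"
      by (rule eventually_filtercomapI) (simp add: eventually_at_right_less)
    then show "\<forall>\<^sub>F x in filtercomap snd (at_right 0). (case x of (\<alpha>, h) \<Rightarrow> arc_oscillation lam (restrict_disc F) \<alpha> h) \<le> (case x of (\<alpha>, h) \<Rightarrow> ennreal (K * h powr (3 - lam)))"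
      by eventually_elim (auto intro: K)
  qed auto
  then show ?thesis using m by (simp add: little_morrey_def)
qed

section \<open>Sums of area integrals and lacunary sequences\<close>

lemma area_integral_cmult:
  assumes [measurable]: "u \<in> borel_measurable borel" "A \<in> sets borel" and "0 \<le> c"
  shows "area_integral A (\<lambda>z. c * u z) = ennreal c * area_integral A u"
proof -
  have "(\<integral>\<^sup>+z\<in>A. ennreal (c * u z) \<partial>lborel) = (\<integral>\<^sup>+z. ennreal c * (ennreal (u z) * indicator A z) \<partial>lborel)"
    using assms by (intro nn_integral_cong) (simp add: ennreal_mult' mult.assoc)
  also have "\<dots> = ennreal c * (\<integral>\<^sup>+z\<in>A. ennreal (u z) \<partial>lborel)"
    by (rule nn_integral_cmult) measurable
  finally show ?thesis unfolding area_integral_lborel by (simp add: mult.left_commute)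
qed

lemma area_integral_sum:
  assumes [measurable]: "\<And>i. i \<in> I \<Longrightarrow> u i \<in> borel_measurable borel" "A \<in> sets borel"
    and "\<And>i z. i \<in> I \<Longrightarrow> z \<in> A \<Longrightarrow> 0 \<le> u i z"
  shows "area_integral A (\<lambda>z. \<Sum>i\<in>I. u i z) = (\<Sum>i\<in>I. area_integral A (u i))"
proof -
  have "(\<integral>\<^sup>+z\<in>A. ennreal (\<Sum>i\<in>I. u i z) \<partial>lborel) = (\<integral>\<^sup>+z. (\<Sum>i\<in>I. ennreal (u i z) * indicator A z) \<partial>lborel)"
    using assms by (intro nn_integral_cong) (auto simp: sum_ennreal split: split_indicator)
  also have "\<dots> = (\<Sum>i\<in>I. \<integral>\<^sup>+z\<in>A. ennreal (u i z) \<partial>lborel)"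
    by (rule nn_integral_sum) measurable
  finally show ?thesis unfolding area_integral_lborel by (simp add: sum_distrib_left)
qed

text \<open>Replaces the box by a Borel set, on which integrals may be added and scaled. In 9 = 1 +
  8 the depth of the box contributes 1 and its arc, of length 2 pi h < 8 h, contributes 8.\<close>

lemma carleson_box_subset_cball: "carleson_box \<alpha> h \<subseteq> unit_disc \<inter> cball (cis \<alpha>) (9 * h)"
proof
  fix z assume "z \<in> carleson_box \<alpha> h"
  then obtain t where z: "1 - h \<le> cmod z" "cmod z < 1" "z = of_real (cmod z) * cis t" and t: "\<alpha> \<le> t" "t \<le> \<alpha> + 2 * pi * h"
    by (auto simp: carleson_box_def arc_angles_def)
  have h: "0 < h" using z by linarith
  have "cis t - z = of_real (1 - cmod z) * cis t" by (subst z(3)) (simp add: left_diff_distrib)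
  then have "cmod (cis t - z) = 1 - cmod z" using z(2) by (simp only: norm_mult norm_of_real norm_cis) simp
  moreover have "cmod (cis \<alpha> - cis t) \<le> 8 * h"
  proof -
    have "cmod (cis \<alpha> - cis t) \<le> \<bar>\<alpha> - t\<bar>" by (rule cis_Lipschitz)
    also have "\<dots> \<le> 2 * pi * h" using t by simp
    also have "\<dots> \<le> 2 * 4 * h" using pi_less_4 h by (intro mult_right_mono) auto
    finally show ?thesis by simp
  qed
  ultimately have "cmod (cis \<alpha> - z) \<le> 9 * h"
    using norm_triangle_ineq[of "cis \<alpha> - cis t" "cis t - z"] z by simp
  then show "z \<in> unit_disc \<inter> cball (cis \<alpha>) (9 * h)" using z by (simp add: dist_norm)
qed

text \<open>The terms with y j >= H and those with y j < H are at most 1 and decay at least like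
  powers of 1/2 away from the crossing point, so each group sums to at most 2.\<close>

lemma sum_min_ratio_le:
  fixes y :: "nat \<Rightarrow> real"
  assumes y: "\<And>j. 0 < y j" "\<And>j. y (Suc j) \<le> y j / 2" and H: "0 < H"
  shows "(\<Sum>j<N. min (H / y j) (y j / H)) \<le> 4"
proof -
  \<comment> \<open>The invariant carries the slack needed for induction: before the crossing the
    sum is at most twice its last term, and afterwards the reserve y n / H below 4 pays for the
    terms still to come.\<close>
  have *: "(\<Sum>j<Suc n. min (H / y j) (y j / H)) \<le> (if H \<le> y n then 2 * (H / y n) else 4 - y n / H)" for n
  proof (induction n)
    case 0
    show ?case
    proof (cases "H \<le> y 0")
      case True
      have "0 < H / y 0" using H y(1)[of 0] by simp
      then show ?thesis using True by (simp add: min_le_iff_disj)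
    next
      case False
      then have "y 0 / H \<le> 1" using H by simp
      then show ?thesis using False by (simp add: min_le_iff_disj)
    qed
  next
    case (Suc n)
    have half: "y (Suc n) / H \<le> y n / H / 2" using y(2)[of n] H by (simp add: field_simps)
    have half': "2 * (H / y n) \<le> H / y (Suc n)"
    proof -
      have "H / (y n / 2) \<le> H / y (Suc n)" using y(1)[of n] y(1)[of "Suc n"] y(2)[of n] H
        by (intro divide_left_mono) auto
      then show ?thesis by (simp add: mult.commute)
    qed
    have pos: "0 < y n / H" "0 < y (Suc n) / H" using y(1) H by auto
    show ?case
    proof (cases "H \<le> y (Suc n)")
      case True
      then have "H \<le> y n" using y(2)[of n] y(1)[of n] by linarith
      then show ?thesis using Suc True half' by (simp add: min_def)
    next
      case False
      then have le1: "y (Suc n) / H \<le> 1" using H by simp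
      show ?thesis
      proof (cases "H \<le> y n")
        case True
        then have "H / y n \<le> 1" using y(1)[of n] by simp
        then show ?thesis using Suc True False le1 pos by (simp add: min_def)
      next
        case F2: False
        then show ?thesis using Suc False half pos by (simp add: min_def)
      qed
    qed
  qed
  show ?thesis
  proof (cases N)
    case (Suc n)
    have "H / y n \<le> 1" if "H \<le> y n" using that y(1)[of n] by simp
    moreover have "0 < y n / H" using y(1)[of n] H by simp
    ultimately show ?thesis using *[of n] unfolding Suc by (auto split: if_splits)
  qed simp
qed

text \<open>The weights prevent a loss of the number of terms. In the application the integral of
  the i-th square is of order (w i)^2, so division by w i leaves a second sum of weights.\<close>

lemma sum_square_le_weighted:
  fixes x w :: "'a \<Rightarrow> real"
  assumes "\<And>i. i \<in> I \<Longrightarrow> 0 < w i"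
  shows "(\<Sum>i\<in>I. x i)\<^sup>2 \<le> (\<Sum>i\<in>I. w i) * (\<Sum>i\<in>I. (x i)\<^sup>2 / w i)"
proof -
  have "(\<Sum>i\<in>I. x i) = (\<Sum>i\<in>I. sqrt (w i) * (x i / sqrt (w i)))"
    using assms by (intro sum.cong) (auto simp: less_imp_neq[symmetric])
  also have "\<dots>\<^sup>2 \<le> (\<Sum>i\<in>I. (sqrt (w i))\<^sup>2) * (\<Sum>i\<in>I. (x i / sqrt (w i))\<^sup>2)"
    by (rule Cauchy_Schwarz_ineq_sum)
  also have "\<dots> = (\<Sum>i\<in>I. w i) * (\<Sum>i\<in>I. (x i)\<^sup>2 / w i)"
    using assms by (intro arg_cong2[where f = "(*)"] sum.cong) (auto simp: power_divide less_imp_le)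
  finally show ?thesis .
qed


subsection \<open>Test functions\<close>

text \<open>The factor 1000 makes all finite sums along lacunary sequences lie in the unit ball.\<close>

definition morrey_test :: "real \<Rightarrow> complex \<Rightarrow> complex \<Rightarrow> complex" where
  "morrey_test lam a z = of_real ((1 - (cmod a)\<^sup>2) powr ((1 + lam) / 2) / 1000) / (1 - cnj a * z)"

lemma one_minus_cnj_mult_ge:
  assumes "cmod z \<le> 1"
  shows "1 - cmod a \<le> cmod (1 - cnj a * z)"
proof -
  have "cmod (cnj a * z) \<le> cmod a" using assms by (simp add: norm_mult mult_left_le)
  then show ?thesis using norm_triangle_ineq2[of 1 "cnj a * z"] by simp
qed

lemma one_minus_cnj_mult_nonzero:
  assumes "cmod a < 1" "cmod z \<le> 1"
  shows "1 - cnj a * z \<noteq> 0"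
  using one_minus_cnj_mult_ge[OF assms(2), of a] assms(1) by (metis diff_gt_0_iff_gt norm_zero not_le)

lemma morrey_test_analytic:
  assumes "cmod a < 1"
  shows "morrey_test lam a analytic_on cball 0 1"
  unfolding morrey_test_def[abs_def]
  by (intro analytic_intros) (use one_minus_cnj_mult_nonzero[OF assms] in auto)

lemma morrey_test_deriv:
  assumes "cmod a < 1" "cmod z \<le> 1"
  shows "(morrey_test lam a has_field_derivative
     of_real ((1 - (cmod a)\<^sup>2) powr ((1 + lam) / 2) / 1000) * cnj a / (1 - cnj a * z)\<^sup>2) (at z)"
  unfolding morrey_test_def[abs_def]
  by (rule derivative_eq_intros refl one_minus_cnj_mult_nonzero[OF assms])+
     (use one_minus_cnj_mult_nonzero[OF assms] in \<open>simp add: power2_eq_square\<close>)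

text \<open>At its own point the denominator is 1 - |a|^2. Multiplied by |g'(a)|, this makes the
  Bloch expression of T_g f_a at a exactly \<open>bloch_weight lam g a / 1000\<close>.\<close>

lemma morrey_test_at:
  assumes "cmod a < 1"
  shows "(1 - (cmod a)\<^sup>2) * cmod (morrey_test lam a a) = (1 - (cmod a)\<^sup>2) powr ((1 + lam) / 2) / 1000"
proof -
  have p: "0 < 1 - (cmod a)\<^sup>2" using one_minus_square_bounds[of "cmod a"] assms by simp
  have "1 - cnj a * a = of_real (1 - (cmod a)\<^sup>2)"
    unfolding of_real_diff complex_norm_square by (simp add: mult.commute)
  then have "cmod (1 - cnj a * a) = 1 - (cmod a)\<^sup>2"
    using p by (metis abs_of_pos norm_of_real)
  then have "cmod (morrey_test lam a a) = (1 - (cmod a)\<^sup>2) powr ((1 + lam) / 2) / 1000 / (1 - (cmod a)\<^sup>2)"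
    unfolding morrey_test_def norm_divide norm_of_real by simp
  moreover have "d * (x / 1000 / d) = x / 1000" if "0 < d" for d x :: real using that by simp
  ultimately show ?thesis using p by (simp only:)
qed

text \<open>If h is at most \<open>\<delta>\<close>, the kernel is bounded by its maximum and the
  region is small. If h is larger, the whole disc is integrated by the Forelli-Rudin estimate with c
  = 1 and s = 4, giving a multiple of \<open>\<delta>\<close> powr lam. Relative to h powr lam both
  are governed by \<open>w\<close>, which decays with the ratio of the scales.\<close>

lemma morrey_test_box_le:
  assumes lam: "0 < lam" "lam < 1" and a: "cmod a < 1" and h: "0 < h" and \<zeta>: "cmod \<zeta> = 1"
  defines "\<delta> \<equiv> 1 - (cmod a)\<^sup>2"
  defines "w \<equiv> min (h powr (lam / 2) / \<delta> powr (lam / 2)) (\<delta> powr (lam / 2) / h powr (lam / 2))"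
  shows "area_integral (unit_disc \<inter> cball \<zeta> (9 * h))
      (\<lambda>z. \<delta> powr (1 + lam) * (cmod (1 - cnj a * z) powr - 4 * (1 - (cmod z)\<^sup>2)))
    \<le> ennreal (160\<^sup>2 * (h powr lam * w\<^sup>2))"
proof -
  have \<delta>: "0 < \<delta>" "\<delta> \<le> 2 * (1 - cmod a)" using one_minus_square_bounds[of "cmod a"] a by (auto simp: \<delta>_def)
  have sq: "(x powr (lam / 2))\<^sup>2 = x powr lam" for x :: real
    by (simp add: power2_eq_square powr_add[symmetric])
  show ?thesis
  proof (cases "h \<le> \<delta>")
    case True
    have hd: "h powr (lam / 2) \<le> \<delta> powr (lam / 2)" using True h lam by (intro powr_mono2) auto
    have w: "w = h powr (lam / 2) / \<delta> powr (lam / 2)"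
    proof -
      have "h powr (lam / 2) / \<delta> powr (lam / 2) \<le> 1" using hd \<delta> by simp
      moreover have "1 \<le> \<delta> powr (lam / 2) / h powr (lam / 2)" using hd h by simp
      ultimately show ?thesis by (simp add: w_def)
    qed
    have "area_integral (unit_disc \<inter> cball \<zeta> (9 * h))
      (\<lambda>z. \<delta> powr (1 + lam) * (cmod (1 - cnj a * z) powr - 4 * (1 - (cmod z)\<^sup>2)))
      \<le> area_integral (cball \<zeta> (9 * h)) (\<lambda>z. \<delta> powr (1 + lam) * ((\<delta> / 2) powr - 4 * (18 * h)))"
    proof (intro area_integral_mono mult_left_mono mult_mono)
      fix z assume z: "z \<in> unit_disc \<inter> cball \<zeta> (9 * h)"
      show "cmod (1 - cnj a * z) powr - 4 \<le> (\<delta> / 2) powr - 4"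
        using one_minus_cnj_mult_ge[of z a] z \<delta> by (intro powr_mono2') auto
      have "1 - cmod z \<le> 9 * h"
        using norm_triangle_ineq2[of \<zeta> z] z \<zeta> by (simp add: dist_norm)
      then show "1 - (cmod z)\<^sup>2 \<le> 18 * h"
        using one_minus_square_bounds[of "cmod z"] z by simp
      show "0 \<le> 1 - (cmod z)\<^sup>2" using one_minus_square_bounds[of "cmod z"] z by simp
    qed auto
    also have "\<dots> = ennreal (\<delta> powr (1 + lam) * ((\<delta> / 2) powr - 4 * (18 * h)) * (81 * h\<^sup>2))"
      unfolding area_integral_lborel
      using h \<delta> by (subst nn_integral_cmult_indicator)
        (auto simp: emeasure_cball unit_ball_vol_2 ennreal_mult'[symmetric] field_simps power2_eq_square)
    also have "\<delta> powr (1 + lam) * ((\<delta> / 2) powr - 4 * (18 * h)) * (81 * h\<^sup>2) = 23328 * (\<delta> powr (lam - 3) * h ^ 3)"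
      using \<delta> by (simp add: powr_divide powr_minus powr_add powr_diff powr_numeral field_simps power2_eq_square power3_eq_cube power4_eq_xxxx)
    also have "\<delta> powr (lam - 3) * h ^ 3 = h powr lam * ((h / \<delta>) powr (3 - lam))"
      using h \<delta> by (simp add: powr_divide powr_diff powr_numeral)
    \<comment> \<open>The base is at most 1 and lam <= 3 - lam; some decay is given up to make the
      two cases symmetric in h and \<open>\<delta>\<close>.\<close>
    also have "(h / \<delta>) powr (3 - lam) \<le> (h / \<delta>) powr lam"
      using h \<delta> True lam by (intro powr_mono') auto
    also have "(h / \<delta>) powr lam = w\<^sup>2"
      using h \<delta> by (simp add: w power_divide sq powr_divide)
    \<comment> \<open>23328 = 16 * 18 * 81, from the kernel bound, the weight 18 h and the
      normalized area 81 h^2. The square 160^2 = 25600 exceeds this and also the 12 of the other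
      case.\<close>
    also have "23328 * (h powr lam * w\<^sup>2) \<le> 160\<^sup>2 * (h powr lam * w\<^sup>2)"
      by (intro mult_right_mono) auto
    finally show ?thesis by (simp add: ennreal_leI mult_left_mono)
  next
    case False
    have hd: "\<delta> powr (lam / 2) \<le> h powr (lam / 2)" using False \<delta> lam by (intro powr_mono2) auto
    have w: "w = \<delta> powr (lam / 2) / h powr (lam / 2)"
    proof -
      have "\<delta> powr (lam / 2) / h powr (lam / 2) \<le> 1" using hd h by simp
      moreover have "1 \<le> h powr (lam / 2) / \<delta> powr (lam / 2)" using hd \<delta> by simp
      ultimately show ?thesis by (simp add: w_def)
    qed
    have "area_integral (unit_disc \<inter> cball \<zeta> (9 * h))
      (\<lambda>z. \<delta> powr (1 + lam) * (cmod (1 - cnj a * z) powr - 4 * (1 - (cmod z)\<^sup>2)))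
      \<le> area_integral unit_disc (\<lambda>z. \<delta> powr (1 + lam) * ((1 - (cmod z)\<^sup>2) powr 1 * cmod (1 - cnj a * z) powr - 4))"
      using one_minus_square_bounds(1) by (intro area_integral_mono) (auto simp: mult.commute less_imp_le)
    also have "\<dots> = ennreal (\<delta> powr (1 + lam)) * area_integral unit_disc (\<lambda>z. (1 - (cmod z)\<^sup>2) powr 1 * cmod (1 - cnj a * z) powr - 4)"
      by (rule area_integral_cmult) auto
    also have "\<dots> \<le> ennreal (\<delta> powr (1 + lam)) * ennreal (2 powr (4 - 1) * (1 / (1 + 1) + 1 / (4 - 2 - 1)) * \<delta> powr (1 + 2 - 4))"
      unfolding \<delta>_def by (intro mult_left_mono forelli_rudin a) auto
    also have "\<dots> = ennreal (12 * \<delta> powr lam)"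
      using \<delta> by (simp add: ennreal_mult'[symmetric] powr_add powr_minus powr_numeral)
    also have "12 * \<delta> powr lam \<le> 160\<^sup>2 * (h powr lam * w\<^sup>2)"
      using h \<delta> by (simp add: w power_divide sq)
    finally show ?thesis by (simp add: ennreal_leI)
  qed
qed

text \<open>Functions of different scales barely interact: a box of size h sees the j-th one with
  weight \<open>w j\<close>, which decays geometrically as the scale \<open>\<delta> j\<close> moves
  away from h. The weights sum to at most 4, however many terms there are.\<close>

lemma morrey_norm_test_sum_le:
  fixes a :: "nat \<Rightarrow> complex"
  assumes lam: "0 < lam" "lam < 1" and a: "\<And>j. cmod (a j) < 1"
    and lac: "\<And>j. (1 - (cmod (a (Suc j)))\<^sup>2) powr (lam / 2) \<le> (1 - (cmod (a j))\<^sup>2) powr (lam / 2) / 2"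
  shows "morrey_norm lam (restrict_disc (\<lambda>z. \<Sum>j<N. morrey_test lam (a j) z)) \<le> 1"
proof -
  define \<delta> where "\<delta> = (\<lambda>j. 1 - (cmod (a j))\<^sup>2)"
  define y where "y = (\<lambda>j. \<delta> j powr (lam / 2))"
  let ?F = "\<lambda>z. \<Sum>j<N. morrey_test lam (a j) z"
  have \<delta>: "0 < \<delta> j" "\<delta> j \<le> 1" for j using one_minus_square_bounds[of "cmod (a j)"] a by (auto simp: \<delta>_def)
  have y: "0 < y j" "y (Suc j) \<le> y j / 2" for j using \<delta>[of j] lac[of j] by (auto simp: y_def \<delta>_def)
  \<comment> \<open>Before division by 1000, the values at 0 sum to at most 4, and the box part is
    at most 640 = 160 * 4, the square root of the box constant times the bound on the sum of
    weights.\<close>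
  have "morrey_norm lam (restrict_disc ?F) \<le> ennreal (4 / 1000 + 640 / 1000)"
  proof (rule morrey_norm_leI)
    \<comment> \<open>The values at 0 are compared with the scale H = 1: since y j <= 1, the minimum
      is y j itself.\<close>
    have "cmod (morrey_test lam (a j) 0) \<le> min (1 / y j) (y j / 1) / 1000" for j
    proof -
      have "cmod (morrey_test lam (a j) 0) = \<delta> j powr ((1 + lam) / 2) / 1000"
        by (simp add: morrey_test_def \<delta>_def)
      also have "\<dots> \<le> y j / 1000" unfolding y_def
        using \<delta>[of j] by (intro divide_right_mono powr_mono') auto
      also have "y j \<le> 1" unfolding y_def using \<delta>[of j] lam by (intro powr_le1) auto
      then have "y j \<le> 1 / y j" using y(1)[of j] by (simp add: field_simps mult_le_one)
      then have "y j / 1000 = min (1 / y j) (y j / 1) / 1000" by simp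
      finally show ?thesis .
    qed
    then have "(\<Sum>j<N. cmod (morrey_test lam (a j) 0)) \<le> (\<Sum>j<N. min (1 / y j) (y j / 1) / 1000)"
      by (rule sum_mono)
    also have "\<dots> = (\<Sum>j<N. min (1 / y j) (y j / 1)) / 1000" by (simp add: sum_divide_distrib)
    also have "\<dots> \<le> 4 / 1000" using sum_min_ratio_le[where y = y and N = N, OF y, of 1] by simp
    finally show "cmod (restrict_disc ?F 0) \<le> 4 / 1000"
      using norm_sum[of "\<lambda>j. morrey_test lam (a j) 0" "{..<N}"] by (simp add: restrict_disc_def)
    fix \<alpha> h :: real assume h: "0 < h" "h \<le> 1"
    define H where "H = h powr (lam / 2)"
    have H: "0 < H" using h by (simp add: H_def)
    define w where "w = (\<lambda>j. min (H / y j) (y j / H))"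
    have w: "0 < w j" for j using H y(1)[of j] by (simp add: w_def)
    define W where "W = (\<Sum>j<N. w j)"
    have W: "0 \<le> W" "W \<le> 4" using sum_min_ratio_le[where y = y and N = N, OF y H] w by (auto simp: W_def w_def less_imp_le intro!: sum_nonneg)
    let ?Q = "unit_disc \<inter> cball (cis \<alpha>) (9 * h)"
    define \<kappa> where "\<kappa> = (\<lambda>j z. \<delta> j powr (1 + lam) * (cmod (1 - cnj (a j) * z) powr - 4 * (1 - (cmod z)\<^sup>2)))"
    have \<kappa>m [measurable]: "\<kappa> j \<in> borel_measurable borel" for j unfolding \<kappa>_def by measurable
    have \<kappa>0: "0 \<le> \<kappa> j z" if "z \<in> unit_disc" for j z
      using that one_minus_square_bounds[of "cmod z"] by (simp add: \<kappa>_def)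
    have "area_integral (carleson_box \<alpha> h) (\<lambda>z. (cmod (deriv (restrict_disc ?F) z))\<^sup>2 * (1 - (cmod z)\<^sup>2))
       \<le> area_integral ?Q (\<lambda>z. \<Sum>j<N. W / w j / 1000\<^sup>2 * \<kappa> j z)"
    proof (rule area_integral_mono)
      show "carleson_box \<alpha> h \<subseteq> ?Q" by (rule carleson_box_subset_cball)
      fix z assume "z \<in> carleson_box \<alpha> h"
      then have z: "cmod z < 1" by (simp add: carleson_box_def)
      define D where "D = (\<lambda>j. of_real (\<delta> j powr ((1 + lam) / 2) / 1000) * cnj (a j) / (1 - cnj (a j) * z)\<^sup>2)"
      have "(?F has_field_derivative (\<Sum>j<N. D j)) (at z)"
        unfolding D_def \<delta>_def using z a by (intro DERIV_sum morrey_test_deriv) auto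
      then have dF: "deriv (restrict_disc ?F) z = (\<Sum>j<N. D j)"
        using z by (simp add: deriv_restrict_disc DERIV_imp_deriv)
      have D: "(cmod (D j))\<^sup>2 * (1 - (cmod z)\<^sup>2) \<le> \<kappa> j z / 1000\<^sup>2" for j
      proof -
        have nz: "0 < cmod (1 - cnj (a j) * z)" using one_minus_cnj_mult_nonzero[of "a j" z] a z by simp
        have "(cmod (D j))\<^sup>2 = \<delta> j powr (1 + lam) / 1000\<^sup>2 * (cmod (a j))\<^sup>2 * cmod (1 - cnj (a j) * z) powr - 4"
        proof -
          have "cmod (D j) = \<delta> j powr ((1 + lam) / 2) / 1000 * cmod (a j) / (cmod (1 - cnj (a j) * z))\<^sup>2"
            by (simp add: D_def norm_mult norm_divide norm_power)
          moreover have "(\<delta> j powr ((1 + lam) / 2))\<^sup>2 = \<delta> j powr (1 + lam)"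
            unfolding power2_eq_square powr_add[symmetric] field_sum_of_halves ..
          moreover have "cmod (1 - cnj (a j) * z) powr - 4 = 1 / ((cmod (1 - cnj (a j) * z))\<^sup>2)\<^sup>2"
            using nz by (simp add: powr_minus powr_numeral divide_inverse)
          ultimately show ?thesis by (simp add: power_mult_distrib power_divide)
        qed
        also have "\<dots> \<le> \<delta> j powr (1 + lam) / 1000\<^sup>2 * 1 * cmod (1 - cnj (a j) * z) powr - 4"
          using a[of j] by (intro mult_right_mono mult_left_mono) (auto simp: abs_square_le_1 less_imp_le)
        finally have "(cmod (D j))\<^sup>2 * (1 - (cmod z)\<^sup>2) \<le> \<delta> j powr (1 + lam) / 1000\<^sup>2 * 1 * cmod (1 - cnj (a j) * z) powr - 4 * (1 - (cmod z)\<^sup>2)"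
          using one_minus_square_bounds[of "cmod z"] z by (intro mult_right_mono) auto
        then show ?thesis by (simp add: \<kappa>_def)
      qed
      \<comment> \<open>Weighted Cauchy-Schwarz. The box estimate supplies (w j)^2, so after
        division by w j the total is a multiple of W^2, and W <= 4.\<close>
      have "(cmod (\<Sum>j<N. D j))\<^sup>2 \<le> (\<Sum>j<N. cmod (D j))\<^sup>2"
        by (intro power_mono norm_sum) auto
      also have "\<dots> \<le> W * (\<Sum>j<N. (cmod (D j))\<^sup>2 / w j)"
        unfolding W_def by (rule sum_square_le_weighted) (rule w)
      finally have "(cmod (\<Sum>j<N. D j))\<^sup>2 * (1 - (cmod z)\<^sup>2) \<le> W * (\<Sum>j<N. (cmod (D j))\<^sup>2 / w j) * (1 - (cmod z)\<^sup>2)"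
        using one_minus_square_bounds[of "cmod z"] z by (intro mult_right_mono) auto
      also have "\<dots> = (\<Sum>j<N. W / w j * ((cmod (D j))\<^sup>2 * (1 - (cmod z)\<^sup>2)))"
        by (simp add: sum_distrib_left sum_distrib_right mult_ac)
      also have "\<dots> \<le> (\<Sum>j<N. W / w j * (\<kappa> j z / 1000\<^sup>2))"
        using W w by (intro sum_mono mult_left_mono D) (auto simp: less_imp_le)
      finally show "(cmod (deriv (restrict_disc ?F) z))\<^sup>2 * (1 - (cmod z)\<^sup>2) \<le> (\<Sum>j<N. W / w j / 1000\<^sup>2 * \<kappa> j z)"
        unfolding dF by simp
    qed
    also have "\<dots> = (\<Sum>j<N. area_integral ?Q (\<lambda>z. W / w j / 1000\<^sup>2 * \<kappa> j z))"
      using \<kappa>0 W w by (intro area_integral_sum) (auto simp: less_imp_le)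
    also have "\<dots> = (\<Sum>j<N. ennreal (W / w j / 1000\<^sup>2) * area_integral ?Q (\<kappa> j))"
      using W w by (intro sum.cong refl area_integral_cmult) (auto simp: less_imp_le)
    also have "\<dots> \<le> (\<Sum>j<N. ennreal (W / w j / 1000\<^sup>2) * ennreal (160\<^sup>2 * (h powr lam * (w j)\<^sup>2)))"
      unfolding \<kappa>_def \<delta>_def w_def H_def y_def
      by (intro sum_mono mult_left_mono morrey_test_box_le lam a h) auto
    also have "\<dots> = ennreal (\<Sum>j<N. W / w j / 1000\<^sup>2 * (160\<^sup>2 * (h powr lam * (w j)\<^sup>2)))"
    proof -
      have "(\<Sum>j<N. ennreal (W / w j / 1000\<^sup>2) * ennreal (160\<^sup>2 * (h powr lam * (w j)\<^sup>2)))
        = (\<Sum>j<N. ennreal (W / w j / 1000\<^sup>2 * (160\<^sup>2 * (h powr lam * (w j)\<^sup>2))))"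
        using W w by (intro sum.cong refl ennreal_mult'[symmetric]) (auto simp: less_imp_le)
      also have "\<dots> = ennreal (\<Sum>j<N. W / w j / 1000\<^sup>2 * (160\<^sup>2 * (h powr lam * (w j)\<^sup>2)))"
        using W w by (intro sum_ennreal) (auto simp: less_imp_le)
      finally show ?thesis .
    qed
    also have "(\<Sum>j<N. W / w j / 1000\<^sup>2 * (160\<^sup>2 * (h powr lam * (w j)\<^sup>2))) = (\<Sum>j<N. (160 / 1000)\<^sup>2 * h powr lam * W * w j)"
      using w by (intro sum.cong) (auto simp: power2_eq_square field_simps less_imp_neq[symmetric])
    also have "\<dots> = (160 / 1000)\<^sup>2 * h powr lam * W\<^sup>2"
      unfolding sum_distrib_left[symmetric] W_def[symmetric] by (simp add: power2_eq_square)
    also have "\<dots> \<le> (160 / 1000)\<^sup>2 * h powr lam * 4\<^sup>2"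
      using W by (intro mult_left_mono power_mono) auto
    also have "\<dots> = h powr lam * (640 / 1000)\<^sup>2" by (simp add: power2_eq_square)
    finally show "area_integral (carleson_box \<alpha> h) (\<lambda>z. (cmod (deriv (restrict_disc ?F) z))\<^sup>2 * (1 - (cmod z)\<^sup>2)) \<le> ennreal (h powr lam * (640 / 1000)\<^sup>2)"
      by (simp add: ennreal_leI)
  qed simp
  also have "\<dots> \<le> 1" by simp
  finally show ?thesis .
qed


subsection \<open>Lower bound for the essential norm\<close>

text \<open>Made for a limsup Y: a real M above it is an eventual bound of the function, from which
  X is estimated. For infinite Y the claim is trivial because c > 0.\<close>

lemma le_ennreal_cmultI:
  fixes X Y :: ennreal
  assumes c: "0 < c" and le: "\<And>M::real. 0 < M \<Longrightarrow> Y < ennreal M \<Longrightarrow> X \<le> ennreal (c * M)"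
  shows "X \<le> ennreal c * Y"
proof (cases Y)
  case (real y)
  have "X \<le> ennreal (c * y) + ennreal e" if e: "0 < e" for e :: real
  proof -
    have cy: "0 \<le> c * y" using real(1) c by simp
    have "X \<le> ennreal (c * (y + e / c))"
    proof (rule le)
      have ec: "0 < e / c" using c e by simp
      then show "0 < y + e / c" using real(1) by linarith
      show "Y < ennreal (y + e / c)" unfolding real(2) using real(1) ec by (intro ennreal_lessI) linarith+
    qed
    also have "c * (y + e / c) = c * y + e" unfolding distrib_left using c by simp
    finally show ?thesis unfolding ennreal_plus[OF cy less_imp_le[OF e]] .
  qed
  then have "X \<le> ennreal (c * y)" by (rule ennreal_le_epsilon)
  then show ?thesis using real c by (simp add: ennreal_mult')
next
  case top
  then show ?thesis using c by (simp add: ennreal_mult_top)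
qed

lemma eventually_at_unit_circle_powr_le:
  assumes q: "0 < q" and e: "0 < e"
  shows "\<forall>\<^sub>F a in at_unit_circle. cmod a < 1 \<and> (1 - (cmod a)\<^sup>2) powr q \<le> e"
  unfolding eventually_at_unit_circle
proof (intro exI conjI allI impI)
  define s where "s = max 0 (1 - e powr (1 / q) / 2)"
  show "s < 1" using e by (simp add: s_def)
  fix a :: complex assume a: "s < cmod a \<and> cmod a < 1"
  then have "1 - (cmod a)\<^sup>2 \<le> 2 * (1 - cmod a)" "0 < 1 - (cmod a)\<^sup>2" using one_minus_square_bounds[of "cmod a"] by auto
  moreover have "2 * (1 - cmod a) \<le> e powr (1 / q)" using a by (simp add: s_def)
  ultimately have "(1 - (cmod a)\<^sup>2) powr q \<le> (e powr (1 / q)) powr q"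
    using q by (intro powr_mono2) auto
  also have "\<dots> = e" using q e by (simp add: powr_powr)
  finally show "(1 - (cmod a)\<^sup>2) powr q \<le> e" .
  show "cmod a < 1" using a by simp
qed

lemma little_bloch_holomorphic: "f \<in> little_bloch \<Longrightarrow> f holomorphic_on unit_disc"
  by (simp add: little_bloch_def bloch_def analytic_disc_def)

lemma little_morrey_holomorphic: "f \<in> little_morrey lam \<Longrightarrow> f holomorphic_on unit_disc"
  by (simp add: little_morrey_def morrey_def hardy2_def analytic_disc_def)

lemma bounded_operator_sum:
  assumes K: "bounded_operator X nX Y nY K"
    and X: "\<And>n::nat. (\<lambda>z. \<Sum>j<n. f j z) \<in> X" "\<And>n. f n \<in> X"
  shows "K (\<lambda>z. \<Sum>j<n. f j z) = (\<lambda>z. \<Sum>j<n. K (f j) z)"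
proof (induction n)
  case 0
  \<comment> \<open>Additivity does not start the induction; the empty sum is obtained as 0 times an
    element of X.\<close>
  have "K (\<lambda>z. 0 * f 0 z) = (\<lambda>z. 0 * K (f 0) z)"
    using K X(2)[of 0] unfolding bounded_operator_def by blast
  then show ?case by simp
next
  case (Suc n)
  have "K (\<lambda>z. (\<Sum>j<n. f j z) + f n z) = (\<lambda>z. K (\<lambda>z. \<Sum>j<n. f j z) z + K (f n) z)"
    using K X(1)[of n] X(2)[of n] unfolding bounded_operator_def by metis
  then show ?case using Suc by simp
qed

text \<open>
  If \<open>K f\<^sub>n \<rightarrow> k\<close> along a lacunary sequence of test functions, then \<open>N k\<close> is close to the image of a
  sum of \<open>N\<close> test functions. Such sums are uniformly bounded, which forces \<open>k = 0\<close>. This replaces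
  weak convergence of the test functions.
\<close>

lemma compact_operator_test_limit:
  fixes a :: "nat \<Rightarrow> complex"
  assumes lam: "0 < lam" "lam < 1" and a: "\<And>j. cmod (a j) < 1"
    and lac: "\<And>j. (1 - (cmod (a (Suc j)))\<^sup>2) powr (lam / 2) \<le> (1 - (cmod (a j))\<^sup>2) powr (lam / 2) / 2"
    and K: "compact_operator (little_morrey lam) (morrey_norm lam) little_bloch bloch_norm K"
  shows "\<exists>s. strict_mono s \<and> (\<lambda>n. bloch_norm (K (restrict_disc (morrey_test lam (a (s n)))))) \<longlonglongrightarrow> 0"
proof -
  define f where "f = (\<lambda>n. restrict_disc (morrey_test lam (a n)))"
  define y where "y = (\<lambda>j. (1 - (cmod (a j))\<^sup>2) powr (lam / 2))"
  have sums: "(\<lambda>z. \<Sum>j<n. f (s j) z) = restrict_disc (\<lambda>z. \<Sum>j<n. morrey_test lam (a (s j)) z)" for s and n :: nat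
    by (auto simp: f_def restrict_disc_def)
  have sumX: "(\<lambda>z. \<Sum>j<n. f (s j) z) \<in> little_morrey lam" for s and n :: nat
    unfolding sums using lam a by (intro restrict_disc_in_little_morrey analytic_on_sum morrey_test_analytic) auto
  have fX: "f n \<in> little_morrey lam" for n
    unfolding f_def using lam a by (intro restrict_disc_in_little_morrey morrey_test_analytic) auto
  have "decseq y"
  proof (rule decseq_SucI)
    fix n
    have "0 \<le> y n" by (simp add: y_def)
    then show "y (Suc n) \<le> y n" using lac[of n] unfolding y_def by linarith
  qed
  have lac': "y (s (Suc j)) \<le> y (s j) / 2" if "strict_mono s" for s j
  proof -
    have "Suc (s j) \<le> s (Suc j)" using strict_monoD[OF that, of j "Suc j"] by simp
    then have "y (s (Suc j)) \<le> y (Suc (s j))" using \<open>decseq y\<close> by (rule decseqD[rotated])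
    also have "\<dots> \<le> y (s j) / 2" using lac unfolding y_def .
    finally show ?thesis .
  qed
  have norm1: "morrey_norm lam (\<lambda>z. \<Sum>j<n. f (s j) z) \<le> 1" if "strict_mono s" for s and n :: nat
    unfolding sums using lac'[OF that] unfolding y_def
    by (intro morrey_norm_test_sum_le lam a) auto
  \<comment> \<open>A one-term sum along the sequence started at n.\<close>
  have "morrey_norm lam (f n) \<le> ennreal 1" for n
    using norm1[of "\<lambda>j. n + j" 1] by (simp add: strict_mono_def)
  then obtain k s where k: "k \<in> little_bloch" and s: "strict_mono s"
    and lim: "(\<lambda>n. bloch_norm (\<lambda>z. K (f (s n)) z - k z)) \<longlonglongrightarrow> 0"
    using K fX unfolding compact_operator_def by blast
  have Kb: "bounded_operator (little_morrey lam) (morrey_norm lam) little_bloch bloch_norm K"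
    using K unfolding compact_operator_def by blast
  then obtain M0 :: real where M0: "\<And>f. f \<in> little_morrey lam \<Longrightarrow> bloch_norm (K f) \<le> ennreal M0 * morrey_norm lam f"
    unfolding bounded_operator_def by blast
  define M where "M = max 0 M0"
  have KX: "K f \<in> little_bloch" if "f \<in> little_morrey lam" for f
    using Kb that unfolding bounded_operator_def by blast
  note hol = little_bloch_holomorphic
  have neg: "bloch_norm (\<lambda>z. - u z) = bloch_norm u" if "u holomorphic_on unit_disc" for u
    using bloch_norm_cmult[OF that, of "-1"] by simp
  obtain \<kappa> where \<kappa>: "0 \<le> \<kappa>" "bloch_norm k = ennreal \<kappa>"
    using k unfolding little_bloch_def bloch_def by (cases "bloch_norm k") auto
  have "\<kappa> \<le> e" if e: "0 < e" for e
  proof -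
    have "\<forall>\<^sub>F n in sequentially. bloch_norm (\<lambda>z. K (f (s n)) z - k z) < ennreal e"
      using order_tendstoD(2)[OF lim, of "ennreal e"] e by simp
    then obtain n0 where n0: "\<And>n. n0 \<le> n \<Longrightarrow> bloch_norm (\<lambda>z. K (f (s n)) z - k z) < ennreal e"
      unfolding eventually_sequentially by blast
    have bound: "real N * \<kappa> \<le> M + real N * e" for N
    proof -
      \<comment> \<open>Starting at \<open>n0\<close> makes every image e-close to k. The sequence
        remains lacunary, so the sum of its N test functions has norm at most 1 and the bound M does
        not depend on N.\<close>
      define t where "t = (\<lambda>j. s (n0 + j))"
      have t: "strict_mono t" using s by (auto simp: t_def strict_mono_def)
      let ?P = "\<lambda>z. \<Sum>j<N. f (t j) z"
      have KP: "K ?P = (\<lambda>z. \<Sum>j<N. K (f (t j)) z)"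
        by (rule bounded_operator_sum[OF Kb sumX fX])
      have dh: "(\<lambda>z. - (K (f (t j)) z - k z)) holomorphic_on unit_disc" for j
        by (intro holomorphic_intros hol KX fX k)
      have "ennreal (real N * \<kappa>) = bloch_norm (\<lambda>z. of_nat N * k z)"
        using bloch_norm_cmult[OF hol[OF k], of "of_nat N"] \<kappa> by (simp add: ennreal_mult')
      also have "(\<lambda>z. of_nat N * k z) = (\<lambda>z. K ?P z + (\<Sum>j<N. - (K (f (t j)) z - k z)))"
        unfolding KP by (simp add: sum_subtractf sum_negf)
      also have "bloch_norm \<dots> \<le> bloch_norm (K ?P) + bloch_norm (\<lambda>z. \<Sum>j<N. - (K (f (t j)) z - k z))"
        using dh by (intro bloch_norm_add_le holomorphic_on_sum hol[OF KX] sumX)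
      also have "\<dots> \<le> ennreal M + ennreal (real N * e)"
      proof (rule add_mono)
        have "bloch_norm (K ?P) \<le> ennreal M0 * morrey_norm lam ?P" by (rule M0[OF sumX])
        also have "\<dots> \<le> ennreal M * 1" using norm1[OF t] by (intro mult_mono) (auto simp: M_def intro: ennreal_leI)
        finally show "bloch_norm (K ?P) \<le> ennreal M" by simp
        have "bloch_norm (\<lambda>z. \<Sum>j<N. - (K (f (t j)) z - k z)) \<le> (\<Sum>j<N. bloch_norm (\<lambda>z. - (K (f (t j)) z - k z)))"
          by (rule bloch_norm_sum_le[OF dh])
        also have "\<dots> \<le> (\<Sum>j<N. ennreal e)"
        proof (rule sum_mono)
          fix j
          have "bloch_norm (\<lambda>z. - (K (f (t j)) z - k z)) = bloch_norm (\<lambda>z. K (f (t j)) z - k z)"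
            by (intro neg holomorphic_intros hol KX fX k)
          also have "\<dots> \<le> ennreal e" using n0[of "n0 + j"] by (simp add: t_def)
          finally show "bloch_norm (\<lambda>z. - (K (f (t j)) z - k z)) \<le> ennreal e" .
        qed
        also have "\<dots> = ennreal (real N * e)" using e by (simp add: ennreal_mult' ennreal_of_nat_eq_real_of_nat)
        finally show "bloch_norm (\<lambda>z. \<Sum>j<N. - (K (f (t j)) z - k z)) \<le> ennreal (real N * e)" .
      qed
      also have "\<dots> = ennreal (M + real N * e)" using e by (simp add: M_def ennreal_plus)
      finally show ?thesis using e by (subst (asm) ennreal_le_iff) (auto simp: M_def)
    qed
    show ?thesis
    proof (rule ccontr)
      assume "\<not> \<kappa> \<le> e"
      then obtain N where "M < real N * (\<kappa> - e)" using reals_Archimedean3[of "\<kappa> - e"] by auto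
      then show False using bound[of N] by (simp add: algebra_simps)
    qed
  qed
  then have "\<kappa> \<le> 0" using dense_ge by blast
  then have k0: "bloch_norm k = 0" using \<kappa> by simp
  have "bloch_norm (K (f (s n))) \<le> bloch_norm (\<lambda>z. K (f (s n)) z - k z)" for n
  proof -
    have "bloch_norm (\<lambda>z. (K (f (s n)) z - k z) + k z) \<le> bloch_norm (\<lambda>z. K (f (s n)) z - k z) + bloch_norm k"
      by (intro bloch_norm_add_le holomorphic_intros hol KX fX k)
    then show ?thesis using k0 by simp
  qed
  then have "(\<lambda>n. bloch_norm (K (f (s n)))) \<longlonglongrightarrow> 0"
    by (intro tendsto_sandwich[OF _ _ tendsto_const lim]) auto
  then show ?thesis using s unfolding f_def by blast
qed

text \<open>The exponent is 1 from the Bloch norm plus (lam - 1)/2 from the maximal growth of Morrey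
  functions.\<close>

definition bloch_weight :: "real \<Rightarrow> (complex \<Rightarrow> complex) \<Rightarrow> complex \<Rightarrow> real" where
  "bloch_weight lam g z = (1 - (cmod z)\<^sup>2) powr ((1 + lam) / 2) * cmod (deriv g z)"

text \<open>Any m below the limsup is exceeded along a lacunary sequence of points. At these, T_g
  applied to the test function has Bloch norm at least m / 1000, while K sends a subsequence to 0;
  hence T_g - K has norm at least m / 1000 for every compact K.\<close>

lemma Limsup_bloch_weight_le_essential_norm:
  assumes lam: "0 < lam" "lam < 1" and g: "g holomorphic_on unit_disc"
    and T: "bounded_operator (little_morrey lam) (morrey_norm lam) little_bloch bloch_norm (volterra g)"
  shows "Limsup at_unit_circle (\<lambda>z. ennreal (bloch_weight lam g z))
    \<le> ennreal 1000 * essential_norm (little_morrey lam) (morrey_norm lam) little_bloch bloch_norm (volterra g)"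
proof -
  let ?L = "Limsup at_unit_circle (\<lambda>z. ennreal (bloch_weight lam g z))"
  have c: "ennreal (1 / 1000) * ennreal 1000 = 1"
    by (subst ennreal_mult'[symmetric]) auto
  then have c': "ennreal 1000 * ennreal (1 / 1000) = 1" by (simp only: mult.commute)
  have main: "ennreal m \<le> ennreal 1000 * operator_norm (little_morrey lam) (morrey_norm lam) bloch_norm (\<lambda>f z. volterra g f z - K f z)"
    if K: "compact_operator (little_morrey lam) (morrey_norm lam) little_bloch bloch_norm K"
      and m: "0 \<le> m" "ennreal m < ?L" for K m
  proof -
    let ?N = "operator_norm (little_morrey lam) (morrey_norm lam) bloch_norm (\<lambda>f z. volterra g f z - K f z)"
    have "\<not> (\<forall>\<^sub>F z in at_unit_circle. ennreal (bloch_weight lam g z) \<le> ennreal m)"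
      using m Limsup_bounded[of "\<lambda>z. ennreal (bloch_weight lam g z)" "ennreal m"] by (meson not_le)
    then have fr: "\<exists>\<^sub>F z in at_unit_circle. m < bloch_weight lam g z"
      using m(1) by (simp add: frequently_def not_less ennreal_le_iff2) (metis (mono_tags, lifting) eventually_mono)
    have ex: "\<exists>a. cmod a < 1 \<and> (1 - (cmod a)\<^sup>2) powr (lam / 2) \<le> e \<and> m < bloch_weight lam g a" if "0 < e" for e
      using frequently_ex[OF frequently_eventually_frequently[OF fr eventually_at_unit_circle_powr_le[of "lam / 2" e]]] lam that by auto
    define P where "P = (\<lambda>a. cmod a < 1 \<and> m < bloch_weight lam g a)"
    \<comment> \<open>Lacunarity only asks the next point to be close enough to the circle, and m is
      exceeded arbitrarily close to it.\<close>
    have "\<exists>a. \<forall>n. P (a n) \<and> (1 - (cmod (a (Suc n)))\<^sup>2) powr (lam / 2) \<le> (1 - (cmod (a n))\<^sup>2) powr (lam / 2) / 2"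
    proof (rule dependent_nat_choice)
      show "\<exists>a. P a" using ex[of 1] by (auto simp: P_def)
      fix a :: complex and n :: nat assume "P a"
      then have "0 < (1 - (cmod a)\<^sup>2) powr (lam / 2) / 2" using one_minus_square_bounds[of "cmod a"] by (simp add: P_def)
      from ex[OF this] show "\<exists>b. P b \<and> (1 - (cmod b)\<^sup>2) powr (lam / 2) \<le> (1 - (cmod a)\<^sup>2) powr (lam / 2) / 2"
        by (auto simp: P_def)
    qed
    then obtain a where a: "\<And>n. cmod (a n) < 1" "\<And>n. m < bloch_weight lam g (a n)"
      and lac: "\<And>n. (1 - (cmod (a (Suc n)))\<^sup>2) powr (lam / 2) \<le> (1 - (cmod (a n))\<^sup>2) powr (lam / 2) / 2"
      unfolding P_def by blast
    define f where "f = (\<lambda>n. restrict_disc (morrey_test lam (a n)))"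
    obtain s where s: "strict_mono s" and lim: "(\<lambda>n. bloch_norm (K (f (s n)))) \<longlonglongrightarrow> 0"
      using compact_operator_test_limit[where a = a, OF lam a(1) lac K] unfolding f_def by blast
    have fX: "f n \<in> little_morrey lam" for n
      unfolding f_def using lam a by (intro restrict_disc_in_little_morrey morrey_test_analytic) auto
    have f1: "morrey_norm lam (f n) \<le> 1" for n
    proof -
      have "morrey_norm lam (restrict_disc (\<lambda>z. \<Sum>j<1. morrey_test lam (a (n + j)) z)) \<le> 1"
        by (rule morrey_norm_test_sum_le[OF lam]) (use a lac in auto)
      then show ?thesis by (simp add: f_def)
    qed
    have K': "bounded_operator (little_morrey lam) (morrey_norm lam) little_bloch bloch_norm K"
      using K unfolding compact_operator_def by blast
    have "ennreal (m / 1000) \<le> ?N + bloch_norm (K (f n))" for n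
    proof -
      have fh: "f n holomorphic_on unit_disc" using fX by (rule little_morrey_holomorphic)
      have Kh: "K (f n) holomorphic_on unit_disc"
        using K' fX unfolding bounded_operator_def by (intro little_bloch_holomorphic) blast
      have Th: "volterra g (f n) holomorphic_on unit_disc" by (rule volterra_holomorphic[OF g fh])
      have an: "a n \<in> unit_disc" using a by simp
      have "(1 - (cmod (a n))\<^sup>2) * cmod (f n (a n) * deriv g (a n)) = (1 - (cmod (a n))\<^sup>2) * cmod (morrey_test lam (a n) (a n)) * cmod (deriv g (a n))"
        using an by (simp add: f_def restrict_disc_def norm_mult)
      also have "\<dots> = bloch_weight lam g (a n) / 1000"
        unfolding morrey_test_at[OF a(1)] by (simp add: bloch_weight_def)
      finally have eq: "(1 - (cmod (a n))\<^sup>2) * cmod (f n (a n) * deriv g (a n)) = bloch_weight lam g (a n) / 1000" .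
      have "ennreal (m / 1000) \<le> ennreal (bloch_weight lam g (a n) / 1000)"
        using a(2)[of n] by (intro ennreal_leI) simp
      also have "\<dots> \<le> bloch_norm (volterra g (f n))"
        unfolding bloch_norm_volterra[OF g fh] eq[symmetric] using an by (rule SUP_upper)
      also have "volterra g (f n) = (\<lambda>z. (volterra g (f n) z - K (f n) z) + K (f n) z)" by simp
      also have "bloch_norm \<dots> \<le> bloch_norm (\<lambda>z. volterra g (f n) z - K (f n) z) + bloch_norm (K (f n))"
        by (intro bloch_norm_add_le holomorphic_intros Th Kh)
      also have "bloch_norm (\<lambda>z. volterra g (f n) z - K (f n) z) \<le> ?N"
        unfolding operator_norm_def using fX f1 by (intro SUP_upper2[of "f n"]) auto
      finally show ?thesis by (simp add: add_right_mono)
    qed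
    then have "ennreal (m / 1000) \<le> ?N + bloch_norm (K (f (s n)))" for n by blast
    moreover have "(\<lambda>n. ?N + bloch_norm (K (f (s n)))) \<longlonglongrightarrow> ?N + 0"
      by (intro tendsto_intros lim)
    ultimately have "ennreal (m / 1000) \<le> ?N" by (intro LIMSEQ_le_const) auto
    then have "ennreal 1000 * ennreal (m / 1000) \<le> ennreal 1000 * ?N" by (intro mult_left_mono) auto
    also have "ennreal 1000 * ennreal (m / 1000) = ennreal m"
      by (subst ennreal_mult'[symmetric]) auto
    finally show ?thesis .
  qed
  have "ennreal (1 / 1000) * ?L \<le> essential_norm (little_morrey lam) (morrey_norm lam) little_bloch bloch_norm (volterra g)"
    unfolding essential_norm_def
  proof (rule INF_greatest)
    fix K assume "K \<in> {K. compact_operator (little_morrey lam) (morrey_norm lam) little_bloch bloch_norm K}"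
    then have K: "compact_operator (little_morrey lam) (morrey_norm lam) little_bloch bloch_norm K" by simp
    let ?N = "operator_norm (little_morrey lam) (morrey_norm lam) bloch_norm (\<lambda>f z. volterra g f z - K f z)"
    have "?L \<le> ennreal 1000 * ?N"
    proof (rule dense_le)
      fix y assume y: "y < ?L"
      then obtain m where "0 \<le> m" "y = ennreal m" by (cases y) auto
      then show "y \<le> ennreal 1000 * ?N" using main[OF K] y by blast
    qed
    then have "ennreal (1 / 1000) * ?L \<le> ennreal (1 / 1000) * (ennreal 1000 * ?N)" by (intro mult_left_mono) auto
    then show "ennreal (1 / 1000) * ?L \<le> ?N" by (simp only: mult.assoc[symmetric] c mult_1)
  qed
  then have "ennreal 1000 * (ennreal (1 / 1000) * ?L) \<le> ennreal 1000 * essential_norm (little_morrey lam) (morrey_norm lam) little_bloch bloch_norm (volterra g)"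
    by (intro mult_left_mono) auto
  then show ?thesis by (simp only: mult.assoc[symmetric] c' mult_1)
qed


subsection \<open>Upper bound for the essential norm\<close>

text \<open>The constant 1 belongs to the little Morrey space, and T_g 1 has derivative g'.\<close>

lemma little_bloch_symbol:
  assumes lam: "lam < 3" and g: "g holomorphic_on unit_disc"
    and T: "bounded_operator (little_morrey lam) (morrey_norm lam) little_bloch bloch_norm (volterra g)"
  obtains N where "\<And>z. z \<in> unit_disc \<Longrightarrow> (1 - (cmod z)\<^sup>2) * cmod (deriv g z) \<le> N"
    "((\<lambda>z. (1 - (cmod z)\<^sup>2) * cmod (deriv g z)) \<longlongrightarrow> 0) at_unit_circle"
proof -
  let ?e = "restrict_disc (\<lambda>_. 1)"
  have e: "?e \<in> little_morrey lam"
    by (rule restrict_disc_in_little_morrey[OF lam]) simp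
  then have V: "volterra g ?e \<in> little_bloch" using T unfolding bounded_operator_def by blast
  have eh: "?e holomorphic_on unit_disc" by (rule little_morrey_holomorphic[OF e])
  have dV: "deriv (volterra g ?e) z = deriv g z" if "z \<in> unit_disc" for z
    using DERIV_imp_deriv[OF volterra_has_field_derivative[OF g eh that]] that by (simp add: restrict_disc_def)
  have "bloch_norm (volterra g ?e) < \<infinity>" using V by (simp add: little_bloch_def bloch_def)
  then obtain N where N: "0 \<le> N" "bloch_norm (volterra g ?e) = ennreal N" by (cases "bloch_norm (volterra g ?e)") auto
  show ?thesis
  proof (rule that)
    fix z :: complex assume z: "z \<in> unit_disc"
    have "ennreal ((1 - (cmod z)\<^sup>2) * cmod (?e z * deriv g z)) \<le> bloch_norm (volterra g ?e)"
      unfolding bloch_norm_volterra[OF g eh] using z by (rule SUP_upper)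
    then show "(1 - (cmod z)\<^sup>2) * cmod (deriv g z) \<le> N" using z N by (simp add: restrict_disc_def)
  next
    have "((\<lambda>z. (1 - (cmod z)\<^sup>2) * cmod (deriv (volterra g ?e) z)) \<longlongrightarrow> 0) at_unit_circle"
      using V by (simp add: little_bloch_def)
    moreover have "\<forall>\<^sub>F z in at_unit_circle. (1 - (cmod z)\<^sup>2) * cmod (deriv (volterra g ?e) z) = (1 - (cmod z)\<^sup>2) * cmod (deriv g z)"
      unfolding eventually_at_unit_circle using dV by (intro exI[of _ 0]) auto
    ultimately show "((\<lambda>z. (1 - (cmod z)\<^sup>2) * cmod (deriv g z)) \<longlongrightarrow> 0) at_unit_circle"
      by (rule Lim_transform_eventually)
  qed
qed

lemma dilation_maps_disc:
  assumes "0 < r" "r < 1" "cmod z < 1"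
  shows "cmod (of_real r * z) < r" "cmod (of_real r * z) \<le> cmod z" "cmod (of_real r * z) < 1"
proof -
  show *: "cmod (of_real r * z) < r" using assms by (simp add: norm_mult)
  show "cmod (of_real r * z) \<le> cmod z" using assms by (simp add: norm_mult mult_left_le_one_le)
  show "cmod (of_real r * z) < 1" using * assms by linarith
qed

lemma holomorphic_dilation:
  assumes "0 < r" "r < 1" "f holomorphic_on unit_disc"
  shows "(\<lambda>z. f (of_real r * z)) holomorphic_on unit_disc"
  by (rule holomorphic_on_compose_gen[OF _ assms(3), of "\<lambda>z. of_real r * z", unfolded o_def])
    (use dilation_maps_disc[OF assms(1,2)] in \<open>auto intro!: holomorphic_intros\<close>)

text \<open>The dilate sees f only on |w| <= r. A norm-bounded sequence has, by Montel, a
  subsequence converging uniformly there, and T_g turns uniform convergence into Bloch convergence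
  because (1 - |z|^2) |g'| is bounded.\<close>

lemma compact_volterra_dilation:
  assumes lam: "0 < lam" "lam < 1" and g: "g holomorphic_on unit_disc" and r: "0 < r" "r < 1"
    and N: "\<And>z. z \<in> unit_disc \<Longrightarrow> (1 - (cmod z)\<^sup>2) * cmod (deriv g z) \<le> N"
    and lim: "((\<lambda>z. (1 - (cmod z)\<^sup>2) * cmod (deriv g z)) \<longlongrightarrow> 0) at_unit_circle"
  shows "compact_operator (little_morrey lam) (morrey_norm lam) little_bloch bloch_norm (\<lambda>f. volterra g (\<lambda>z. f (of_real r * z)))"
    (is "compact_operator _ _ _ _ ?K")
proof -
  note hol = little_morrey_holomorphic
  have Kh: "(\<lambda>z. f (of_real r * z)) holomorphic_on unit_disc" if "f holomorphic_on unit_disc" for f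
    by (rule holomorphic_dilation[OF r that])
  have N0: "0 \<le> N" using N[of 0] by (simp add: order_trans[OF norm_ge_zero])
  define c where "c = (1 + 8 / (1 - lam)) * (1 - r) powr ((lam - 1) / 2)"
  have c0: "0 \<le> c" using lam by (simp add: c_def)
  have growth: "cmod (f w) \<le> c * M" if f: "f holomorphic_on unit_disc" and M: "morrey_norm lam f \<le> ennreal M" "0 \<le> M" and w: "cmod w \<le> r" for f M w
  proof -
    have "cmod (f w) \<le> (1 + 8 / (1 - lam)) * M * (1 - cmod w) powr ((lam - 1) / 2)"
      using lam r w by (intro morrey_growth f M) auto
    also have "\<dots> \<le> (1 + 8 / (1 - lam)) * M * (1 - r) powr ((lam - 1) / 2)"
      using lam r w M by (intro mult_left_mono powr_mono2') auto
    finally show ?thesis by (simp add: c_def mult_ac)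
  qed
  \<comment> \<open>Stated for all holomorphic f because it is also applied to the Montel limit
    \<open>G\<close>, of which only holomorphy is known.\<close>
  have KY: "?K f \<in> little_bloch" if f: "f holomorphic_on unit_disc" for f
  proof -
    have "continuous_on (cball 0 r) f"
      by (intro holomorphic_on_imp_continuous_on holomorphic_on_subset[OF f]) (use r in auto)
    then have "bounded (f ` cball 0 r)"
      by (intro compact_imp_bounded compact_continuous_image) auto
    then obtain A where A: "\<And>z. z \<in> cball 0 r \<Longrightarrow> cmod (f z) \<le> A"
      unfolding bounded_iff by blast
    show ?thesis
      by (rule volterra_in_little_bloch[OF g Kh[OF f] _ N lim, of A])
        (use A dilation_maps_disc[OF r] in \<open>auto simp: less_imp_le\<close>)
  qed
  have "bounded_operator (little_morrey lam) (morrey_norm lam) little_bloch bloch_norm ?K"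
    unfolding bounded_operator_def
  proof (intro conjI ballI allI)
    fix f assume f: "f \<in> little_morrey lam"
    show "?K f \<in> little_bloch" by (rule KY[OF hol[OF f]])
    show "?K (\<lambda>z. b * f z) = (\<lambda>z. b * ?K f z)" for b
      by (rule volterra_cmult[OF g Kh[OF hol[OF f]]])
    show "?K (\<lambda>z. f z + k z) = (\<lambda>z. ?K f z + ?K k z)" if "k \<in> little_morrey lam" for k
      by (rule volterra_add[OF g Kh[OF hol[OF f]] Kh[OF hol[OF that]]])
  next
    show "\<exists>M::real. \<forall>f\<in>little_morrey lam. bloch_norm (?K f) \<le> ennreal M * morrey_norm lam f"
    \<comment> \<open>Adding 1 keeps the factor positive, so that the right-hand side is infinite
      when the norm of f is; 0 times infinity would be 0.\<close>
    proof (intro exI[of _ "N * c + 1"] ballI)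
      fix f assume f: "f \<in> little_morrey lam"
      show "bloch_norm (?K f) \<le> ennreal (N * c + 1) * morrey_norm lam f"
      proof (cases "morrey_norm lam f")
        case (real m)
        have "bloch_norm (?K f) \<le> ennreal (N * (c * m))"
          by (rule bloch_norm_volterra_le[OF g Kh[OF hol[OF f]] _ N])
            (use dilation_maps_disc[OF r] growth[OF hol[OF f], of m] real in \<open>auto simp: less_imp_le\<close>)
        also have "\<dots> \<le> ennreal ((N * c + 1) * m)" using real by (intro ennreal_leI) (simp add: algebra_simps)
        also have "\<dots> = ennreal (N * c + 1) * morrey_norm lam f"
          using real N0 c0 by (simp add: ennreal_mult'')
        finally show ?thesis .
      next
        case top
        have "0 < N * c + 1" using N0 c0 by (simp add: add_nonneg_pos)
        then show ?thesis using top by (simp add: ennreal_mult_top)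
      qed
    qed
  qed
  moreover have "\<exists>k\<in>little_bloch. \<exists>s::nat \<Rightarrow> nat. strict_mono s \<and> (\<lambda>n. bloch_norm (\<lambda>z. ?K (F (s n)) z - k z)) \<longlonglongrightarrow> 0"
    if F: "\<And>n. F n \<in> little_morrey lam" and M: "\<And>n. morrey_norm lam (F n) \<le> ennreal M" for F :: "nat \<Rightarrow> complex \<Rightarrow> complex" and M
  proof -
    define M' where "M' = max 0 M"
    have M': "0 \<le> M'" "\<And>n. morrey_norm lam (F n) \<le> ennreal M'"
      by (auto simp: M'_def intro!: order_trans[OF M ennreal_leI])
    have bnd: "\<exists>B. \<forall>h\<in>range F. \<forall>z\<in>S. cmod (h z) \<le> B" if S: "compact S" "S \<subseteq> unit_disc" for S
    proof -
      obtain \<rho> where \<rho>: "\<rho> < 1" "\<And>z. z \<in> S \<Longrightarrow> cmod z \<le> \<rho>"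
      proof (cases "S = {}")
        case False
        then obtain x where "x \<in> S" "\<And>y. y \<in> S \<Longrightarrow> cmod y \<le> cmod x"
          using continuous_attains_sup[OF S(1), of cmod] continuous_on_norm_id by blast
        then show ?thesis using S that[of "cmod x"] by auto
      qed (use that[of 0] in auto)
      have "cmod (F n z) \<le> (1 + 8 / (1 - lam)) * M' * (1 - \<rho>) powr ((lam - 1) / 2)" if z: "z \<in> S" for n z
      proof -
        have "cmod (F n z) \<le> (1 + 8 / (1 - lam)) * M' * (1 - cmod z) powr ((lam - 1) / 2)"
          using lam S z by (intro morrey_growth hol[OF F] M') auto
        also have "\<dots> \<le> (1 + 8 / (1 - lam)) * M' * (1 - \<rho>) powr ((lam - 1) / 2)"
          using lam \<rho> z M' by (intro mult_left_mono powr_mono2') auto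
        finally show ?thesis .
      qed
      then show ?thesis by blast
    qed
    obtain G s where G: "G holomorphic_on unit_disc" and s: "strict_mono (s :: nat \<Rightarrow> nat)"
      and ul: "\<And>S. compact S \<Longrightarrow> S \<subseteq> unit_disc \<Longrightarrow> uniform_limit S (F \<circ> s) G sequentially"
    proof (rule Montel[of unit_disc "range F" F])
      show "h holomorphic_on unit_disc" if "h \<in> range F" for h using that hol F by auto
    qed (use bnd in auto)
    have "(\<lambda>n. bloch_norm (\<lambda>z. ?K (F (s n)) z - ?K G z)) \<longlonglongrightarrow> 0"
    proof (rule order_tendstoI)
      fix e :: ennreal assume "0 < e"
      then obtain e' where "0 < e'" "e' < e" using dense by blast
      then obtain e0 where e0: "0 < e0" "ennreal e0 < e"
        by (cases e') (auto simp: top_unique)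
      have "uniform_limit (cball 0 r) (F \<circ> s) G sequentially"
        by (rule ul) (use r in auto)
      \<comment> \<open>Division by N + 1 instead of N, since N may be 0.\<close>
      from uniform_limitD[OF this, of "e0 / (N + 1)"] e0 N0
      have "\<forall>\<^sub>F n in sequentially. \<forall>w\<in>cball 0 r. dist ((F \<circ> s) n w) (G w) < e0 / (N + 1)" by simp
      then show "\<forall>\<^sub>F n in sequentially. bloch_norm (\<lambda>z. ?K (F (s n)) z - ?K G z) < e"
      proof eventually_elim
        case (elim n)
        have "bloch_norm (\<lambda>z. ?K (F (s n)) z - ?K G z) = bloch_norm (volterra g (\<lambda>z. F (s n) (of_real r * z) - G (of_real r * z)))"
          by (rule arg_cong[OF volterra_diff[OF g Kh[OF hol[OF F]] Kh[OF G], symmetric]])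
        also have "\<dots> \<le> ennreal (N * (e0 / (N + 1)))"
        proof (rule bloch_norm_volterra_le[OF g _ _ N])
          fix z :: complex assume "z \<in> unit_disc"
          then have "of_real r * z \<in> cball 0 r" using dilation_maps_disc(1)[OF r, of z] by simp
          from bspec[OF elim this] show "cmod (F (s n) (of_real r * z) - G (of_real r * z)) \<le> e0 / (N + 1)"
            by (simp add: dist_norm)
        qed (intro holomorphic_intros Kh hol[OF F] G)
        also have "\<dots> \<le> ennreal e0" using N0 e0 by (intro ennreal_leI) (simp add: field_simps)
        also note e0(2)
        finally show ?case .
      qed
    qed simp
    then show ?thesis using KY[OF G] s by blast
  qed
  ultimately show ?thesis unfolding compact_operator_def by blast
qed

text \<open>The disc is cut at a radius s beyond which the weight of g is at most M. Inside, f(z) -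
  f(r z) is small for r near 1; outside no cancellation is available, and the growth bound is
  applied to both terms.\<close>

lemma essential_norm_le_Limsup_bloch_weight:
  assumes lam: "0 < lam" "lam < 1" and g: "g holomorphic_on unit_disc"
    and T: "bounded_operator (little_morrey lam) (morrey_norm lam) little_bloch bloch_norm (volterra g)"
  shows "essential_norm (little_morrey lam) (morrey_norm lam) little_bloch bloch_norm (volterra g)
    \<le> ennreal (4 * (1 + 8 / (1 - lam))) * Limsup at_unit_circle (\<lambda>z. ennreal (bloch_weight lam g z))"
proof (rule le_ennreal_cmultI)
  define K where "K = 1 + 8 / (1 - lam)"
  have K: "1 \<le> K" using lam by (simp add: K_def)
  then have "0 < 4 * K" by simp
  then show "0 < 4 * (1 + 8 / (1 - lam))" unfolding K_def .
  fix M :: real assume M: "0 < M" "Limsup at_unit_circle (\<lambda>z. ennreal (bloch_weight lam g z)) < ennreal M"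
  have "\<forall>\<^sub>F z in at_unit_circle. ennreal (bloch_weight lam g z) < ennreal M"
    by (rule Limsup_lessD[OF M(2)])
  then obtain s0 where s0: "s0 < 1" "\<And>z. s0 < cmod z \<Longrightarrow> cmod z < 1 \<Longrightarrow> ennreal (bloch_weight lam g z) < ennreal M"
    unfolding eventually_at_unit_circle by blast
  define s where "s = max 0 s0"
  have s: "0 \<le> s" "s < 1" using s0 by (auto simp: s_def)
  have outer: "bloch_weight lam g z \<le> M" if "s < cmod z" "cmod z < 1" for z
    using s0(2)[of z] that M(1) by (simp add: s_def ennreal_less_iff bloch_weight_def less_imp_le)
  have "lam < 3" using lam by simp
  then obtain N where N: "\<And>z. z \<in> unit_disc \<Longrightarrow> (1 - (cmod z)\<^sup>2) * cmod (deriv g z) \<le> N"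
    and lim: "((\<lambda>z. (1 - (cmod z)\<^sup>2) * cmod (deriv g z)) \<longlongrightarrow> 0) at_unit_circle"
    using little_bloch_symbol[OF _ g T] by blast
  have N0: "0 \<le> N" using N[of 0] by (simp add: order_trans[OF norm_ge_zero])
  \<comment> \<open>Bounds f' on |z| <= s for all f of Morrey norm at most 1.\<close>
  define D where "D = 4 * (1 - s) powr ((lam - 3) / 2)"
  have D0: "0 \<le> D" by (simp add: D_def)
  \<comment> \<open>Chosen to give N * D * (1 - r) <= M. The minimum with 1/2 keeps r positive, and
    the + 1 avoids a division by 0.\<close>
  define r where "r = 1 - min (1 / 2) (M / (N * D + 1))"
  have ND: "0 < N * D + 1" using N0 D0 by (simp add: add_nonneg_pos)
  have r: "0 < r" "r < 1" "1 - r \<le> M / (N * D + 1)" using M ND by (auto simp: r_def min_def)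
  have Dr: "N * (D * (1 - r)) \<le> M"
  proof -
    have "N * (D * (1 - r)) \<le> (N * D + 1) * (1 - r)" using r by (simp add: algebra_simps)
    also have "\<dots> \<le> (N * D + 1) * (M / (N * D + 1))" using r ND by (intro mult_left_mono) auto
    also have "\<dots> = M" using ND by simp
    finally show ?thesis .
  qed
  let ?R = "\<lambda>f. volterra g (\<lambda>z. f (of_real r * z))"
  have "compact_operator (little_morrey lam) (morrey_norm lam) little_bloch bloch_norm ?R"
    by (rule compact_volterra_dilation[OF lam g r(1,2) N lim])
  then have "essential_norm (little_morrey lam) (morrey_norm lam) little_bloch bloch_norm (volterra g)
    \<le> operator_norm (little_morrey lam) (morrey_norm lam) bloch_norm (\<lambda>f z. volterra g f z - ?R f z)"
    unfolding essential_norm_def by (intro INF_lower) simp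
  also have "\<dots> \<le> ennreal (4 * K * M)"
    unfolding operator_norm_def
  proof (rule SUP_least)
    fix f assume "f \<in> {f \<in> little_morrey lam. morrey_norm lam f \<le> 1}"
    then have f: "f \<in> little_morrey lam" "morrey_norm lam f \<le> ennreal 1" by auto
    have fh: "f holomorphic_on unit_disc" by (rule little_morrey_holomorphic[OF f(1)])
    have rh: "(\<lambda>z. f (of_real r * z)) holomorphic_on unit_disc" by (rule holomorphic_dilation[OF r(1,2) fh])
    have "bloch_norm (\<lambda>z. volterra g f z - ?R f z) = bloch_norm (volterra g (\<lambda>z. f z - f (of_real r * z)))"
      by (rule arg_cong[OF volterra_diff[OF g fh rh, symmetric]])
    also have "\<dots> = (SUP z\<in>unit_disc. ennreal ((1 - (cmod z)\<^sup>2) * cmod ((f z - f (of_real r * z)) * deriv g z)))"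
      by (rule bloch_norm_volterra[OF g]) (intro holomorphic_intros fh rh)
    also have "\<dots> \<le> ennreal (4 * K * M)"
    proof (intro SUP_least ennreal_leI)
      fix z :: complex assume z: "z \<in> unit_disc"
      define x where "x = 1 - (cmod z)\<^sup>2"
      have x: "0 < x" "x \<le> 2 * (1 - cmod z)" using one_minus_square_bounds[of "cmod z"] z by (auto simp: x_def)
      note rz = dilation_maps_disc[OF r(1,2), of z]
      show "(1 - (cmod z)\<^sup>2) * cmod ((f z - f (of_real r * z)) * deriv g z) \<le> 4 * K * M"
      proof (cases "cmod z \<le> s")
        case True
        have "cmod (f z - f (of_real r * z)) \<le> D * cmod (z - of_real r * z)"
        proof (rule field_differentiable_bound[of "cball 0 s" f "deriv f"])
          fix w :: complex assume w: "w \<in> cball 0 s"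
          show "(f has_field_derivative deriv f w) (at w within cball 0 s)"
            using w s by (intro holomorphic_derivI[OF fh]) auto
          have "cmod (deriv f w) \<le> 4 * 1 * (1 - cmod w) powr ((lam - 3) / 2)"
            using lam w s by (intro morrey_deriv_growth fh f(2)) auto
          also have "\<dots> \<le> D"
            unfolding D_def using lam w s by (simp add: powr_mono2')
          finally show "cmod (deriv f w) \<le> D" .
        qed (use True rz z in auto)
        also have "cmod (z - of_real r * z) = (1 - r) * cmod z"
        proof -
          have "z - of_real r * z = of_real (1 - r) * z" by (simp add: algebra_simps)
          then show ?thesis using r by (simp only: norm_mult norm_of_real abs_of_pos diff_gt_0_iff_gt)
        qed
        also have "D * ((1 - r) * cmod z) \<le> D * (1 - r)"
          using z r D0 by (intro mult_left_mono mult_right_le_one_le) auto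
        finally have "x * cmod (deriv g z) * cmod (f z - f (of_real r * z)) \<le> N * (D * (1 - r))"
          using N[OF z] N0 x by (intro mult_mono) (auto simp: x_def)
        also have "\<dots> \<le> M" by (rule Dr)
        also have "\<dots> \<le> 4 * K * M" using K M by simp
        finally show ?thesis by (simp add: x_def norm_mult mult_ac)
      next
        case False
        \<comment> \<open>As |r z| <= |z|, this serves f(z) and f(r z) alike; adding the two gives
          the 4 in 4 * K.\<close>
        have gr: "cmod (f w) \<le> 2 * K * x powr ((lam - 1) / 2)" if w: "cmod w \<le> cmod z" for w
        proof -
          have "cmod (f w) \<le> K * 1 * (1 - cmod w) powr ((lam - 1) / 2)"
            unfolding K_def using lam w z by (intro morrey_growth fh f(2)) auto
          also have "\<dots> \<le> K * (x / 2) powr ((lam - 1) / 2)"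
            using K lam x w by (simp, intro mult_left_mono powr_mono2') auto
          also have "(x / 2) powr ((lam - 1) / 2) = x powr ((lam - 1) / 2) * 2 powr ((1 - lam) / 2)"
          proof -
            have "(x / 2) powr b = x powr b * 2 powr (- b)" for b :: real
              using x by (simp add: powr_divide powr_minus_divide)
            moreover have "- ((lam - 1) / 2) = (1 - lam) / 2" by (simp only: minus_divide_left minus_diff_eq)
            ultimately show ?thesis by (simp only:)
          qed
          also have "\<dots> \<le> x powr ((lam - 1) / 2) * 2 powr 1"
            using lam by (intro mult_left_mono powr_mono) auto
          finally show ?thesis using K by (simp add: mult_ac)
        qed
        have "cmod (f z - f (of_real r * z)) \<le> 4 * K * x powr ((lam - 1) / 2)"
          using norm_triangle_ineq4[of "f z" "f (of_real r * z)"] gr[of z] gr[OF rz(2)] z by simp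
        then have "x * cmod (deriv g z) * cmod (f z - f (of_real r * z)) \<le> x * cmod (deriv g z) * (4 * K * x powr ((lam - 1) / 2))"
          using x by (intro mult_left_mono) auto
        also have "\<dots> = 4 * K * (x powr 1 * x powr ((lam - 1) / 2) * cmod (deriv g z))"
          using x by simp
        also have "x powr 1 * x powr ((lam - 1) / 2) = x powr ((1 + lam) / 2)"
          unfolding powr_add[symmetric] by (simp add: field_simps)
        also have "\<dots> * cmod (deriv g z) \<le> M"
          using outer[of z] False z by (simp add: bloch_weight_def x_def)
        finally show ?thesis using K by (simp add: x_def norm_mult mult_ac)
      qed
    qed
    finally show "bloch_norm (\<lambda>z. volterra g f z - ?R f z) \<le> ennreal (4 * K * M)" .
  qed
  finally show "essential_norm (little_morrey lam) (morrey_norm lam) little_bloch bloch_norm (volterra g)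
    \<le> ennreal (4 * (1 + 8 / (1 - lam)) * M)" by (simp add: K_def)
qed


subsection \<open>Comparison with the Carleson kernel integral\<close>

text \<open>The quotient is the modulus of the derivative at z of the disc automorphism that
  interchanges 0 and a. The exponent q stands for p + 1 - lam.\<close>

definition carleson_kernel_integral :: "real \<Rightarrow> real \<Rightarrow> (complex \<Rightarrow> complex) \<Rightarrow> complex \<Rightarrow> ennreal" where
  "carleson_kernel_integral p q g a = area_integral unit_disc
     (\<lambda>z. ((1 - (cmod a)\<^sup>2) / (cmod (1 - cnj a * z))\<^sup>2) powr q * (cmod (deriv g z))\<^sup>2 * (1 - (cmod z)\<^sup>2) powr p)"

text \<open>On the disc of radius d/2 about a, with d = 1 - |a|, the kernel is at least of order 1/d
  and 1 - |z|^2 at least of order d. The sub-mean value property yields the power 2 - q + p of d,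
  which equals 1 + lam.\<close>

lemma bloch_weight_le_carleson_kernel_integral:
  assumes lam: "0 \<le> lam" "lam \<le> 1" and p: "0 \<le> p" "lam \<le> p + 1" and g: "g holomorphic_on unit_disc" and a: "cmod a < 1"
  shows "ennreal ((bloch_weight lam g a)\<^sup>2)
    \<le> ennreal (16 * 2 powr p * (25 / 4) powr (p + 1 - lam)) * carleson_kernel_integral p (p + 1 - lam) g a"
proof -
  define q where "q = p + 1 - lam"
  have q: "0 \<le> q" using p by (simp add: q_def)
  define d where "d = 1 - cmod a"
  have d: "0 < d" "d \<le> 1" using a by (auto simp: d_def)
  have ad: "cmod a = 1 - d" by (simp add: d_def)
  define \<delta> where "\<delta> = 1 - (cmod a)\<^sup>2"
  have \<delta>: "0 < \<delta>" "\<delta> \<le> 2 * d" "d \<le> \<delta>" using one_minus_square_bounds[of "cmod a"] a by (auto simp: \<delta>_def d_def)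
  \<comment> \<open>A lower bound for the kernel part times the weight on that disc, with 4 / (25 d)
    = d / (5 d / 2)^2.\<close>
  define c where "c = (4 / (25 * d)) powr q * (d / 2) powr p"
  have c: "0 \<le> c" by (simp add: c_def)
  have B: "cmod z < 1" "d / 2 \<le> 1 - (cmod z)\<^sup>2" "cmod (1 - cnj a * z) \<le> 5 * d / 2" if z: "z \<in> ball a (d / 2)" for z
  proof -
    have az: "cmod (a - z) < d / 2" using z by (simp add: dist_norm)
    have *: "cmod z < cmod a + d / 2"
      using az norm_triangle_ineq2[of z a] by (simp add: norm_minus_commute)
    show z1: "cmod z < 1" using * d ad by linarith
    have "d / 2 \<le> 1 - cmod z" using * d ad by linarith
    then show "d / 2 \<le> 1 - (cmod z)\<^sup>2" using one_minus_square_bounds[of "cmod z"] z1 by auto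
    \<comment> \<open>Expansion about z = a: the two terms are at most 2 d and d/2 in modulus,
      whence 5 d / 2.\<close>
    have "1 - cnj a * z = of_real \<delta> + cnj a * (a - z)"
      by (simp add: \<delta>_def right_diff_distrib mult.commute[of "cnj a" a] complex_norm_square[symmetric])
    then have "cmod (1 - cnj a * z) \<le> \<delta> + cmod a * cmod (a - z)"
      using norm_triangle_ineq[of "of_real \<delta>" "cnj a * (a - z)"] \<delta> by (simp add: norm_mult)
    also have "cmod a * cmod (a - z) \<le> 1 * cmod (a - z)" using a by (intro mult_right_mono) auto
    finally show "cmod (1 - cnj a * z) \<le> 5 * d / 2" using az \<delta> by linarith
  qed
  have "(\<lambda>w. of_real (sqrt c) * deriv g w) holomorphic_on ball a (d / 2)"
    by (intro holomorphic_intros holomorphic_on_subset[OF holomorphic_deriv[OF g]]) (use B in auto)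
  from area_integral_mean_value[OF this]
  have "ennreal ((d / 2)\<^sup>2 * (c * (cmod (deriv g a))\<^sup>2)) \<le> area_integral (ball a (d / 2)) (\<lambda>w. c * (cmod (deriv g w))\<^sup>2)"
    using d c by (simp add: norm_mult power_mult_distrib)
  also have "\<dots> \<le> carleson_kernel_integral p q g a"
    unfolding carleson_kernel_integral_def
  proof (intro area_integral_mono)
    show "ball a (d / 2) \<subseteq> unit_disc" using B by auto
    fix w assume w: "w \<in> ball a (d / 2)"
    have nz: "0 < cmod (1 - cnj a * w)" using one_minus_cnj_mult_nonzero[of a w] a B[OF w] by simp
    have "4 / (25 * d) = d / (5 * d / 2)\<^sup>2" using d by (simp add: power2_eq_square field_simps)
    also have "\<dots> \<le> \<delta> / (cmod (1 - cnj a * w))\<^sup>2"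
      using \<delta> d nz B[OF w] by (intro frac_le power_mono) auto
    finally have "(4 / (25 * d)) powr q \<le> (\<delta> / (cmod (1 - cnj a * w))\<^sup>2) powr q"
      using d q by (intro powr_mono2) auto
    moreover have "(d / 2) powr p \<le> (1 - (cmod w)\<^sup>2) powr p"
      using d p B[OF w] by (intro powr_mono2) auto
    ultimately have "c \<le> (\<delta> / (cmod (1 - cnj a * w))\<^sup>2) powr q * (1 - (cmod w)\<^sup>2) powr p"
      unfolding c_def by (intro mult_mono) auto
    from mult_right_mono[OF this, of "(cmod (deriv g w))\<^sup>2"]
    show "c * (cmod (deriv g w))\<^sup>2 \<le> ((1 - (cmod a)\<^sup>2) / (cmod (1 - cnj a * w))\<^sup>2) powr q * (cmod (deriv g w))\<^sup>2 * (1 - (cmod w)\<^sup>2) powr p"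
      by (simp add: \<delta>_def mult_ac)
  qed
  finally have main: "ennreal ((d / 2)\<^sup>2 * (c * (cmod (deriv g a))\<^sup>2)) \<le> carleson_kernel_integral p q g a" .
  \<comment> \<open>One 4 bounds 2 powr (1 + lam), another undoes the square of d/2; the other two
    factors undo the constants in \<open>c\<close>.\<close>
  define C where "C = 16 * 2 powr p * (25 / 4) powr q"
  have "(bloch_weight lam g a)\<^sup>2 = \<delta> powr (1 + lam) * (cmod (deriv g a))\<^sup>2"
    unfolding bloch_weight_def \<delta>_def[symmetric] power_mult_distrib
    unfolding power2_eq_square powr_add[symmetric] field_sum_of_halves ..
  also have "\<dots> \<le> (4 * d powr (1 + lam)) * (cmod (deriv g a))\<^sup>2"
  proof (intro mult_right_mono)
    have "\<delta> powr (1 + lam) \<le> (2 * d) powr (1 + lam)" using \<delta> lam by (intro powr_mono2) auto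
    also have "\<dots> = 2 powr (1 + lam) * d powr (1 + lam)" using d by (simp add: powr_mult)
    also have "\<dots> \<le> 2 powr 2 * d powr (1 + lam)" using lam by (intro mult_right_mono powr_mono) auto
    finally show "\<delta> powr (1 + lam) \<le> 4 * d powr (1 + lam)" by simp
  qed simp
  also have "\<dots> = C * ((d / 2)\<^sup>2 * (c * (cmod (deriv g a))\<^sup>2))"
  proof -
    have e1: "(4 / (25 * d)) powr q = 1 / ((25 / 4) powr q * d powr q)"
      using d by (simp add: powr_divide powr_mult field_simps)
    have e2: "(d / 2) powr p = d powr p / 2 powr p" using d by (simp add: powr_divide)
    have e3: "d powr (1 + lam) = d\<^sup>2 * d powr p / d powr q"
      using d by (simp add: q_def powr_diff powr_add powr_numeral power2_eq_square field_simps)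
    show ?thesis unfolding C_def c_def e1 e2 e3 using d by (simp add: field_simps power2_eq_square)
  qed
  finally have "ennreal ((bloch_weight lam g a)\<^sup>2) \<le> ennreal (C * ((d / 2)\<^sup>2 * (c * (cmod (deriv g a))\<^sup>2)))"
    by (rule ennreal_leI)
  also have "\<dots> = ennreal C * ennreal ((d / 2)\<^sup>2 * (c * (cmod (deriv g a))\<^sup>2))"
    by (rule ennreal_mult') (simp add: C_def)
  also have "\<dots> \<le> ennreal C * carleson_kernel_integral p q g a"
    by (intro mult_left_mono main) simp
  finally show ?thesis unfolding C_def q_def .
qed

text \<open>For |z| > s the bound on g' leaves a Forelli-Rudin integral with exponents p - 1 - lam >
  -1 and 2 q, of order \<open>\<delta>\<close> powr - q, which cancels the factor
  \<open>\<delta>\<close> powr q. For |z| <= s the kernel has no singularity, so that factor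
  survives and makes this part negligible as |a| tends to 1.\<close>

lemma carleson_kernel_integral_le:
  assumes lam: "lam < p" and q: "q = p + 1 - lam" and p: "0 \<le> p" and a: "cmod a < 1" and g: "g holomorphic_on unit_disc"
    and s: "0 \<le> s" "s < 1" and M: "\<And>z. s < cmod z \<Longrightarrow> cmod z < 1 \<Longrightarrow> bloch_weight lam g z \<le> M"
    and D: "\<And>z. cmod z \<le> s \<Longrightarrow> cmod (deriv g z) \<le> D"
  shows "carleson_kernel_integral p q g a
    \<le> ennreal (M\<^sup>2 * (2 powr (2 * q - 1) * (1 / (p - lam) + 1 / q)) + D\<^sup>2 * (1 - s) powr (- 2 * q) * (1 - (cmod a)\<^sup>2) powr q)"
proof -
  define \<delta> where "\<delta> = 1 - (cmod a)\<^sup>2"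
  have \<delta>: "0 < \<delta>" using one_minus_square_bounds[of "cmod a"] a by (auto simp: \<delta>_def)
  have q1: "1 < q" using lam q by simp
  define S where "S = D\<^sup>2 * (1 - s) powr (- 2 * q)"
  define u where "u = (\<lambda>z. (1 - (cmod z)\<^sup>2) powr (p - 1 - lam) * cmod (1 - cnj a * z) powr - (2 * q))"
  have [measurable]: "u \<in> borel_measurable borel" unfolding u_def by measurable
  have kernel: "(\<delta> / (cmod (1 - cnj a * z))\<^sup>2) powr q = \<delta> powr q * cmod (1 - cnj a * z) powr - (2 * q)"
    if "cmod z < 1" for z
  proof -
    have nz: "0 < cmod (1 - cnj a * z)" using one_minus_cnj_mult_nonzero[of a z] a that by simp
    have "(cmod (1 - cnj a * z))\<^sup>2 powr q = cmod (1 - cnj a * z) powr (2 * q)"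
      using nz by (simp add: powr_powr flip: powr_numeral)
    moreover have "(\<delta> / (cmod (1 - cnj a * z))\<^sup>2) powr q = \<delta> powr q / (cmod (1 - cnj a * z))\<^sup>2 powr q"
      using \<delta> by (simp add: powr_divide)
    ultimately show ?thesis by (simp add: powr_minus_divide)
  qed
  have "carleson_kernel_integral p q g a \<le> area_integral unit_disc (\<lambda>z. (M\<^sup>2 * \<delta> powr q) * u z + S * \<delta> powr q)"
    unfolding carleson_kernel_integral_def
  proof (intro area_integral_mono subset_refl)
    fix z :: complex assume "z \<in> unit_disc"
    then have z: "cmod z < 1" by simp
    define x where "x = 1 - (cmod z)\<^sup>2"
    have x: "0 < x" "x \<le> 1" using one_minus_square_bounds[of "cmod z"] z by (auto simp: x_def)
    define m where "m = cmod (1 - cnj a * z)"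
    have nn: "0 \<le> M\<^sup>2 * \<delta> powr q * u z" "0 \<le> S * \<delta> powr q" by (auto simp: u_def S_def)
    have "(\<delta> / m\<^sup>2) powr q * (cmod (deriv g z))\<^sup>2 * x powr p \<le> (M\<^sup>2 * \<delta> powr q) * u z + S * \<delta> powr q"
    proof (cases "cmod z \<le> s")
      case False
      have "(cmod (deriv g z))\<^sup>2 * x powr (1 + lam) = (bloch_weight lam g z)\<^sup>2"
        unfolding bloch_weight_def x_def[symmetric] power_mult_distrib
        unfolding power2_eq_square powr_add[symmetric] field_sum_of_halves by (rule mult.commute)
      also have "\<dots> \<le> M\<^sup>2" using M[of z] False z by (intro power_mono) (auto simp: bloch_weight_def)
      finally have "(cmod (deriv g z))\<^sup>2 * x powr (1 + lam) \<le> M\<^sup>2" .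
      then have "(\<delta> / m\<^sup>2) powr q * x powr (p - 1 - lam) * ((cmod (deriv g z))\<^sup>2 * x powr (1 + lam)) \<le> (\<delta> / m\<^sup>2) powr q * x powr (p - 1 - lam) * M\<^sup>2"
        by (intro mult_left_mono) auto
      also have "(\<delta> / m\<^sup>2) powr q * x powr (p - 1 - lam) * M\<^sup>2 = M\<^sup>2 * \<delta> powr q * u z"
        unfolding m_def kernel[OF z] u_def x_def by (simp add: mult_ac)
      also have "(\<delta> / m\<^sup>2) powr q * x powr (p - 1 - lam) * ((cmod (deriv g z))\<^sup>2 * x powr (1 + lam))
         = (\<delta> / m\<^sup>2) powr q * (cmod (deriv g z))\<^sup>2 * (x powr (p - 1 - lam) * x powr (1 + lam))" by (simp only: mult_ac)
      also have "x powr (p - 1 - lam) * x powr (1 + lam) = x powr p" unfolding powr_add[symmetric] by simp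
      finally show ?thesis using nn by linarith
    next
      case True
      have "1 - cmod z \<le> m"
      proof -
        have "cmod (cnj a * z) \<le> cmod z" using a by (simp add: norm_mult mult_left_le_one_le)
        then show ?thesis using norm_triangle_ineq2[of 1 "cnj a * z"] by (simp add: m_def)
      qed
      then have "m powr - (2 * q) \<le> (1 - s) powr - (2 * q)" using True s q1 by (intro powr_mono2') auto
      moreover have "(cmod (deriv g z))\<^sup>2 \<le> D\<^sup>2" using D[OF True] by (intro power_mono) auto
      moreover have "x powr p \<le> 1" using x p by (intro powr_le1) auto
      ultimately have "(\<delta> powr q * m powr - (2 * q)) * (cmod (deriv g z))\<^sup>2 * x powr p \<le> (\<delta> powr q * (1 - s) powr - (2 * q)) * D\<^sup>2 * 1"
        by (intro mult_mono) auto
      then have "(\<delta> / m\<^sup>2) powr q * (cmod (deriv g z))\<^sup>2 * x powr p \<le> S * \<delta> powr q"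
        unfolding m_def kernel[OF z] by (simp add: S_def mult_ac)
      then show ?thesis using nn by linarith
    qed
    then show "((1 - (cmod a)\<^sup>2) / (cmod (1 - cnj a * z))\<^sup>2) powr q * (cmod (deriv g z))\<^sup>2 * (1 - (cmod z)\<^sup>2) powr p \<le> (M\<^sup>2 * \<delta> powr q) * u z + S * \<delta> powr q"
      unfolding \<delta>_def m_def x_def .
  qed
  \<comment> \<open>The two terms are written as a sum over truth values in order to use additivity
    for finite sums.\<close>
  also have "\<dots> = area_integral unit_disc (\<lambda>z. \<Sum>b\<in>{True, False}. if b then (M\<^sup>2 * \<delta> powr q) * u z else S * \<delta> powr q)"
    by simp
  also have "\<dots> = (\<Sum>b\<in>{True, False}. area_integral unit_disc (\<lambda>z. if b then (M\<^sup>2 * \<delta> powr q) * u z else S * \<delta> powr q))"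
    by (rule area_integral_sum) (auto simp: u_def S_def)
  also have "\<dots> = area_integral unit_disc (\<lambda>z. (M\<^sup>2 * \<delta> powr q) * u z) + area_integral unit_disc (\<lambda>z. S * \<delta> powr q)"
    by simp
  also have "area_integral unit_disc (\<lambda>z. (M\<^sup>2 * \<delta> powr q) * u z) = ennreal (M\<^sup>2 * \<delta> powr q) * area_integral unit_disc u"
    by (rule area_integral_cmult) auto
  also have "\<dots> \<le> ennreal (M\<^sup>2 * \<delta> powr q) * ennreal (2 powr (2 * q - 1) * (1 / (p - 1 - lam + 1) + 1 / (2 * q - 2 - (p - 1 - lam))) * \<delta> powr (p - 1 - lam + 2 - 2 * q))"
    unfolding u_def \<delta>_def using lam q by (intro mult_left_mono forelli_rudin a) auto
  also have "\<dots> = ennreal (M\<^sup>2 * (2 powr (2 * q - 1) * (1 / (p - lam) + 1 / q)))"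
  proof -
    have e: "p - 1 - lam + 2 - 2 * q = - q" "2 * q - 2 - (p - 1 - lam) = q" "p - 1 - lam + 1 = p - lam" using q by auto
    have "\<delta> powr q * \<delta> powr - q = 1" using \<delta> by (simp add: powr_add[symmetric])
    then have eq: "M\<^sup>2 * \<delta> powr q * (2 powr (2 * q - 1) * (1 / (p - lam) + 1 / q) * \<delta> powr - q) = M\<^sup>2 * (2 powr (2 * q - 1) * (1 / (p - lam) + 1 / q))"
      by (simp add: mult_ac)
    show ?thesis unfolding e by (subst ennreal_mult'[symmetric]) (simp, simp only: eq)
  qed
  also have "area_integral unit_disc (\<lambda>z. S * \<delta> powr q) = ennreal (S * \<delta> powr q)"
    unfolding area_integral_lborel
    by (subst nn_integral_cmult_indicator)
       (auto simp: emeasure_ball unit_ball_vol_2 S_def ennreal_mult'[symmetric])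
  also have "ennreal (M\<^sup>2 * (2 powr (2 * q - 1) * (1 / (p - lam) + 1 / q))) + ennreal (S * \<delta> powr q)
     = ennreal (M\<^sup>2 * (2 powr (2 * q - 1) * (1 / (p - lam) + 1 / q)) + S * \<delta> powr q)"
    using lam q1 by (subst ennreal_plus) (auto simp: S_def)
  finally show ?thesis by (simp add: S_def \<delta>_def add_right_mono)
qed

section \<open>Comparison of the two limits superior\<close>

lemma Limsup_bloch_weight_le_carleson:
  assumes lam: "0 \<le> lam" "lam \<le> 1" and p: "0 \<le> p" "lam \<le> p + 1" and g: "g holomorphic_on unit_disc"
  shows "Limsup at_unit_circle (\<lambda>z. ennreal (bloch_weight lam g z))
    \<le> ennreal (sqrt (16 * 2 powr p * (25 / 4) powr (p + 1 - lam)))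
      * Limsup at_unit_circle (\<lambda>a. ennreal_sqrt (carleson_kernel_integral p (p + 1 - lam) g a))"
proof (rule le_ennreal_cmultI)
  let ?C = "16 * 2 powr p * (25 / 4) powr (p + 1 - lam)"
  show "0 < sqrt ?C" by simp
  fix M :: real assume M: "0 < M" "Limsup at_unit_circle (\<lambda>a. ennreal_sqrt (carleson_kernel_integral p (p + 1 - lam) g a)) < ennreal M"
  from Limsup_lessD[OF M(2)]
  obtain s0 where s0: "s0 < 1" "\<And>z. s0 < cmod z \<Longrightarrow> cmod z < 1 \<Longrightarrow> ennreal_sqrt (carleson_kernel_integral p (p + 1 - lam) g z) < ennreal M"
    unfolding eventually_at_unit_circle by blast
  have "ennreal (bloch_weight lam g z) \<le> ennreal (sqrt ?C * M)" if z: "s0 < cmod z" "cmod z < 1" for z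
  proof -
    have "carleson_kernel_integral p (p + 1 - lam) g z \<le> ennreal (M\<^sup>2)"
      using iffD1[OF ennreal_sqrt_le_iff less_imp_le[OF s0(2)[OF z]]] M(1) by simp
    then have "ennreal ?C * carleson_kernel_integral p (p + 1 - lam) g z \<le> ennreal ?C * ennreal (M\<^sup>2)"
      by (intro mult_left_mono) auto
    also have "\<dots> = ennreal ((sqrt ?C * M)\<^sup>2)" by (simp add: ennreal_mult'[symmetric] power_mult_distrib)
    finally have "ennreal ((bloch_weight lam g z)\<^sup>2) \<le> ennreal ((sqrt ?C * M)\<^sup>2)"
      using bloch_weight_le_carleson_kernel_integral[OF lam p g z(2)] by (rule order_trans[rotated])
    then have "(bloch_weight lam g z)\<^sup>2 \<le> (sqrt ?C * M)\<^sup>2" by (subst (asm) ennreal_le_iff) auto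
    then have "bloch_weight lam g z \<le> sqrt ?C * M"
      by (rule power2_le_imp_le) (use M in simp)
    then show ?thesis by (rule ennreal_leI)
  qed
  then show "Limsup at_unit_circle (\<lambda>z. ennreal (bloch_weight lam g z)) \<le> ennreal (sqrt ?C * M)"
    using s0(1) by (intro Limsup_bounded) (auto simp: eventually_at_unit_circle)
qed

text \<open>The part over |z| <= s tends to 0 as |a| tends to 1, so it is eventually at most M^2.
  This is the + 1 under the square root.\<close>

lemma Limsup_carleson_le_bloch_weight:
  assumes lam: "lam < p" and p: "0 \<le> p" and g: "g holomorphic_on unit_disc"
  shows "Limsup at_unit_circle (\<lambda>a. ennreal_sqrt (carleson_kernel_integral p (p + 1 - lam) g a))
    \<le> ennreal (sqrt (2 powr (2 * (p + 1 - lam) - 1) * (1 / (p - lam) + 1 / (p + 1 - lam)) + 1))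
      * Limsup at_unit_circle (\<lambda>z. ennreal (bloch_weight lam g z))"
proof (rule le_ennreal_cmultI)
  define q where "q = p + 1 - lam"
  have q: "0 < q" using lam by (simp add: q_def)
  let ?C = "2 powr (2 * q - 1) * (1 / (p - lam) + 1 / q)"
  have C: "0 \<le> ?C" using lam q by simp
  then show "0 < sqrt (2 powr (2 * (p + 1 - lam) - 1) * (1 / (p - lam) + 1 / (p + 1 - lam)) + 1)"
    unfolding q_def by (simp add: add_nonneg_pos)
  fix M :: real assume M: "0 < M" "Limsup at_unit_circle (\<lambda>z. ennreal (bloch_weight lam g z)) < ennreal M"
  from Limsup_lessD[OF M(2)]
  obtain s0 where s0: "s0 < 1" "\<And>z. s0 < cmod z \<Longrightarrow> cmod z < 1 \<Longrightarrow> ennreal (bloch_weight lam g z) < ennreal M"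
    unfolding eventually_at_unit_circle by blast
  define s where "s = max 0 s0"
  have s: "0 \<le> s" "s < 1" using s0 by (auto simp: s_def)
  have outer: "bloch_weight lam g z \<le> M" if "s < cmod z" "cmod z < 1" for z
    using s0(2)[of z] that M(1) by (simp add: s_def ennreal_less_iff bloch_weight_def less_imp_le)
  have "continuous_on (cball 0 s) (deriv g)"
    by (intro holomorphic_on_imp_continuous_on holomorphic_on_subset[OF holomorphic_deriv[OF g]]) (use s in auto)
  then have "bounded (deriv g ` cball 0 s)"
    by (intro compact_imp_bounded compact_continuous_image) auto
  then obtain D where "\<And>z. z \<in> cball 0 s \<Longrightarrow> cmod (deriv g z) \<le> D"
    unfolding bounded_iff by blast
  then have D: "\<And>z. cmod z \<le> s \<Longrightarrow> cmod (deriv g z) \<le> D" by simp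
  define S where "S = D\<^sup>2 * (1 - s) powr (- 2 * q)"
  have S: "0 \<le> S" by (simp add: S_def)
  have "\<forall>\<^sub>F a in at_unit_circle. cmod a < 1 \<and> (1 - (cmod a)\<^sup>2) powr q \<le> M\<^sup>2 / (S + 1)"
    using q S M by (intro eventually_at_unit_circle_powr_le) (auto simp: add_nonneg_pos)
  then have "\<forall>\<^sub>F a in at_unit_circle. ennreal_sqrt (carleson_kernel_integral p q g a) \<le> ennreal (sqrt (?C + 1) * M)"
  proof eventually_elim
    case (elim a)
    have "S * (1 - (cmod a)\<^sup>2) powr q \<le> (S + 1) * (M\<^sup>2 / (S + 1))"
      using elim S by (intro mult_mono) auto
    also have "\<dots> = M\<^sup>2" using S by simp
    finally have SM: "S * (1 - (cmod a)\<^sup>2) powr q \<le> M\<^sup>2" .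
    have "carleson_kernel_integral p q g a \<le> ennreal (M\<^sup>2 * ?C + S * (1 - (cmod a)\<^sup>2) powr q)"
      unfolding S_def by (rule carleson_kernel_integral_le[OF lam q_def p _ g s outer D]) (use elim in auto)
    also have "\<dots> \<le> ennreal ((sqrt (?C + 1) * M)\<^sup>2)"
      using SM C by (intro ennreal_leI) (simp add: power_mult_distrib algebra_simps)
    finally show ?case using M C by (subst ennreal_sqrt_le_iff) auto
  qed
  then show "Limsup at_unit_circle (\<lambda>a. ennreal_sqrt (carleson_kernel_integral p (p + 1 - lam) g a))
    \<le> ennreal (sqrt (2 powr (2 * (p + 1 - lam) - 1) * (1 / (p - lam) + 1 / (p + 1 - lam)) + 1) * M)"
    unfolding q_def[symmetric] by (rule Limsup_bounded)
qed

section \<open>The two-sided estimate\<close>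

theorem theorem5p4:
  fixes lam p :: real
  assumes "0 < lam" and "lam < 1" and "1 < p"
  shows "\<exists>C::real. C > 0 \<and> (\<forall>g. g holomorphic_on unit_disc \<longrightarrow>
    bounded_operator (little_morrey lam) (morrey_norm lam) little_bloch bloch_norm (volterra g) \<longrightarrow>
    (let E = essential_norm (little_morrey lam) (morrey_norm lam) little_bloch bloch_norm (volterra g);
         G = Limsup at_unit_circle (\<lambda>a. ennreal_sqrt (area_integral unit_disc
               (\<lambda>z. ((1 - (cmod a)\<^sup>2) / (cmod (1 - cnj a * z))\<^sup>2) powr (p + 1 - lam) *
                    (cmod (deriv g z))\<^sup>2 * (1 - (cmod z)\<^sup>2) powr p)))
     in ennreal (1 / C) * G \<le> E \<and> E \<le> ennreal C * G))"
proof -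
  define C1 where "C1 = sqrt (16 * 2 powr p * (25 / 4) powr (p + 1 - lam))"
  define C2 where "C2 = sqrt (2 powr (2 * (p + 1 - lam) - 1) * (1 / (p - lam) + 1 / (p + 1 - lam)) + 1)"
  define C3 where "C3 = 4 * (1 + 8 / (1 - lam))"
  have C1: "0 < C1" by (simp add: C1_def)
  have C2: "0 < C2" unfolding C2_def using assms by (simp add: add_nonneg_pos)
  have C3: "0 < C3" unfolding C3_def using assms by (intro mult_pos_pos add_pos_pos) auto
  \<comment> \<open>For the limsup L of \<open>bloch_weight\<close> the chains are E <= C3 L <= C3
    C1 G and G <= C2 L <= 1000 C2 E. All constants are fixed before g.\<close>
  define C where "C = max (C3 * C1) (C2 * 1000)"
  have C: "0 < C" "C3 * C1 \<le> C" "C2 * 1000 \<le> C" using C2 by (auto simp: C_def less_max_iff_disj)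
  show ?thesis
  proof (intro exI[of _ C] conjI allI impI)
    fix g assume g: "g holomorphic_on unit_disc"
      and T: "bounded_operator (little_morrey lam) (morrey_norm lam) little_bloch bloch_norm (volterra g)"
    define E where "E = essential_norm (little_morrey lam) (morrey_norm lam) little_bloch bloch_norm (volterra g)"
    define G where "G = Limsup at_unit_circle (\<lambda>a. ennreal_sqrt (carleson_kernel_integral p (p + 1 - lam) g a))"
    define L where "L = Limsup at_unit_circle (\<lambda>z. ennreal (bloch_weight lam g z))"
    have LG: "L \<le> ennreal C1 * G" unfolding L_def G_def C1_def
      by (rule Limsup_bloch_weight_le_carleson[OF _ _ _ _ g]) (use assms in auto)
    have GL: "G \<le> ennreal C2 * L" unfolding L_def G_def C2_def
      by (rule Limsup_carleson_le_bloch_weight[OF _ _ g]) (use assms in auto)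
    have EL: "E \<le> ennreal C3 * L" unfolding L_def E_def C3_def
      by (rule essential_norm_le_Limsup_bloch_weight[OF assms(1,2) g T])
    have LE: "L \<le> ennreal 1000 * E" unfolding L_def E_def
      by (rule Limsup_bloch_weight_le_essential_norm[OF assms(1,2) g T])
    have "E \<le> ennreal C3 * (ennreal C1 * G)"
      by (rule order_trans[OF EL mult_left_mono[OF LG]]) simp
    also have "\<dots> = ennreal (C3 * C1) * G"
      using C3 by (simp add: ennreal_mult' mult.assoc)
    also have "\<dots> \<le> ennreal C * G" using C by (intro mult_right_mono ennreal_leI) auto
    finally have upper: "E \<le> ennreal C * G" .
    have "G \<le> ennreal C2 * (ennreal 1000 * E)"
      by (rule order_trans[OF GL mult_left_mono[OF LE]]) simp
    also have "\<dots> = ennreal (C2 * 1000) * E"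
      using C2 by (subst ennreal_mult'') (auto simp: mult.assoc)
    also have "\<dots> \<le> ennreal C * E" using C by (intro mult_right_mono ennreal_leI) auto
    finally have "ennreal (1 / C) * G \<le> ennreal (1 / C) * (ennreal C * E)" by (intro mult_left_mono) auto
    also have "\<dots> = E" using C by (simp add: mult.assoc[symmetric] ennreal_mult'[symmetric])
    finally have "ennreal (1 / C) * G \<le> E \<and> E \<le> ennreal C * G" using upper by blast
    then show "let E = essential_norm (little_morrey lam) (morrey_norm lam) little_bloch bloch_norm (volterra g);
         G = Limsup at_unit_circle (\<lambda>a. ennreal_sqrt (area_integral unit_disc
               (\<lambda>z. ((1 - (cmod a)\<^sup>2) / (cmod (1 - cnj a * z))\<^sup>2) powr (p + 1 - lam) *
                    (cmod (deriv g z))\<^sup>2 * (1 - (cmod z)\<^sup>2) powr p)))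
     in ennreal (1 / C) * G \<le> E \<and> E \<le> ennreal C * G"
      unfolding Let_def E_def G_def carleson_kernel_integral_def .
  qed (rule C(1))
qed

end
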